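(* Let $(X,\mathcal A,\mu)$ be a probability space, let $V_n\subset L^2(X,\mu)$ be a subspace of dimension $n$, let $m\geq n$ be an integer, and let $f:X\to\mathbb C$ be measurable. (1) Let $r=\frac{m+1}{n}>1$. Run Algorithm A (defined in the context) with inputs $\varepsilon=r^{-1/4}$ and $\gamma=r^{1/2}-r^{1/4}$, and let $\tilde f$ be the conditional weighted least-squares approximation $\tilde f=P_n^mf\,|\,E$ (defined in the context, with $p=r^{-1/4}$). Then $$\mathbb E\big(\|f-\tilde f\|_{L^2}^2\big)\leq\left(1+\frac{1}{r(1-r^{-1/4})^7}\right)\min_{v\in V_n}\|f-v\|_{L^2}^2 .$$ (2) Suppose $n\geq 2$, let $r=\frac{m}{n-1}>1$ and $\kappa\in[0,1]$. Run Algorithm B (defined in the context) with inputs $\delta=r^{-1/2}$ and $\kappa$, and let $\tilde f=P_n^mf$ be the weighted least-squares estimator based on the resulting points and weights. Then $\tilde f$ simultaneously satisfies $$\mathbb E\big(\|f-\tilde f\|_{L^2}^2\big)\leq\left(1+\frac{1}{1-\kappa}\,\frac{1}{(1-1/\sqrt r)^2}\right)\min_{v\in V_n}\|f-v\|_{L^2}^2\qquad\text{if }\kappa<1,$$ and, if $\kappa>0$ and $V_n\subset L^\infty(X,\mu)$, $$\|f-\tilde f\|_{L^2}\leq\left(1+\frac{1}{\sqrt\kappa}\,\frac{1}{1-1/\sqrt r}\right)\min_{v\in V_n}\|f-v\|_{L^\infty}\qquad\text{almost surely.}$$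
   Context: Notation. $\|g\|_{L^2}=(\int_X|g|^2\,d\mu)^{1/2}$ and $\|\cdot\|_{L^\infty}$ is the essential supremum norm of $L^\infty(X,\mu)$; norms may equal $+\infty$. $\varphi=(\varphi_1,\dots,\varphi_n)$ is an orthonormal basis of $V_n$ in $L^2(X,\mu)$ (with fixed pointwise representatives); $\varphi(x)$ is viewed as a column vector in $\mathbb C^n$, $\varphi(x)^*$ is its conjugate transpose. $I$ is the $n\times n$ identity matrix, $\operatorname{Tr}$ is the trace, and $A\succcurlyeq B$ means that $A-B$ is positive semi-definite. Weighted least squares. Given points $x_1,\dots,x_m\in X$ and weights $s_1,\dots,s_m>0$, $P_n^mf\in\operatorname{arg\,min}_{v\in V_n}\sum_{i=1}^m s_i|f(x_i)-v(x_i)|^2$. The minimizer is unique when $A_m=\sum_{i=1}^m s_i\varphi(x_i)\varphi(x_i)^*$ is invertible. Algorithm A (inputs: $\mu$, $\varepsilon\in(0,1)$, $\gamma\geq0$; put $\eta=\varepsilon/(1-\varepsilon)$). Start with $A_0=0\in\mathbb R^{n\times n}$, $\ell_0=-n$. For $i=1,\dots,m$: let $Y_i=(A_{i-1}-\ell_{i-1}I)^{-1}$, $\Psi_i=\operatorname{Tr}(Y_i)+\gamma$, $\delta_i=\varepsilon/\Psi_i$, $\ell_i=\ell_{i-1}+\delta_i$; let $Z_i=(A_{i-1}-\ell_iI)^{-1}$, $\rho_i(x)=\varphi(x)^*(Z_i+\gamma I/n)\varphi(x)$, $\Xi_i=\operatorname{Tr}(Z_i)+\gamma$; conditionally on $x_1,\dots,x_{i-1}$,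 draw $x_i$ from the probability measure $\frac{\rho_i(x)}{\Xi_i}\,d\mu(x)$; let $s_i=\eta/\rho_i(x_i)$ and $A_i=A_{i-1}+s_i\varphi(x_i)\varphi(x_i)^*$. Output: points $x_1,\dots,x_m$, weights $s_1,\dots,s_m$, matrix $A_m$. Conditional weighted least-squares approximation. For $p\in(0,1)$, let $\alpha=n\left(\frac{\varepsilon r}{1/p+\gamma}-1\right)$ with $r=(m+1)/n$, and let $E$ be the event $\{A_m\succcurlyeq\alpha I\}$, where $A_m$ is the output of Algorithm A; this event has probability at least $1-p$. Then $\tilde f=P_n^mf\,|\,E$ denotes the weighted least-squares projection conditioned on $E$ (Algorithm A is rerun until $E$ occurs and the last sample is used), so that $\mathbb E(\|f-\tilde f\|_{L^2}^2)=\mathbb E(\|f-P_n^mf\|_{L^2}^2\,|\,E)$. Algorithm B (inputs: $\mu$, $\delta\in(0,1)$, $\kappa\in[0,1]$). Start with $A_0=0\in\mathbb R^{n\times n}$, $\ell_0=-n$. For $i=1,\dots,m$: let $Y_i=(A_{i-1}-\ell_{i-1}I)^{-1}$, $\ell_i=\ell_{i-1}+\delta$, $Z_i=(A_{i-1}-\ell_iI)^{-1}$, $W_i=\big(\operatorname{Tr}(Z_i)-\operatorname{Tr}(Y_i)\big)^{-1}Z_i^2-Z_i$, $w_i(x)=\varphi(x)^*W_i\varphi(x)$; let $R_i(x)=w_i(x)$ if $w_i(x)\geq\kappa\frac{1-\delta}{\delta}$ and $R_i(x)=0$ otherwise, and $\Gamma_i=\int_XR_i\,d\mu$; conditionally on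 $x_1,\dots,x_{i-1}$, draw $x_i$ from the probability measure $\frac{R_i(x)}{\Gamma_i}\,d\mu(x)$; let $s_i=1/R_i(x_i)=1/w_i(x_i)$ and $A_i=A_{i-1}+s_i\varphi(x_i)\varphi(x_i)^*$. Output: points $x_1,\dots,x_m$, weights $s_1,\dots,s_m$, matrix $A_m$. *)

theory Defs
  imports "HOL-Probability.Probability"
begin

section \<open>Norms, subspaces of \<open>L\<^sup>2\<close> and orthonormal bases\<close>

text \<open>Norms are extended nonnegative reals, so that they may be infinite.\<close>

definition L2_norm :: "'a measure \<Rightarrow> ('a \<Rightarrow> complex) \<Rightarrow> ennreal" where
  "L2_norm M g =
     (let I = (\<integral>\<^sup>+ x. ennreal ((norm (g x))\<^sup>2) \<partial>M)
      in if I = \<top> then \<top> else ennreal (sqrt (enn2real I)))"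

definition Linf_norm :: "'a measure \<Rightarrow> ('a \<Rightarrow> complex) \<Rightarrow> ennreal" where
  "Linf_norm M g = esssup M (\<lambda>x. ennreal (norm (g x)))"

definition L2_space :: "'a measure \<Rightarrow> ('a \<Rightarrow> complex) set" where
  "L2_space M = {g \<in> borel_measurable M. L2_norm M g < \<top>}"

definition Linf_space :: "'a measure \<Rightarrow> ('a \<Rightarrow> complex) set" where
  "Linf_space M = {g \<in> borel_measurable M. Linf_norm M g < \<top>}"

text \<open>
  A subspace of \<open>L\<^sup>2\<close> is given by a complex-linear space of square-integrable functions.
  Such a set may, but need not, contain all representatives of its almost-everywhere classes.
\<close>

definition L2_subspace :: "'a measure \<Rightarrow> ('a \<Rightarrow> complex) set \<Rightarrow> bool" where
  "L2_subspace M V \<longleftrightarrow>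
     V \<subseteq> L2_space M \<and>
     (\<lambda>x. 0) \<in> V \<and>
     (\<forall>u\<in>V. \<forall>v\<in>V. (\<lambda>x. u x + v x) \<in> V) \<and>
     (\<forall>c. \<forall>v\<in>V. (\<lambda>x. c * v x) \<in> V)"

definition lin_comb :: "('a \<Rightarrow> complex^'n) \<Rightarrow> complex^'n \<Rightarrow> 'a \<Rightarrow> complex" where
  "lin_comb \<phi> c x = (\<Sum>j\<in>UNIV. c $ j * \<phi> x $ j)"

text \<open>
  The basis functions are the components of \<open>\<phi>\<close>.  Equality of functions in \<open>L\<^sup>2\<close> is equality
  almost everywhere, so \<open>V\<close> has dimension \<open>CARD('n)\<close> as a subspace of \<open>L\<^sup>2\<close>.
\<close>

definition L2_orthonormal_basis ::
    "'a measure \<Rightarrow> ('a \<Rightarrow> complex) set \<Rightarrow> ('a \<Rightarrow> complex^'n) \<Rightarrow> bool" where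
  "L2_orthonormal_basis M V \<phi> \<longleftrightarrow>
     (\<forall>j. (\<lambda>x. \<phi> x $ j) \<in> V) \<and>
     (\<forall>j k. (\<integral>x. \<phi> x $ j * cnj (\<phi> x $ k) \<partial>M) = (if j = k then 1 else 0)) \<and>
     (\<forall>v\<in>V. \<exists>c. AE x in M. v x = lin_comb \<phi> c x)"


section \<open>Matrices\<close>

text \<open>\<open>qform B v\<close> is \<open>v\<^sup>* B v\<close>, and \<open>outer v\<close> is \<open>v v\<^sup>*\<close>.\<close>

definition qform :: "complex^'n^'n \<Rightarrow> complex^'n \<Rightarrow> complex" where
  "qform B v = (\<Sum>i\<in>UNIV. \<Sum>j\<in>UNIV. cnj (v $ i) * B $ i $ j * v $ j)"

definition outer :: "complex^'n \<Rightarrow> complex^'n^'n" where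
  "outer v = (\<chi> i j. v $ i * cnj (v $ j))"

text \<open>Over the complex numbers, a real-valued quadratic form forces \<open>B\<close> to be Hermitian.\<close>

definition psd :: "complex^'n^'n \<Rightarrow> bool" where
  "psd B \<longleftrightarrow> (\<forall>v. qform B v \<in> \<real> \<and> 0 \<le> Re (qform B v))"

text \<open>
  All matrices below are Hermitian, hence their traces and quadratic forms are real; the real
  part only adjusts the type.
\<close>

definition rtrace :: "complex^'n^'n \<Rightarrow> real" where
  "rtrace B = Re (trace B)"

definition resolvent :: "complex^'n^'n \<Rightarrow> real \<Rightarrow> complex^'n^'n" where
  "resolvent A l = matrix_inv (A - l *\<^sub>R mat 1)"


section \<open>Weighted least squares\<close>

text \<open>
  Points and weights are indexed by \<open>1, \<dots>, m\<close>.  Since point values are needed, \<open>v\<close> ranges over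
  the linear combinations of the fixed representatives \<open>\<phi>\<close>.
\<close>

definition wls :: "('a \<Rightarrow> complex^'n) \<Rightarrow> nat \<Rightarrow> (nat \<Rightarrow> 'a) \<Rightarrow> (nat \<Rightarrow> real) \<Rightarrow>
    ('a \<Rightarrow> complex) \<Rightarrow> 'a \<Rightarrow> complex" where
  "wls \<phi> m x s f =
     arg_min (\<lambda>v. \<Sum>i=1..m. s i * (norm (f (x i) - v (x i)))\<^sup>2) (\<lambda>v. v \<in> range (lin_comb \<phi>))"


section \<open>Sequential sampling\<close>

text \<open>
  \<open>seq_law M K m\<close> is the joint law of \<open>x 1, \<dots>, x m\<close> when, for each \<open>i\<close>, the point \<open>x i\<close> is
  drawn from \<open>K i x\<close> conditionally on \<open>x 1, \<dots>, x (i - 1)\<close>; the kernel \<open>K i x\<close> must only depend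
  on these entries of \<open>x\<close>.
\<close>

primrec seq_law :: "'a measure \<Rightarrow> (nat \<Rightarrow> (nat \<Rightarrow> 'a) \<Rightarrow> 'a measure) \<Rightarrow> nat \<Rightarrow>
    (nat \<Rightarrow> 'a) measure" where
  "seq_law M K 0 = return (PiM {1..0} (\<lambda>_. M)) (\<lambda>_. undefined)"
| "seq_law M K (Suc i) =
     seq_law M K i \<bind>
       (\<lambda>x. distr (K (Suc i) x) (PiM {1..Suc i} (\<lambda>_. M)) (\<lambda>y. x(Suc i := y)))"


section \<open>Algorithm A\<close>

text \<open>
  Below, \<open>A\<close> and \<open>l\<close> stand for \<open>A\<^bsub>i-1\<^esub>\<close> and \<open>\<ell>\<^bsub>i-1\<^esub>\<close>, while \<open>l'\<close> stands for \<open>\<ell>\<^bsub>i\<^esub>\<close>; thus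
  \<open>resolvent A l\<close> is \<open>Y\<^bsub>i\<^esub>\<close> and \<open>resolvent A l'\<close> is \<open>Z\<^bsub>i\<^esub>\<close>.
\<close>

definition barrier_A :: "real \<Rightarrow> real \<Rightarrow> complex^'n^'n \<Rightarrow> real \<Rightarrow> real" where
  "barrier_A \<epsilon> \<gamma> A l = l + \<epsilon> / (rtrace (resolvent A l) + \<gamma>)"

definition rho_A :: "('a \<Rightarrow> complex^'n) \<Rightarrow> real \<Rightarrow> complex^'n^'n \<Rightarrow> real \<Rightarrow> 'a \<Rightarrow> real" where
  "rho_A \<phi> \<gamma> A l' y =
     Re (qform (resolvent A l' + (\<gamma> / real CARD('n)) *\<^sub>R mat 1) (\<phi> y))"

definition Xi_A :: "real \<Rightarrow> complex^'n^'n \<Rightarrow> real \<Rightarrow> real" where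
  "Xi_A \<gamma> A l' = rtrace (resolvent A l') + \<gamma>"

definition eta :: "real \<Rightarrow> real" where
  "eta \<epsilon> = \<epsilon> / (1 - \<epsilon>)"

text \<open>\<open>state_A \<phi> \<epsilon> \<gamma> x i\<close> is the pair \<open>(A\<^bsub>i\<^esub>, \<ell>\<^bsub>i\<^esub>)\<close> when the points drawn are \<open>x\<close>.\<close>

primrec state_A :: "('a \<Rightarrow> complex^'n) \<Rightarrow> real \<Rightarrow> real \<Rightarrow> (nat \<Rightarrow> 'a) \<Rightarrow> nat \<Rightarrow>
    (complex^'n^'n) \<times> real" where
  "state_A \<phi> \<epsilon> \<gamma> x 0 = (0, - real CARD('n))"
| "state_A \<phi> \<epsilon> \<gamma> x (Suc i) =
     (let A = fst (state_A \<phi> \<epsilon> \<gamma> x i); l = snd (state_A \<phi> \<epsilon> \<gamma> x i);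
          l' = barrier_A \<epsilon> \<gamma> A l;
          y = x (Suc i)
      in (A + (eta \<epsilon> / rho_A \<phi> \<gamma> A l' y) *\<^sub>R outer (\<phi> y), l'))"

definition matrix_A :: "('a \<Rightarrow> complex^'n) \<Rightarrow> real \<Rightarrow> real \<Rightarrow> (nat \<Rightarrow> 'a) \<Rightarrow> nat \<Rightarrow>
    complex^'n^'n" where
  "matrix_A \<phi> \<epsilon> \<gamma> x i = fst (state_A \<phi> \<epsilon> \<gamma> x i)"

text \<open>
  The barrier \<open>\<ell>\<^bsub>i\<^esub>\<close> is computed from \<open>A\<^bsub>i-1\<^esub>\<close> and \<open>\<ell>\<^bsub>i-1\<^esub>\<close> only, since it is needed before
  \<open>x i\<close> is drawn.  Both definitions below are meant for \<open>i \<ge> 1\<close>.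
\<close>

definition weight_A :: "('a \<Rightarrow> complex^'n) \<Rightarrow> real \<Rightarrow> real \<Rightarrow> (nat \<Rightarrow> 'a) \<Rightarrow> nat \<Rightarrow> real" where
  "weight_A \<phi> \<epsilon> \<gamma> x i =
     (let (A, l) = state_A \<phi> \<epsilon> \<gamma> x (i - 1)
      in eta \<epsilon> / rho_A \<phi> \<gamma> A (barrier_A \<epsilon> \<gamma> A l) (x i))"

definition kernel_A :: "'a measure \<Rightarrow> ('a \<Rightarrow> complex^'n) \<Rightarrow> real \<Rightarrow> real \<Rightarrow> nat \<Rightarrow>
    (nat \<Rightarrow> 'a) \<Rightarrow> 'a measure" where
  "kernel_A M \<phi> \<epsilon> \<gamma> i x =
     (let (A, l) = state_A \<phi> \<epsilon> \<gamma> x (i - 1); l' = barrier_A \<epsilon> \<gamma> A l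
      in density M (\<lambda>y. ennreal (rho_A \<phi> \<gamma> A l' y / Xi_A \<gamma> A l')))"

definition law_A :: "'a measure \<Rightarrow> ('a \<Rightarrow> complex^'n) \<Rightarrow> real \<Rightarrow> real \<Rightarrow> nat \<Rightarrow>
    (nat \<Rightarrow> 'a) measure" where
  "law_A M \<phi> \<epsilon> \<gamma> m = seq_law M (kernel_A M \<phi> \<epsilon> \<gamma>) m"

text \<open>
  The event \<open>A\<^bsub>m\<^esub> \<succeq> \<alpha> I\<close>.  Conditioning on it is expressed by \<open>uniform_measure\<close>, the
  normalised restriction of a measure to an event.
\<close>

definition event_A :: "'a measure \<Rightarrow> ('a \<Rightarrow> complex^'n) \<Rightarrow> real \<Rightarrow> real \<Rightarrow> real \<Rightarrow> nat \<Rightarrow>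
    (nat \<Rightarrow> 'a) set" where
  "event_A M \<phi> \<epsilon> \<gamma> p m =
     (let n = real CARD('n);
          r = (real m + 1) / n;
          \<alpha> = n * (\<epsilon> * r / (1 / p + \<gamma>) - 1)
      in {x \<in> space (law_A M \<phi> \<epsilon> \<gamma> m). psd (matrix_A \<phi> \<epsilon> \<gamma> x m - \<alpha> *\<^sub>R mat 1)})"

definition cond_law_A :: "'a measure \<Rightarrow> ('a \<Rightarrow> complex^'n) \<Rightarrow> real \<Rightarrow> real \<Rightarrow> real \<Rightarrow> nat \<Rightarrow>
    (nat \<Rightarrow> 'a) measure" where
  "cond_law_A M \<phi> \<epsilon> \<gamma> p m = uniform_measure (law_A M \<phi> \<epsilon> \<gamma> m) (event_A M \<phi> \<epsilon> \<gamma> p m)"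


section \<open>Algorithm B\<close>

text \<open>As before, \<open>A\<close> and \<open>l\<close> stand for \<open>A\<^bsub>i-1\<^esub>\<close> and \<open>\<ell>\<^bsub>i-1\<^esub>\<close>, and \<open>\<ell>\<^bsub>i\<^esub> = l + \<delta>\<close>.\<close>

definition W_B :: "real \<Rightarrow> complex^'n^'n \<Rightarrow> real \<Rightarrow> complex^'n^'n" where
  "W_B \<delta> A l =
     (let Y = resolvent A l; Z = resolvent A (l + \<delta>)
      in inverse (rtrace Z - rtrace Y) *\<^sub>R (Z ** Z) - Z)"

definition w_B :: "('a \<Rightarrow> complex^'n) \<Rightarrow> real \<Rightarrow> complex^'n^'n \<Rightarrow> real \<Rightarrow> 'a \<Rightarrow> real" where
  "w_B \<phi> \<delta> A l y = Re (qform (W_B \<delta> A l) (\<phi> y))"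

definition R_B :: "('a \<Rightarrow> complex^'n) \<Rightarrow> real \<Rightarrow> real \<Rightarrow> complex^'n^'n \<Rightarrow> real \<Rightarrow> 'a \<Rightarrow> real" where
  "R_B \<phi> \<delta> \<kappa> A l y =
     (if w_B \<phi> \<delta> A l y \<ge> \<kappa> * ((1 - \<delta>) / \<delta>) then w_B \<phi> \<delta> A l y else 0)"

definition Gamma_B :: "'a measure \<Rightarrow> ('a \<Rightarrow> complex^'n) \<Rightarrow> real \<Rightarrow> real \<Rightarrow> complex^'n^'n \<Rightarrow>
    real \<Rightarrow> real" where
  "Gamma_B M \<phi> \<delta> \<kappa> A l = (\<integral>y. R_B \<phi> \<delta> \<kappa> A l y \<partial>M)"

primrec state_B :: "('a \<Rightarrow> complex^'n) \<Rightarrow> real \<Rightarrow> real \<Rightarrow> (nat \<Rightarrow> 'a) \<Rightarrow> nat \<Rightarrow>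
    (complex^'n^'n) \<times> real" where
  "state_B \<phi> \<delta> \<kappa> x 0 = (0, - real CARD('n))"
| "state_B \<phi> \<delta> \<kappa> x (Suc i) =
     (let A = fst (state_B \<phi> \<delta> \<kappa> x i); l = snd (state_B \<phi> \<delta> \<kappa> x i); y = x (Suc i)
      in (A + (1 / R_B \<phi> \<delta> \<kappa> A l y) *\<^sub>R outer (\<phi> y), l + \<delta>))"

definition weight_B :: "('a \<Rightarrow> complex^'n) \<Rightarrow> real \<Rightarrow> real \<Rightarrow> (nat \<Rightarrow> 'a) \<Rightarrow> nat \<Rightarrow> real" where
  "weight_B \<phi> \<delta> \<kappa> x i =
     (let (A, l) = state_B \<phi> \<delta> \<kappa> x (i - 1) in 1 / R_B \<phi> \<delta> \<kappa> A l (x i))"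

definition kernel_B :: "'a measure \<Rightarrow> ('a \<Rightarrow> complex^'n) \<Rightarrow> real \<Rightarrow> real \<Rightarrow> nat \<Rightarrow>
    (nat \<Rightarrow> 'a) \<Rightarrow> 'a measure" where
  "kernel_B M \<phi> \<delta> \<kappa> i x =
     (let (A, l) = state_B \<phi> \<delta> \<kappa> x (i - 1)
      in density M (\<lambda>y. ennreal (R_B \<phi> \<delta> \<kappa> A l y / Gamma_B M \<phi> \<delta> \<kappa> A l)))"

definition law_B :: "'a measure \<Rightarrow> ('a \<Rightarrow> complex^'n) \<Rightarrow> real \<Rightarrow> real \<Rightarrow> nat \<Rightarrow>
    (nat \<Rightarrow> 'a) measure" where
  "law_B M \<phi> \<delta> \<kappa> m = seq_law M (kernel_B M \<phi> \<delta> \<kappa>) m"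

end

theory Submission
  imports Defs
begin

text \<open>
  Write \<open>f = g + v\<close> with \<open>v\<close> the orthogonal projection of \<open>f\<close> onto \<open>V\<close>. The least-squares estimator
  reproduces \<open>v\<close>, so its squared error is the sum of the squared norms of \<open>g\<close> and of the estimator
  of \<open>g\<close>. The latter is controlled by a lower bound on \<open>A\<^sub>m\<close>, which comes from a barrier argument:
  \<open>A\<^sub>i - \<ell>\<^sub>i I\<close> stays positive definite, and the potential \<open>Tr (A\<^sub>i - \<ell>\<^sub>i I)\<^sup>-\<^sup>1\<close> is a supermartingale for
  algorithm A and constantly 1 for algorithm B. For algorithm A, Markov's inequality for the average
  potential gives the probability of \<open>E\<close>, and the right-hand sides \<open>s\<^sub>i g(x\<^sub>i) \<phi>(x\<^sub>i)\<close> of the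
  normal equations are martingale differences, which yields the decay \<open>1 / r\<close>. For algorithm B,
  the threshold bounds the weights, which gives the almost sure estimate, and the lower bound
  \<open>(1 - \<kappa>) (1 - \<delta>) / \<delta>\<close> on \<open>\<Gamma>\<^sub>i\<close> gives the estimate in expectation.
\<close>


section \<open>Hermitian matrices and traces of resolvents\<close>

text \<open>Hermitian matrices are handled as selfadjoint operators for the real inner product of
  \<open>complex^'n\<close>. Eigenvalues never occur; the smallest one is replaced by the bound 1 /
  Tr B^-1 of \<open>posdef_lower_bound\<close>.

  A step raises the barrier, which increases the trace of the inverse, and then adds a rank-one
  term, which decreases it. The sampling densities are designed so that the second effect
  compensates the first. That there is room for this is, in both algorithms, the trace inequality
  (Tr ZY)^2 \<le> Tr(ZYZ) Tr Y.

  The summand \<gamma> I / n in \<open>rho_A\<close> keeps the density above a multiple of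
  |\<phi>|^2, so each term of the right-hand side has a bounded conditional second moment. Dividing
  the sum of m such moments by \<alpha>^2 leaves (m/n) q^8 with q = r^(-1/4), up to powers of 1 - q;
  this is the decay 1 / r.

  Division by zero yields zero. This is harmless for algorithm A, where the density vanishes only
  together with \<phi>. For algorithm B the invariant is established only along histories with
  positive \<open>R_B\<close>, so this property (\<open>admissible\<close>) is carried along almost
  surely.\<close>

lemma inner_complex_Re: "(x::complex) \<bullet> y = Re (cnj x * y)"
  by (simp add: inner_complex_def)

lemma Re_qform: "Re (qform B v) = v \<bullet> (B *v v)"
  by (simp add: qform_def inner_vec_def inner_complex_Re matrix_vector_mult_def sum_distrib_left
      mult.assoc flip: Re_sum)

lemma scaleR_matrix_mult_vec: "(k *\<^sub>R (B :: complex^'n^'m)) *v x = k *\<^sub>R (B *v x)"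
  by (simp add: matrix_vector_mult_def vec_eq_iff scaleR_sum_right)

lemma matrix_mult_scaleR_vec: "(B :: complex^'n^'m) *v (k *\<^sub>R x) = k *\<^sub>R (B *v x)"
  by (simp add: matrix_vector_mult_def vec_eq_iff scaleR_sum_right)

lemma matrix_diff_ldistrib: "(A :: complex^'m^'n) ** (B - C) = A ** B - A ** C"
  by (simp add: matrix_matrix_mult_def vec_eq_iff algebra_simps sum_subtractf)

lemma matrix_diff_rdistrib: "(B - C) ** (A :: complex^'m^'n)  = B ** A - C ** A"
  by (simp add: matrix_matrix_mult_def vec_eq_iff algebra_simps sum_subtractf)

lemma matrix_add_rdistrib: "(B + C) ** (A :: complex^'m^'n)  = B ** A + C ** A"
  by (simp add: matrix_matrix_mult_def vec_eq_iff algebra_simps sum.distrib)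

lemma matrix_scaleR_left: "(k *\<^sub>R (A :: complex^'m^'n)) ** B = k *\<^sub>R (A ** B)"
  by (simp add: scalar_matrix_assoc)

lemma matrix_scaleR_right: "(A :: complex^'m^'n) ** (k *\<^sub>R B) = k *\<^sub>R (A ** B)"
  by (simp add: matrix_scalar_ac scalar_matrix_assoc)

lemmas matrix_simps =
  matrix_diff_ldistrib matrix_diff_rdistrib matrix_add_ldistrib matrix_add_rdistrib
  matrix_scaleR_left matrix_scaleR_right

lemma rtrace_add: "rtrace (A + B) = rtrace A + rtrace B"
  by (simp add: rtrace_def trace_add)

lemma rtrace_diff: "rtrace (A - B) = rtrace A - rtrace B"
  by (simp add: rtrace_def trace_sub)

lemma rtrace_scaleR: "rtrace (k *\<^sub>R A) = k * rtrace A"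
  by (simp add: rtrace_def trace_def sum_distrib_left)

lemma rtrace_mat1: "rtrace (mat 1 :: complex^'n^'n) = real CARD('n)"
  by (simp add: rtrace_def trace_I)

lemma rtrace_mult_comm: "rtrace (A ** B) = rtrace (B ** A)"
  unfolding rtrace_def trace_mul_sym[of A B] ..

lemmas rtrace_simps = rtrace_add rtrace_diff rtrace_scaleR rtrace_mat1

lemma inner_axis_matrix_axis: "axis i a \<bullet> (B *v axis j b) = Re (cnj a * B $ i $ j * b)"
proof -
  have "(B *v axis j b) $ i = B $ i $ j * b"
    by (simp add: matrix_vector_mult_def axis_def if_distrib[of "\<lambda>x. y * x" for y] cong: if_cong)
  moreover have "axis i a \<bullet> (B *v axis j b) = a \<bullet> (B *v axis j b) $ i"
    by (simp add: inner_axis')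
  ultimately show ?thesis by (simp add: inner_complex_Re mult.assoc)
qed

lemma rtrace_inner: "rtrace B = (\<Sum>j\<in>UNIV. axis j 1 \<bullet> (B *v axis j 1))"
  by (simp add: inner_axis_matrix_axis rtrace_def trace_def)

text \<open>Selfadjointness with respect to the real inner product is the same as being Hermitian.\<close>

definition selfadj :: "complex^'n^'n \<Rightarrow> bool" where
  "selfadj B \<longleftrightarrow> (\<forall>x y. (B *v x) \<bullet> y = x \<bullet> (B *v y))"

definition posdef :: "complex^'n^'n \<Rightarrow> bool" where
  "posdef B \<longleftrightarrow> selfadj B \<and> (\<forall>x. x \<noteq> 0 \<longrightarrow> 0 < x \<bullet> (B *v x))"

lemma selfadjD: "selfadj B \<Longrightarrow> (B *v x) \<bullet> y = x \<bullet> (B *v y)"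
  by (simp add: selfadj_def)

lemma selfadj_simps:
  "selfadj A \<Longrightarrow> selfadj B \<Longrightarrow> selfadj (A + B)"
  "selfadj A \<Longrightarrow> selfadj B \<Longrightarrow> selfadj (A - B)"
  "selfadj A \<Longrightarrow> selfadj (k *\<^sub>R A)"
  "selfadj (mat 1)"
  "selfadj 0"
  by (simp_all add: selfadj_def matrix_vector_mult_add_rdistrib matrix_vector_mult_diff_rdistrib
      scaleR_matrix_mult_vec inner_simps)

lemma outer_mult_vec: "outer v *v x = (\<Sum>j\<in>UNIV. cnj (v $ j) * x $ j) *s v"
  by (simp add: outer_def matrix_vector_mult_def vec_eq_iff sum_distrib_left sum_distrib_right
      mult_ac)

lemma inner_outer: "x \<bullet> (outer v *v y) =
    Re (cnj (\<Sum>j\<in>UNIV. cnj (v $ j) * x $ j) * (\<Sum>j\<in>UNIV. cnj (v $ j) * y $ j))"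
proof -
  have "x \<bullet> (outer v *v y) = Re (\<Sum>i\<in>UNIV. cnj (x $ i) * v $ i * (\<Sum>j\<in>UNIV. cnj (v $ j) * y $ j))"
    unfolding outer_mult_vec inner_vec_def inner_complex_Re by (simp add: mult_ac)
  then show ?thesis
    by (simp add: sum_distrib_right mult_ac)
qed

lemma inner_outer_self: "x \<bullet> (outer v *v x) = (cmod (\<Sum>j\<in>UNIV. cnj (v $ j) * x $ j))\<^sup>2"
  unfolding inner_outer inner_complex_Re[symmetric] by (simp add: dot_square_norm)

lemma selfadj_outer: "selfadj (outer v)"
proof -
  have "(outer v *v x) \<bullet> y = x \<bullet> (outer v *v y)" for x y
    unfolding inner_commute[of "outer v *v x"] inner_outer inner_complex_Re[symmetric]
    by (rule inner_commute)
  then show ?thesis by (simp add: selfadj_def)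
qed

text \<open>Test real selfadjointness on the pair \<open>\<i> *s v\<close>, \<open>v\<close>: since
  B is complex linear, one side is the imaginary part of \<open>qform B v\<close> and the other is
  its negative.\<close>

lemma selfadj_qform_Reals:
  assumes "selfadj B"
  shows "qform B v \<in> \<real>"
proof -
  have q: "qform B v = (\<Sum>i\<in>UNIV. cnj (v $ i) * (B *v v) $ i)"
    by (simp add: qform_def matrix_vector_mult_def sum_distrib_left mult.assoc)
  have inner: "x \<bullet> y = Re (\<Sum>i\<in>UNIV. cnj (x $ i) * y $ i)" for x y :: "complex^'a"
    by (simp add: inner_vec_def inner_complex_Re)
  have "(\<i> *s v) \<bullet> (B *v v) = Re (- \<i> * qform B v)"
    unfolding q inner sum_distrib_left by (simp add: mult.assoc)
  then have eq: "Im (qform B v) = (\<i> *s v) \<bullet> (B *v v)"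
    by simp
  have "B *v (\<i> *s v) = \<i> *s (B *v v)"
    by (simp add: vec_eq_iff matrix_vector_mult_def sum_distrib_left mult_ac)
  then have "v \<bullet> (B *v (\<i> *s v)) = Re (\<i> * qform B v)"
    unfolding q inner sum_distrib_left by (simp add: mult_ac)
  then have "v \<bullet> (B *v (\<i> *s v)) = - Im (qform B v)"
    by simp
  with eq selfadjD[OF assms, of "\<i> *s v" v] have "Im (qform B v) = 0"
    by (simp add: inner_commute)
  then show ?thesis by (simp add: complex_is_Real_iff)
qed

section \<open>Inverses, positive definiteness and rank-one updates\<close>

lemma matrix_inv_eqI:
  fixes B C :: "complex^'n^'n"
  assumes "B ** C = mat 1"
  shows "matrix_inv B = C"
proof -
  have CB: "C ** B = mat 1" using assms matrix_left_right_inverse by blast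
  have "\<exists>A'. B ** A' = mat 1 \<and> A' ** B = mat 1" using assms CB by blast
  then have "B ** matrix_inv B = mat 1 \<and> matrix_inv B ** B = mat 1"
    unfolding matrix_inv_def by (rule someI_ex)
  then show ?thesis
    by (metis CB matrix_mul_assoc matrix_mul_lid matrix_mul_rid)
qed

lemma posdef_selfadj: "posdef B \<Longrightarrow> selfadj B"
  and posdef_pos: "posdef B \<Longrightarrow> x \<noteq> 0 \<Longrightarrow> 0 < x \<bullet> (B *v x)"
  by (simp_all add: posdef_def)

lemma posdef_nonneg: "posdef B \<Longrightarrow> 0 \<le> x \<bullet> (B *v x)"
  by (cases "x = 0") (auto simp: posdef_def intro: less_imp_le)

text \<open>The kernel of B is trivial, hence B is invertible. The form of the inverse at x is the
  form of B at the solution y of B y = x, so selfadjointness and positivity carry over.\<close>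

lemma posdef_inv:
  fixes B :: "complex^'n^'n"
  assumes "posdef B"
  shows "B ** matrix_inv B = mat 1" "matrix_inv B ** B = mat 1" "posdef (matrix_inv B)"
proof -
  have "\<forall>x. B *v x = 0 \<longrightarrow> x = 0"
    using posdef_pos[OF assms] by force
  then obtain C where C: "C ** B = mat 1"
    using matrix_left_invertible_ker by blast
  then have C': "B ** C = mat 1" using matrix_left_right_inverse by blast
  have inv: "matrix_inv B = C" by (rule matrix_inv_eqI[OF C'])
  show "B ** matrix_inv B = mat 1" "matrix_inv B ** B = mat 1"
    using C C' inv by auto
  have BC: "B *v (C *v x) = x" for x
    by (simp add: matrix_vector_mul_assoc C')
  have "(C *v x) \<bullet> y = x \<bullet> (C *v y)" for x y
    by (metis BC posdef_selfadj[OF assms] selfadjD)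
  moreover have "0 < x \<bullet> (C *v x)" if "x \<noteq> 0" for x
  proof -
    have "C *v x \<noteq> 0" using that BC[of x] by auto
    from posdef_pos[OF assms this] show ?thesis by (simp add: BC inner_commute)
  qed
  ultimately show "posdef (matrix_inv B)"
    unfolding inv posdef_def selfadj_def by blast
qed

text \<open>The real parts of the diagonal entries are values of the form of B at the vectors P e_j.
  Trace inequalities follow from this without square roots of matrices.\<close>

lemma rtrace_PBP_nonneg:
  assumes "selfadj P" "\<And>x. 0 \<le> x \<bullet> (B *v x)"
  shows "0 \<le> rtrace (P ** B ** P)"
proof -
  have "axis j 1 \<bullet> ((P ** B ** P) *v axis j 1) = (P *v axis j 1) \<bullet> (B *v (P *v axis j 1))" for j
    by (simp add: selfadjD[OF assms(1)] flip: matrix_vector_mul_assoc)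
  then show ?thesis
    unfolding rtrace_inner by (simp add: assms(2) sum_nonneg)
qed

lemma posdef_rtrace_pos:
  assumes "posdef B"
  shows "0 < rtrace B"
  unfolding rtrace_inner
  by (rule sum_pos) (auto intro!: posdef_pos[OF assms] simp: axis_eq_0_iff)

text \<open>
  The difference of the two sides is half the sum over \<open>i\<close> and \<open>j\<close> of the quadratic form of \<open>B\<close>
  at the vectors \<open>cnj x\<^sub>j e\<^sub>i - cnj x\<^sub>i e\<^sub>j\<close>.
\<close>

lemma inner_le_rtrace:
  fixes B :: "complex^'n^'n"
  assumes "\<And>x. 0 \<le> x \<bullet> (B *v x)"
  shows "x \<bullet> (B *v x) \<le> rtrace B * (norm x)\<^sup>2"
proof -
  define w where "w i j = axis i (cnj (x $ j)) - axis j (cnj (x $ i))" for i j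
  have c: "(cmod z)\<^sup>2 = Re z * Re z + Im z * Im z" for z
    unfolding cmod_power2 by (simp add: power2_eq_square)
  have w: "w i j \<bullet> (B *v w i j) = (cmod (x $ j))\<^sup>2 * Re (B $ i $ i) + (cmod (x $ i))\<^sup>2 * Re (B $ j $ j)
      - Re (cnj (x $ i) * B $ i $ j * x $ j) - Re (cnj (x $ j) * B $ j $ i * x $ i)" for i j
    by (simp add: w_def inner_axis_matrix_axis matrix_vector_mult_diff_distrib inner_simps c
        algebra_simps)
  have q: "(\<Sum>i\<in>UNIV. \<Sum>j\<in>UNIV. Re (cnj (x $ i) * B $ i $ j * x $ j)) = x \<bullet> (B *v x)"
    unfolding Re_qform[symmetric] by (simp add: qform_def)
  have q': "(\<Sum>i\<in>UNIV. \<Sum>j\<in>UNIV. Re (cnj (x $ j) * B $ j $ i * x $ i)) = x \<bullet> (B *v x)"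
    by (subst sum.swap) (rule q)
  have n: "(norm x)\<^sup>2 = (\<Sum>i\<in>UNIV. (cmod (x $ i))\<^sup>2)"
    by (simp add: norm_vec_def L2_set_def sum_nonneg)
  have t: "rtrace B = (\<Sum>i\<in>UNIV. Re (B $ i $ i))"
    by (simp add: rtrace_def trace_def)
  have t1: "(\<Sum>i\<in>UNIV. \<Sum>j\<in>UNIV. (cmod (x $ j))\<^sup>2 * Re (B $ i $ i)) = rtrace B * (norm x)\<^sup>2"
    unfolding n t by (simp add: sum_product mult.commute)
  have t2: "(\<Sum>i\<in>UNIV. \<Sum>j\<in>UNIV. (cmod (x $ i))\<^sup>2 * Re (B $ j $ j)) = rtrace B * (norm x)\<^sup>2"
    by (subst sum.swap) (rule t1)
  have "0 \<le> (\<Sum>i\<in>UNIV. \<Sum>j\<in>UNIV. w i j \<bullet> (B *v w i j))"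
    by (intro sum_nonneg assms)
  also have "\<dots> = 2 * (rtrace B * (norm x)\<^sup>2) - 2 * (x \<bullet> (B *v x))"
    unfolding w sum.distrib sum_subtractf t1 t2 q q' by simp
  finally show ?thesis by simp
qed

lemma posdef_cauchy_schwarz:
  assumes "posdef B"
  shows "(x \<bullet> (B *v y))\<^sup>2 \<le> (x \<bullet> (B *v x)) * (y \<bullet> (B *v y))"
proof (cases "x = 0")
  case False
  then have p: "0 < x \<bullet> (B *v x)" by (rule posdef_pos[OF assms])
  have s: "y \<bullet> (B *v x) = x \<bullet> (B *v y)"
    using selfadjD[OF posdef_selfadj[OF assms], of x y] by (simp add: inner_commute)
  \<comment> \<open>Minimiser of the form of B at y - t x over real t.\<close>
  define t where "t = (x \<bullet> (B *v y)) / (x \<bullet> (B *v x))"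
  have "0 \<le> (y - t *\<^sub>R x) \<bullet> (B *v (y - t *\<^sub>R x))"
    by (rule posdef_nonneg[OF assms])
  also have "\<dots> = y \<bullet> (B *v y) - 2 * t * (x \<bullet> (B *v y)) + t\<^sup>2 * (x \<bullet> (B *v x))"
    by (simp add: matrix_vector_mult_diff_distrib matrix_mult_scaleR_vec inner_simps s power2_eq_square
        algebra_simps)
  also have "\<dots> = y \<bullet> (B *v y) - (x \<bullet> (B *v y))\<^sup>2 / (x \<bullet> (B *v x))"
    using p by (simp add: t_def field_simps power2_eq_square)
  finally show ?thesis using p by (simp add: field_simps)
qed simp

text \<open>Cauchy-Schwarz for the form of B at x and B^-1 x, followed by
  \<open>inner_le_rtrace\<close> for the inverse. In spectral terms, the smallest eigenvalue of B is
  at least 1 / Tr B^-1.\<close>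

lemma posdef_lower_bound:
  assumes "posdef B"
  shows "(norm x)\<^sup>2 \<le> rtrace (matrix_inv B) * (x \<bullet> (B *v x))"
proof (cases "x = 0")
  case False
  let ?Y = "matrix_inv B"
  have Y: "posdef ?Y" by (rule posdef_inv[OF assms])
  have "B *v (?Y *v x) = x"
    by (simp add: matrix_vector_mul_assoc posdef_inv[OF assms])
  then have "(x \<bullet> x)\<^sup>2 \<le> (x \<bullet> (B *v x)) * (x \<bullet> (?Y *v x))"
    using posdef_cauchy_schwarz[OF assms, of x "?Y *v x"] by (simp add: inner_commute)
  also have "\<dots> \<le> (x \<bullet> (B *v x)) * (rtrace ?Y * (norm x)\<^sup>2)"
    by (intro mult_left_mono inner_le_rtrace posdef_nonneg assms Y)
  finally have "(x \<bullet> x) * (x \<bullet> x) \<le> (rtrace ?Y * (x \<bullet> (B *v x))) * (x \<bullet> x)"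
    unfolding power2_norm_eq_inner by (simp only: power2_eq_square mult_ac)
  then show ?thesis
    unfolding power2_norm_eq_inner by (rule mult_right_le_imp_le) (simp add: False)
qed simp

text \<open>The barrier can be raised by any d below 1 / Tr B^-1 without losing positivity, because
  this number bounds the form of B from below.\<close>

lemma posdef_diff_scaleR_mat1:
  assumes "posdef B" "d * rtrace (matrix_inv B) < 1"
  shows "posdef (B - d *\<^sub>R mat 1)"
  unfolding posdef_def
proof (intro conjI allI impI)
  show "selfadj (B - d *\<^sub>R mat 1)"
    by (intro selfadj_simps posdef_selfadj assms)
  fix x :: "complex^'a" assume "x \<noteq> 0"
  let ?t = "rtrace (matrix_inv B)"
  have t: "0 < ?t" by (intro posdef_rtrace_pos posdef_inv assms)
  have "?t * (d * (norm x)\<^sup>2) < 1 * (norm x)\<^sup>2"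
    unfolding mult.assoc[symmetric] using assms(2) \<open>x \<noteq> 0\<close>
    by (intro mult_strict_right_mono) (auto simp: mult.commute)
  also have "\<dots> \<le> ?t * (x \<bullet> (B *v x))"
    using posdef_lower_bound[OF assms(1), of x] by simp
  finally have "d * (norm x)\<^sup>2 < x \<bullet> (B *v x)"
    using t by simp
  then show "0 < x \<bullet> ((B - d *\<^sub>R mat 1) *v x)"
    by (simp add: matrix_vector_mult_diff_rdistrib scaleR_matrix_mult_vec inner_simps
        power2_norm_eq_inner)
qed

lemma posdef_add_outer:
  assumes "posdef B" "0 \<le> s"
  shows "posdef (B + s *\<^sub>R outer v)"
  unfolding posdef_def
proof (intro conjI allI impI)
  show "selfadj (B + s *\<^sub>R outer v)"
    by (intro selfadj_simps posdef_selfadj assms selfadj_outer)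
  fix x :: "complex^'a" assume "x \<noteq> 0"
  then show "0 < x \<bullet> ((B + s *\<^sub>R outer v) *v x)"
    using posdef_pos[OF assms(1), of x] assms(2)
    by (simp add: matrix_vector_mult_add_rdistrib scaleR_matrix_mult_vec inner_simps
        inner_outer_self add_pos_nonneg)
qed

lemma outer_mult_outer: "outer v ** B ** outer v = (\<chi> i j. qform B v * outer v $ i $ j)"
proof -
  have "(outer v ** B) $ i $ k = v $ i * (\<Sum>l\<in>UNIV. cnj (v $ l) * B $ l $ k)" for i k
    by (simp add: outer_def matrix_matrix_mult_def sum_distrib_left mult_ac)
  then have "(outer v ** B ** outer v) $ i $ j
      = v $ i * cnj (v $ j) * (\<Sum>k\<in>UNIV. \<Sum>l\<in>UNIV. cnj (v $ l) * B $ l $ k * v $ k)" for i j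
    by (simp add: matrix_matrix_mult_def[of "outer v ** B"]) 
       (simp add: outer_def sum_distrib_left sum_distrib_right mult_ac)
  also have "\<dots> i j = qform B v * outer v $ i $ j" for i j
    unfolding qform_def by (subst sum.swap) (simp add: outer_def mult_ac)
  finally show ?thesis by (simp add: vec_eq_iff)
qed

lemma outer_mult_outer_selfadj:
  assumes "selfadj B"
  shows "outer v ** B ** outer v = (v \<bullet> (B *v v)) *\<^sub>R outer v"
proof -
  have "qform B v = complex_of_real (v \<bullet> (B *v v))"
    using selfadj_qform_Reals[OF assms, of v] Re_qform[of B v]
    by (metis of_real_Re)
  then show ?thesis
    by (simp add: outer_mult_outer vec_eq_iff) (simp add: scaleR_conv_of_real)
qed

lemma rtrace_outer_mult: "rtrace (outer v ** B) = v \<bullet> (B *v v)"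
proof -
  have "rtrace (outer v ** B) = Re (\<Sum>i\<in>UNIV. \<Sum>j\<in>UNIV. cnj (v $ j) * B $ j $ i * v $ i)"
    by (simp add: rtrace_def trace_def matrix_matrix_mult_def outer_def mult_ac)
  also have "\<dots> = Re (qform B v)"
    unfolding qform_def by (subst sum.swap) simp
  finally show ?thesis by (simp add: Re_qform)
qed

text \<open>The Sherman--Morrison formula for the trace of the inverse.\<close>

lemma rtrace_inv_add_outer:
  assumes "posdef B" "0 \<le> s"
  defines "Z \<equiv> matrix_inv B"
  shows "rtrace (matrix_inv (B + s *\<^sub>R outer v)) =
    rtrace Z - s * (v \<bullet> ((Z ** Z) *v v)) / (1 + s * (v \<bullet> (Z *v v)))"
proof -
  define q where "q = v \<bullet> (Z *v v)"
  \<comment> \<open>Solution of s - k - k s q = 0, the equation that removes the rank-one part from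
    the product of the matrix with its candidate inverse.\<close>
  define k where "k = s / (1 + s * q)"
  have Z: "posdef Z" "B ** Z = mat 1" unfolding Z_def by (intro posdef_inv assms)+
  have q: "0 \<le> q" unfolding q_def by (rule posdef_nonneg[OF Z(1)])
  have k: "s - k - k * s * q = 0"
  proof -
    have "1 + s * q > 0" using q assms(2) by (simp add: add_pos_nonneg)
    then show ?thesis by (simp add: k_def field_simps)
  qed
  have OZO: "outer v ** Z ** outer v = q *\<^sub>R outer v"
    unfolding q_def by (intro outer_mult_outer_selfadj posdef_selfadj Z)
  have 1: "B ** (Z ** outer v ** Z) = outer v ** Z"
    by (simp add: matrix_mul_assoc Z)
  have 2: "outer v ** (Z ** outer v ** Z) = q *\<^sub>R (outer v ** Z)"
    by (simp add: matrix_mul_assoc OZO matrix_scaleR_left)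
  have "(B + s *\<^sub>R outer v) ** (Z - k *\<^sub>R (Z ** outer v ** Z))
      = mat 1 + (s - k - k * s * q) *\<^sub>R (outer v ** Z)"
    unfolding matrix_simps 1 2 Z(2) by (simp add: algebra_simps)
  then have "matrix_inv (B + s *\<^sub>R outer v) = Z - k *\<^sub>R (Z ** outer v ** Z)"
    by (intro matrix_inv_eqI) (simp add: k)
  moreover have "rtrace (Z ** outer v ** Z) = v \<bullet> ((Z ** Z) *v v)"
    unfolding rtrace_outer_mult[symmetric] using rtrace_mult_comm[of Z "outer v ** Z"]
    by (simp add: matrix_mul_assoc)
  ultimately show ?thesis
    by (simp add: rtrace_simps k_def q_def)
qed

text \<open>Y and Z are the resolvents before and after the barrier is raised by d. The two
  equations come from the resolvent identity Z = Y + d ZY = Y + d YZ. The last inequality is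
  Cauchy-Schwarz for the form (P, Q) -> Tr(P Y Q), taken at the identity and Z.\<close>

lemma shifted_inverse_traces:
  assumes B: "posdef B" and d: "0 < d" and B': "posdef (B - d *\<^sub>R mat 1)"
  defines "Y \<equiv> matrix_inv B" and "Z \<equiv> matrix_inv (B - d *\<^sub>R mat 1)"
  shows "rtrace Z - rtrace Y = d * rtrace (Z ** Y)"
    and "rtrace (Z ** Z) = rtrace (Z ** Y) + d * rtrace (Z ** Y ** Z)"
    and "0 < rtrace (Z ** Y)"
    and "0 \<le> rtrace (Z ** Y ** Z)"
    and "(rtrace (Z ** Y))\<^sup>2 \<le> rtrace (Z ** Y ** Z) * rtrace Y"
proof -
  have Y: "posdef Y" "B ** Y = mat 1" "Y ** B = mat 1" unfolding Y_def by (intro posdef_inv B)+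
  have Z: "posdef Z" "(B - d *\<^sub>R mat 1) ** Z = mat 1" "Z ** (B - d *\<^sub>R mat 1) = mat 1"
    unfolding Z_def by (intro posdef_inv B')+
  have sub: "B = (B - d *\<^sub>R mat 1) + d *\<^sub>R mat 1" by simp
  have "Z = Z ** (B ** Y)" by (simp add: Y)
  also have "\<dots> = Z ** ((B - d *\<^sub>R mat 1) + d *\<^sub>R mat 1) ** Y" by (simp add: matrix_mul_assoc)
  also have "\<dots> = Y + d *\<^sub>R (Z ** Y)" unfolding matrix_add_ldistrib Z(3) matrix_add_rdistrib
    by (simp add: matrix_simps)
  finally have ZY: "Z = Y + d *\<^sub>R (Z ** Y)" .
  have "Z = (Y ** B) ** Z" by (simp add: Y)
  also have "\<dots> = Y ** (((B - d *\<^sub>R mat 1) + d *\<^sub>R mat 1) ** Z)" by (simp add: matrix_mul_assoc)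
  also have "\<dots> = Y + d *\<^sub>R (Y ** Z)" unfolding matrix_add_rdistrib Z(2) matrix_add_ldistrib
    by (simp add: matrix_simps)
  finally have YZ: "Z = Y + d *\<^sub>R (Y ** Z)" .
  show "rtrace Z - rtrace Y = d * rtrace (Z ** Y)"
    by (subst ZY) (simp add: rtrace_simps)
  have "Z ** Z = Z ** (Y + d *\<^sub>R (Y ** Z))" using YZ by simp
  then show "rtrace (Z ** Z) = rtrace (Z ** Y) + d * rtrace (Z ** Y ** Z)"
    by (simp add: matrix_simps rtrace_simps matrix_mul_assoc)
  show c: "0 \<le> rtrace (Z ** Y ** Z)"
    by (intro rtrace_PBP_nonneg posdef_selfadj posdef_nonneg Y Z)
  \<comment> \<open>The trace of a product of two positive matrices is not visibly positive.
    Expanding Z by the resolvent identity writes it as Tr(YY) plus d times Tr(YZY).\<close>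
  have "Z ** Y = Y ** Y + d *\<^sub>R (Y ** Z ** Y)"
    using arg_cong[OF YZ, of "\<lambda>A. A ** Y"] by (simp add: matrix_simps)
  then have "rtrace (Z ** Y) = rtrace (Y ** Y) + d * rtrace (Y ** Z ** Y)"
    by (simp add: rtrace_simps)
  moreover have "0 \<le> rtrace (Y ** Z ** Y)"
    by (intro rtrace_PBP_nonneg posdef_selfadj posdef_nonneg Y Z)
  moreover have "0 < rtrace (Y ** Y)"
    unfolding rtrace_inner
  proof (rule sum_pos)
    fix j
    have "Y *v axis j 1 \<noteq> 0"
      using posdef_pos[OF Y(1), of "axis j 1"] by (auto simp: axis_eq_0_iff)
    then show "0 < axis j 1 \<bullet> (Y ** Y *v axis j 1)"
      using selfadjD[OF posdef_selfadj[OF Y(1)], of "axis j 1" "Y *v axis j 1"]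
      by (metis inner_gt_zero_iff matrix_vector_mul_assoc)
  qed auto
  ultimately show a: "0 < rtrace (Z ** Y)"
    using d by (simp add: add_pos_nonneg)
  \<comment> \<open>The optimal t would be Tr(ZY) / Tr(ZYZ), whose denominator is so far only known
    to be nonnegative. This t gives the same inequality and divides by Tr(ZY), which is
    positive.\<close>
  define t where "t = rtrace Y / rtrace (Z ** Y)"
  have "0 \<le> rtrace ((mat 1 - t *\<^sub>R Z) ** Y ** (mat 1 - t *\<^sub>R Z))"
    by (intro rtrace_PBP_nonneg selfadj_simps posdef_selfadj posdef_nonneg Y Z)
  also have "\<dots> = rtrace Y - 2 * t * rtrace (Z ** Y) + t * t * rtrace (Z ** Y ** Z)"
    by (simp add: matrix_simps rtrace_simps rtrace_mult_comm[of Y Z] algebra_simps)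
  finally have "0 \<le> rtrace Y * (rtrace Y * rtrace (Z ** Y ** Z) / (rtrace (Z ** Y))\<^sup>2 - 1)"
    using a by (simp add: t_def field_simps power2_eq_square)
  moreover have "0 < rtrace Y" by (rule posdef_rtrace_pos[OF Y(1)])
  ultimately have "1 \<le> rtrace Y * rtrace (Z ** Y ** Z) / (rtrace (Z ** Y))\<^sup>2"
    by (simp add: zero_le_mult_iff)
  then show "(rtrace (Z ** Y))\<^sup>2 \<le> rtrace (Z ** Y ** Z) * rtrace Y"
    using a by (simp add: field_simps)
qed


section \<open>Sequential sampling from densities\<close>

text \<open>
  The densities may integrate to less than 1 at points outside the support of the law, hence
  the mass condition is an inequality; \<open>h i\<close> is the density of the point number \<open>Suc i\<close>.
\<close>

locale density_chain = prob_space M for M :: "'a measure" +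
  fixes K :: "nat \<Rightarrow> (nat \<Rightarrow> 'a) \<Rightarrow> 'a measure" and h :: "nat \<Rightarrow> (nat \<Rightarrow> 'a) \<Rightarrow> 'a \<Rightarrow> real"
  assumes kernel_eq: "K (Suc i) x = density M (\<lambda>y. ennreal (h i x y))"
    and density_measurable:
      "(\<lambda>(x, y). h i x y) \<in> borel_measurable (PiM {1..i} (\<lambda>_. M) \<Otimes>\<^sub>M M)"
    and density_mass:
      "x \<in> space (PiM {1..i} (\<lambda>_. M)) \<Longrightarrow> (\<integral>\<^sup>+ y. ennreal (h i x y) \<partial>M) \<le> 1"
begin

abbreviation "law \<equiv> seq_law M K"
abbreviation "prodM i \<equiv> PiM {1..i} (\<lambda>_. M)"

lemma density_measurable1:
  "x \<in> space (prodM i) \<Longrightarrow> (\<lambda>y. h i x y) \<in> borel_measurable M"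
  using measurable_compose[OF measurable_Pair1' density_measurable, of x i] by simp

lemma space_prodM_nonempty: "space (prodM i) \<noteq> {}"
  by (simp add: space_PiM PiE_eq_empty_iff not_empty)

lemma kernel_measurable: "K (Suc i) \<in> measurable (prodM i) (subprob_algebra M)"
proof (rule measurable_subprob_algebra)
  fix x assume x: "x \<in> space (prodM i)"
  note [measurable] = density_measurable1[OF x]
  show "subprob_space (K (Suc i) x)"
  proof
    show "emeasure (K (Suc i) x) (space (K (Suc i) x)) \<le> 1"
      using density_mass[OF x] by (simp add: kernel_eq emeasure_density cong: nn_integral_cong)
    show "space (K (Suc i) x) \<noteq> {}"
      by (simp add: kernel_eq not_empty)
  qed
  show "sets (K (Suc i) x) = sets M" by (simp add: kernel_eq)
next
  fix A assume [measurable]: "A \<in> sets M"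
  note [measurable] = density_measurable
  have "(\<lambda>x. \<integral>\<^sup>+ y. ennreal (h i x y) * indicator A y \<partial>M) \<in> borel_measurable (prodM i)"
    by (rule borel_measurable_nn_integral) measurable
  then show "(\<lambda>x. emeasure (K (Suc i) x) A) \<in> borel_measurable (prodM i)"
    by (rule measurable_cong[THEN iffD1, rotated])
       (simp add: kernel_eq emeasure_density density_measurable1)
qed

lemma upd_measurable:
  "(\<lambda>(x, y). x(Suc i := y)) \<in> measurable (prodM i \<Otimes>\<^sub>M M) (prodM (Suc i))"
  using measurable_add_dim[of "Suc i" "{1..i}" "\<lambda>_. M"] by (simp add: atLeastAtMostSuc_conv)

lemma upd_measurable1:
  "x \<in> space (prodM i) \<Longrightarrow> (\<lambda>y. x(Suc i := y)) \<in> measurable M (prodM (Suc i))"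
  using measurable_compose[OF measurable_Pair1' upd_measurable, of x i] by simp

lemma step_measurable:
  "(\<lambda>x. distr (K (Suc i) x) (prodM (Suc i)) (\<lambda>y. x(Suc i := y)))
     \<in> measurable (prodM i) (subprob_algebra (prodM (Suc i)))"
  by (rule measurable_distr2[OF upd_measurable kernel_measurable])

lemma sets_law: "sets (law i) = sets (prodM i)"
proof (induction i)
  case (Suc i)
  then have "space (law i) \<noteq> {}"
    using sets_eq_imp_space_eq space_prodM_nonempty by metis
  then show ?case
    by (simp add: sets_bind[where N = "prodM (Suc i)"])
qed simp

lemma space_law: "space (law i) = space (prodM i)"
  by (rule sets_eq_imp_space_eq[OF sets_law])

lemma step_measurable_law:
  "(\<lambda>x. distr (K (Suc i) x) (prodM (Suc i)) (\<lambda>y. x(Suc i := y)))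
     \<in> measurable (law i) (subprob_algebra (prodM (Suc i)))"
  using step_measurable by (simp cong: measurable_cong_sets add: sets_law)

lemma nn_integral_step:
  assumes F: "F \<in> borel_measurable (prodM (Suc i))" and x: "x \<in> space (prodM i)"
  shows "(\<integral>\<^sup>+ z. F z \<partial>distr (K (Suc i) x) (prodM (Suc i)) (\<lambda>y. x(Suc i := y)))
    = (\<integral>\<^sup>+ y. ennreal (h i x y) * F (x(Suc i := y)) \<partial>M)"
proof -
  note [measurable] = upd_measurable1[OF x] F density_measurable1[OF x]
  have "(\<lambda>y. x(Suc i := y)) \<in> measurable (K (Suc i) x) (prodM (Suc i))"
    unfolding kernel_eq by measurable
  from nn_integral_distr[OF this, of F] F show ?thesis
    unfolding kernel_eq by (simp add: nn_integral_density)
qed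

lemma nn_integral_law_Suc:
  assumes F: "F \<in> borel_measurable (prodM (Suc i))"
  shows "(\<integral>\<^sup>+ x. F x \<partial>law (Suc i))
    = (\<integral>\<^sup>+ x. \<integral>\<^sup>+ y. ennreal (h i x y) * F (x(Suc i := y)) \<partial>M \<partial>law i)"
  unfolding seq_law.simps nn_integral_bind[OF F step_measurable_law]
  by (intro nn_integral_cong nn_integral_step F) (simp add: space_law)

text \<open>Points of density zero carry no mass, so P has to be checked only where \<open>h\<close>
  is positive. This lets the positivity of the weights pass from one draw to the next in algorithm
  B.\<close>

lemma AE_law_Suc:
  assumes P: "Measurable.pred (prodM (Suc i)) P"
    and ae: "AE x in law i. AE y in M. 0 < h i x y \<longrightarrow> P (x(Suc i := y))"
  shows "AE x in law (Suc i). P x"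
  unfolding seq_law.simps AE_bind[OF step_measurable_law P]
proof (rule AE_mp[OF ae], rule AE_I2, rule impI)
  fix x assume "x \<in> space (law i)" and *: "AE y in M. 0 < h i x y \<longrightarrow> P (x(Suc i := y))"
  then have x: "x \<in> space (prodM i)" by (simp add: space_law)
  note [measurable] = upd_measurable1[OF x] density_measurable1[OF x]
  have u: "(\<lambda>y. x(Suc i := y)) \<in> measurable (K (Suc i) x) (prodM (Suc i))"
    unfolding kernel_eq by measurable
  have "AE y in K (Suc i) x. P (x(Suc i := y))"
    unfolding kernel_eq using * by (subst AE_density) auto
  then show "AE z in distr (K (Suc i) x) (prodM (Suc i)) (\<lambda>y. x(Suc i := y)). P z"
    using P by (subst AE_distr_iff[OF u]) auto
qed

lemma prob_space_law_0: "prob_space (law 0)"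
  by (simp add: space_PiM prob_space_return)

text \<open>Total mass 1 is asked for only almost surely: in algorithm B it is established only for
  histories that the sampler reaches with probability one.\<close>

lemma prob_space_law_Suc:
  assumes "prob_space (law i)" and "AE x in law i. (\<integral>\<^sup>+ y. ennreal (h i x y) \<partial>M) = 1"
  shows "prob_space (law (Suc i))"
proof
  have "emeasure (law (Suc i)) (space (law (Suc i))) = (\<integral>\<^sup>+ x. 1 \<partial>law (Suc i))"
    by simp
  also have "\<dots> = (\<integral>\<^sup>+ x. \<integral>\<^sup>+ y. ennreal (h i x y) * 1 \<partial>M \<partial>law i)"
    by (rule nn_integral_law_Suc) simp
  also have "\<dots> = (\<integral>\<^sup>+ x. 1 \<partial>law i)"
    using assms(2) by (intro nn_integral_cong_AE) simp
  also have "\<dots> = 1"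
    using prob_space.emeasure_space_1[OF assms(1)] by simp
  finally show "emeasure (law (Suc i)) (space (law (Suc i))) = 1" .
qed

lemma nn_integral_law_0:
  assumes "F \<in> borel_measurable (prodM 0)"
  shows "(\<integral>\<^sup>+ x. F x \<partial>law 0) = F (\<lambda>_. undefined)"
  using assms by (simp add: nn_integral_return space_PiM)

end


section \<open>Measurability\<close>

lemma borel_measurable_vecI:
  fixes f :: "'a \<Rightarrow> 'b::euclidean_space^'n"
  assumes "\<And>i. (\<lambda>x. f x $ i) \<in> borel_measurable M"
  shows "f \<in> borel_measurable M"
proof (subst borel_measurable_euclidean_space, intro ballI)
  fix b :: "'b^'n" assume "b \<in> Basis"
  then obtain i u where b: "b = axis i u" by (auto simp: Basis_vec_def)
  note [measurable] = assms
  show "(\<lambda>x. f x \<bullet> b) \<in> borel_measurable M"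
    unfolding b inner_axis by measurable
qed

lemma borel_measurable_vec_nth [measurable (raw)]:
  fixes f :: "'a \<Rightarrow> 'b::real_normed_vector^'n"
  shows "f \<in> borel_measurable M \<Longrightarrow> (\<lambda>x. f x $ i) \<in> borel_measurable M"
  by (erule borel_measurable_continuous_on[rotated]) (intro continuous_intros)

lemma borel_measurable_det:
  fixes f :: "'a \<Rightarrow> complex^'n^'n"
  assumes [measurable]: "\<And>i j. (\<lambda>x. f x $ i $ j) \<in> borel_measurable M"
  shows "(\<lambda>x. det (f x)) \<in> borel_measurable M"
  unfolding det_def by measurable

text \<open>Cramer's rule applied to the columns of the inverse. It expresses each entry by
  determinants, that is by polynomials in the entries, whose measurability is clear.\<close>

lemma matrix_inv_cramer:
  fixes A :: "complex^'n^'n"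
  assumes "det A \<noteq> 0"
  shows "matrix_inv A $ i $ j = det (\<chi> k l. if l = i then axis j 1 $ k else A $ k $ l) / det A"
proof -
  from assms have "invertible A" by (simp add: invertible_det_nz)
  then obtain C where C: "A ** C = mat 1" by (auto simp: invertible_def)
  have inv: "matrix_inv A = C" by (rule matrix_inv_eqI[OF C])
  have "A *v (C *v axis j 1) = axis j 1"
    by (simp add: matrix_vector_mul_assoc C)
  then have "C *v axis j 1 = (\<chi> i. det (\<chi> k l. if l = i then axis j 1 $ k else A $ k $ l) / det A)"
    by (subst (asm) cramer[OF assms])
  moreover have "(C *v axis j 1) $ i = C $ i $ j"
    by (simp add: matrix_vector_mult_def axis_def if_distrib[of "\<lambda>x. y * x" for y] cong: if_cong)
  ultimately show ?thesis unfolding inv by simp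
qed

text \<open>All singular matrices have the same junk value as inverse.\<close>

lemma matrix_inv_singular:
  fixes A B :: "complex^'n^'n"
  assumes "det A = 0" "det B = 0"
  shows "matrix_inv A = matrix_inv B"
proof -
  have "\<not> (A ** A' = mat 1 \<and> A' ** A = mat 1)" "\<not> (B ** A' = mat 1 \<and> A' ** B = mat 1)" for A'
    using assms invertible_det_nz[of A] invertible_det_nz[of B] by (auto simp: invertible_def)
  then have "(\<lambda>A'. A ** A' = mat 1 \<and> A' ** A = mat 1) = (\<lambda>A'. B ** A' = mat 1 \<and> A' ** B = mat 1)"
    by blast
  then show ?thesis unfolding matrix_inv_def by (rule arg_cong)
qed

text \<open>The determinant splits the space into two measurable parts: on one the entries are
  quotients of determinants, on the other the inverse is constant.\<close>

lemma borel_measurable_matrix_inv [measurable (raw)]: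
  fixes f :: "'a \<Rightarrow> complex^'n^'n"
  assumes [measurable]: "f \<in> borel_measurable M"
  shows "(\<lambda>x. matrix_inv (f x)) \<in> borel_measurable M"
proof (intro borel_measurable_vecI)
  fix i j
  have [measurable]: "(\<lambda>x. det (f x)) \<in> borel_measurable M"
    by (rule borel_measurable_det) measurable
  have [measurable]:
    "(\<lambda>x. det (\<chi> k l. if l = i then axis j 1 $ k else f x $ k $ l)) \<in> borel_measurable M"
    by (rule borel_measurable_det) simp
  have det0: "det (0 :: complex^'n^'n) = 0"
    using invertible_det_nz[of "0 :: complex^'n^'n"] by (auto simp: det_0 simp flip: mat_0)
  have singular: "matrix_inv (f x) = matrix_inv 0" if "det (f x) = 0" for x
    using matrix_inv_singular[OF that det0] .
  have "(\<lambda>x. matrix_inv (f x) $ i $ j) = (\<lambda>x. if det (f x) = 0 then matrix_inv 0 $ i $ j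
      else det (\<chi> k l. if l = i then axis j 1 $ k else f x $ k $ l) / det (f x))"
    by (intro ext) (simp add: matrix_inv_cramer singular)
  then show "(\<lambda>x. matrix_inv (f x) $ i $ j) \<in> borel_measurable M"
    by simp
qed

lemma borel_measurable_resolvent [measurable (raw)]:
  fixes f :: "'a \<Rightarrow> complex^'n^'n"
  assumes [measurable]: "f \<in> borel_measurable M" "l \<in> borel_measurable M"
  shows "(\<lambda>x. resolvent (f x) (l x)) \<in> borel_measurable M"
  unfolding resolvent_def by measurable

lemma borel_measurable_rtrace [measurable (raw)]:
  fixes f :: "'a \<Rightarrow> complex^'n^'n"
  assumes [measurable]: "f \<in> borel_measurable M"
  shows "(\<lambda>x. rtrace (f x)) \<in> borel_measurable M"
  unfolding rtrace_def trace_def by measurable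

lemma borel_measurable_cnj [measurable (raw)]:
  assumes "f \<in> borel_measurable M"
  shows "(\<lambda>x. cnj (f x)) \<in> borel_measurable M"
  by (rule borel_measurable_continuous_on[OF _ assms]) (intro continuous_intros)

lemma borel_measurable_qform [measurable (raw)]:
  fixes f :: "'a \<Rightarrow> complex^'n^'n"
  assumes [measurable]: "f \<in> borel_measurable M" "v \<in> borel_measurable M"
  shows "(\<lambda>x. qform (f x) (v x)) \<in> borel_measurable M"
  unfolding qform_def by measurable

lemma borel_measurable_outer [measurable (raw)]:
  assumes [measurable]: "v \<in> borel_measurable M"
  shows "(\<lambda>x. outer (v x)) \<in> borel_measurable M"
  by (intro borel_measurable_vecI) (simp add: outer_def)

lemma borel_measurable_matrix_mult [measurable (raw)]:
  fixes f g :: "'a \<Rightarrow> complex^'n^'n"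
  assumes [measurable]: "f \<in> borel_measurable M" "g \<in> borel_measurable M"
  shows "(\<lambda>x. f x ** g x) \<in> borel_measurable M"
  by (intro borel_measurable_vecI) (simp add: matrix_matrix_mult_def)

text \<open>The condition ranges over uncountably many vectors. It is still measurable, since each
  vector gives a closed condition and an intersection of closed sets is closed.\<close>

lemma pred_psd:
  fixes f :: "'a \<Rightarrow> complex^'n^'n"
  assumes "f \<in> borel_measurable M"
  shows "Measurable.pred M (\<lambda>x. psd (f x))"
proof -
  have "closed {B :: complex^'n^'n. qform B v \<in> \<real> \<and> 0 \<le> Re (qform B v)}" for v
    unfolding complex_is_Real_iff qform_def
    by (intro closed_Collect_conj closed_Collect_eq closed_Collect_le continuous_intros)
  then have "closed (\<Inter>v. {B :: complex^'n^'n. qform B v \<in> \<real> \<and> 0 \<le> Re (qform B v)})"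
    by (intro closed_INT) auto
  also have "(\<Inter>v. {B :: complex^'n^'n. qform B v \<in> \<real> \<and> 0 \<le> Re (qform B v)}) = {B. psd B}"
    by (auto simp: psd_def)
  finally have "{B :: complex^'n^'n. psd B} \<in> sets borel" by (rule borel_closed)
  from measurable_sets_Collect[OF assms, of psd] this show ?thesis
    by (simp add: pred_def)
qed

section \<open>Measurability of the densities and states of the two algorithms\<close>

lemma rho_A_measurable [measurable (raw)]:
  fixes \<phi> :: "'b \<Rightarrow> complex^'n"
  assumes [measurable]: "A \<in> borel_measurable M" "l \<in> borel_measurable M" "y \<in> measurable M N"
    "\<phi> \<in> borel_measurable N"
  shows "(\<lambda>x. rho_A \<phi> \<gamma> (A x) (l x) (y x)) \<in> borel_measurable M"
  unfolding rho_A_def by measurable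

lemma barrier_A_measurable [measurable (raw)]:
  fixes A :: "'a \<Rightarrow> complex^'n^'n"
  assumes [measurable]: "A \<in> borel_measurable M" "l \<in> borel_measurable M"
  shows "(\<lambda>x. barrier_A \<epsilon> \<gamma> (A x) (l x)) \<in> borel_measurable M"
  unfolding barrier_A_def by measurable

lemma Xi_A_measurable [measurable (raw)]:
  fixes A :: "'a \<Rightarrow> complex^'n^'n"
  assumes [measurable]: "A \<in> borel_measurable M" "l \<in> borel_measurable M"
  shows "(\<lambda>x. Xi_A \<gamma> (A x) (l x)) \<in> borel_measurable M"
  unfolding Xi_A_def by measurable

text \<open>Stated on the product over {1..j} for i \<le> j, so that earlier states and weights can
  be used on the sample space of a longer run.\<close>

lemma state_A_measurable:
  fixes \<phi> :: "'b \<Rightarrow> complex^'n"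
  assumes [measurable]: "\<phi> \<in> borel_measurable M" and "i \<le> j"
  shows "(\<lambda>x. fst (state_A \<phi> \<epsilon> \<gamma> x i)) \<in> borel_measurable (PiM {1..j} (\<lambda>_. M))"
    and "(\<lambda>x. snd (state_A \<phi> \<epsilon> \<gamma> x i)) \<in> borel_measurable (PiM {1..j} (\<lambda>_. M))"
  using \<open>i \<le> j\<close>
proof (induction i)
  case (Suc i)
  {
    case 1
    then have [measurable]: "(\<lambda>x. x (Suc i)) \<in> measurable (PiM {1..j} (\<lambda>_. M)) M"
      by (intro measurable_component_singleton) auto
    from 1 have "i \<le> j" by simp
    note [measurable] = Suc[OF this]
    show ?case unfolding state_A.simps Let_def fst_conv by measurable
  next
    case 2
    from 2 have "i \<le> j" by simp
    note [measurable] = Suc[OF this]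
    show ?case unfolding state_A.simps Let_def snd_conv by measurable
  }
qed simp_all

lemma w_B_measurable [measurable (raw)]:
  fixes \<phi> :: "'b \<Rightarrow> complex^'n"
  assumes [measurable]: "A \<in> borel_measurable M" "l \<in> borel_measurable M" "y \<in> measurable M N"
    "\<phi> \<in> borel_measurable N"
  shows "(\<lambda>x. w_B \<phi> \<delta> (A x) (l x) (y x)) \<in> borel_measurable M"
  unfolding w_B_def W_B_def Let_def by measurable

lemma R_B_measurable [measurable (raw)]:
  fixes \<phi> :: "'b \<Rightarrow> complex^'n"
  assumes [measurable]: "A \<in> borel_measurable M" "l \<in> borel_measurable M" "y \<in> measurable M N"
    "\<phi> \<in> borel_measurable N"
  shows "(\<lambda>x. R_B \<phi> \<delta> \<kappa> (A x) (l x) (y x)) \<in> borel_measurable M"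
  unfolding R_B_def by measurable

lemma Gamma_B_measurable [measurable (raw)]:
  fixes \<phi> :: "'b \<Rightarrow> complex^'n"
  assumes [measurable]: "A \<in> borel_measurable M" "l \<in> borel_measurable M" "\<phi> \<in> borel_measurable N"
    and "sigma_finite_measure N"
  shows "(\<lambda>x. Gamma_B N \<phi> \<delta> \<kappa> (A x) (l x)) \<in> borel_measurable M"
  unfolding Gamma_B_def
  by (rule sigma_finite_measure.borel_measurable_lebesgue_integral[OF assms(4)]) measurable

lemma state_B_measurable:
  fixes \<phi> :: "'b \<Rightarrow> complex^'n"
  assumes [measurable]: "\<phi> \<in> borel_measurable M" and "i \<le> j"
  shows "(\<lambda>x. fst (state_B \<phi> \<delta> \<kappa> x i)) \<in> borel_measurable (PiM {1..j} (\<lambda>_. M))"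
    and "(\<lambda>x. snd (state_B \<phi> \<delta> \<kappa> x i)) \<in> borel_measurable (PiM {1..j} (\<lambda>_. M))"
  using \<open>i \<le> j\<close>
proof (induction i)
  case (Suc i)
  {
    case 1
    then have [measurable]: "(\<lambda>x. x (Suc i)) \<in> measurable (PiM {1..j} (\<lambda>_. M)) M"
      by (intro measurable_component_singleton) auto
    from 1 have "i \<le> j" by simp
    note [measurable] = Suc[OF this]
    show ?case unfolding state_B.simps Let_def fst_conv by measurable
  next
    case 2
    from 2 have "i \<le> j" by simp
    note [measurable] = Suc[OF this]
    show ?case unfolding state_B.simps Let_def snd_conv by measurable
  }
qed simp_all


section \<open>Orthonormal bases and weighted least squares\<close>

lemma L2_norm_power2: "(L2_norm M g)\<^sup>2 = (\<integral>\<^sup>+ x. ennreal ((norm (g x))\<^sup>2) \<partial>M)"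
proof (cases "(\<integral>\<^sup>+ x. ennreal ((norm (g x))\<^sup>2) \<partial>M)")
  case (real r)
  then have "(L2_norm M g)\<^sup>2 = ennreal (sqrt r) * ennreal (sqrt r)"
    by (simp add: L2_norm_def Let_def power2_eq_square)
  also have "\<dots> = ennreal r"
    using real by (simp flip: ennreal_mult)
  finally show ?thesis using real by simp
qed (simp add: L2_norm_def Let_def power2_eq_square)

lemma L2_norm_mono:
  assumes "(\<integral>\<^sup>+ x. ennreal ((norm (g x))\<^sup>2) \<partial>M) \<le> (\<integral>\<^sup>+ x. ennreal ((norm (h x))\<^sup>2) \<partial>M)"
  shows "L2_norm M g \<le> L2_norm M h"
proof (cases "(\<integral>\<^sup>+ x. ennreal ((norm (h x))\<^sup>2) \<partial>M) = \<top>")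
  case False
  then have "(\<integral>\<^sup>+ x. ennreal ((norm (g x))\<^sup>2) \<partial>M) \<noteq> \<top>"
    using neq_top_trans[OF _ assms] by blast
  moreover have "enn2real (\<integral>\<^sup>+ x. ennreal ((norm (g x))\<^sup>2) \<partial>M)
      \<le> enn2real (\<integral>\<^sup>+ x. ennreal ((norm (h x))\<^sup>2) \<partial>M)"
    using False by (intro enn2real_mono[OF assms]) (simp only: less_top)
  ultimately show ?thesis
    using False by (simp add: L2_norm_def Let_def ennreal_leI)
qed (simp add: L2_norm_def)

definition square_integrable :: "'a measure \<Rightarrow> ('a \<Rightarrow> complex) \<Rightarrow> bool" where
  "square_integrable M g \<longleftrightarrow> g \<in> borel_measurable M \<and> integrable M (\<lambda>x. (norm (g x))\<^sup>2)"

lemma L2_space_iff: "g \<in> L2_space M \<longleftrightarrow> square_integrable M g"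
proof -
  have "L2_norm M g < \<top> \<longleftrightarrow> (\<integral>\<^sup>+ x. ennreal ((norm (g x))\<^sup>2) \<partial>M) < \<top>"
    by (simp add: L2_norm_def Let_def less_top[symmetric])
  then show ?thesis
    by (auto simp: L2_space_def square_integrable_def integrable_iff_bounded)
qed

lemma square_integrable_measurable: "square_integrable M g \<Longrightarrow> g \<in> borel_measurable M"
  by (simp add: square_integrable_def)

lemma square_integrable_mult:
  assumes "square_integrable M g" "square_integrable M h"
  shows "integrable M (\<lambda>x. g x * cnj (h x))"
proof (rule Bochner_Integration.integrable_bound)
  show "integrable M (\<lambda>x. (norm (g x))\<^sup>2 + (norm (h x))\<^sup>2)"
    using assms by (simp add: square_integrable_def)
  show "(\<lambda>x. g x * cnj (h x)) \<in> borel_measurable M"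
    using assms by (auto simp: square_integrable_def)
  have "a * b \<le> a\<^sup>2 + b\<^sup>2" if "0 \<le> a" "0 \<le> b" for a b :: real
    using sum_squares_bound[of a b] mult_nonneg_nonneg[OF that] by simp
  then show "AE x in M. norm (g x * cnj (h x)) \<le> norm ((norm (g x))\<^sup>2 + (norm (h x))\<^sup>2)"
    by (intro AE_I2) (simp add: norm_mult)
qed

lemma square_integrable_cmult:
  "square_integrable M g \<Longrightarrow> square_integrable M (\<lambda>x. c * g x)"
  by (auto simp: square_integrable_def norm_mult power_mult_distrib)

lemma cmod_add_power2: "(cmod (a + b))\<^sup>2 = (cmod a)\<^sup>2 + (cmod b)\<^sup>2 + 2 * Re (a * cnj b)"
  unfolding cmod_power2 by (simp add: power2_eq_square algebra_simps)

lemma square_integrable_add: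
  assumes "square_integrable M g" "square_integrable M h"
  shows "square_integrable M (\<lambda>x. g x + h x)"
  using assms integrable_Re[OF square_integrable_mult[OF assms]]
  unfolding square_integrable_def cmod_add_power2
  by (intro conjI Bochner_Integration.integrable_add integrable_mult_right) auto

lemma square_integrable_diff:
  assumes "square_integrable M g" "square_integrable M h"
  shows "square_integrable M (\<lambda>x. g x - h x)"
  using square_integrable_add[OF assms(1) square_integrable_cmult[OF assms(2), of "-1"]] by simp

lemma norm_vec_power2: "(norm (c :: complex^'n))\<^sup>2 = (\<Sum>j\<in>UNIV. (cmod (c $ j))\<^sup>2)"
  by (simp add: norm_vec_def L2_set_def sum_nonneg)

lemma lin_comb_add: "lin_comb \<phi> (c + d) x = lin_comb \<phi> c x + lin_comb \<phi> d x"
  by (simp add: lin_comb_def sum.distrib algebra_simps)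

lemma lin_comb_diff: "lin_comb \<phi> (c - d) x = lin_comb \<phi> c x - lin_comb \<phi> d x"
  by (simp add: lin_comb_def sum_subtractf algebra_simps)

lemma lin_comb_0: "lin_comb \<phi> 0 x = 0"
  by (simp add: lin_comb_def)

section \<open>Expansion in the orthonormal basis\<close>

locale L2_basis = prob_space M for M :: "'a measure" +
  fixes V :: "('a \<Rightarrow> complex) set" and \<phi> :: "'a \<Rightarrow> complex^'n"
  assumes subspace: "L2_subspace M V" and basis: "L2_orthonormal_basis M V \<phi>"
begin

lemma V_square_integrable: "v \<in> V \<Longrightarrow> square_integrable M v"
  using subspace by (auto simp: L2_subspace_def L2_space_iff)

lemma basis_in_V: "(\<lambda>x. \<phi> x $ j) \<in> V"
  using basis by (simp add: L2_orthonormal_basis_def)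

lemma basis_square_integrable: "square_integrable M (\<lambda>x. \<phi> x $ j)"
  by (rule V_square_integrable[OF basis_in_V])

lemma basis_measurable [measurable]: "\<phi> \<in> borel_measurable M"
  by (intro borel_measurable_vecI square_integrable_measurable basis_square_integrable)

lemma orthonormal: "(\<integral>x. \<phi> x $ j * cnj (\<phi> x $ k) \<partial>M) = (if j = k then 1 else 0)"
  using basis by (simp add: L2_orthonormal_basis_def)

lemma V_lin_comb: "v \<in> V \<Longrightarrow> \<exists>c. AE x in M. v x = lin_comb \<phi> c x"
  using basis by (simp add: L2_orthonormal_basis_def)

lemma lin_comb_in_V: "lin_comb \<phi> c \<in> V"
proof -
  have "(\<lambda>x. \<Sum>j\<in>J. c $ j * \<phi> x $ j) \<in> V" if "finite J" for J
    using that
  proof induction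
    case empty
    then show ?case using subspace by (simp add: L2_subspace_def)
  next
    case (insert k J)
    have "(\<lambda>x. c $ k * \<phi> x $ k) \<in> V"
      using subspace basis_in_V[of k] by (auto simp: L2_subspace_def)
    with insert show ?case using subspace by (simp add: L2_subspace_def)
  qed
  from this[of UNIV] show ?thesis
    by (simp add: lin_comb_def[abs_def])
qed

lemma lin_comb_square_integrable: "square_integrable M (lin_comb \<phi> c)"
  by (rule V_square_integrable[OF lin_comb_in_V])

lemma lin_comb_measurable [measurable]: "lin_comb \<phi> c \<in> borel_measurable M"
  by (rule square_integrable_measurable[OF lin_comb_square_integrable])

lemma integral_mult_lin_comb:
  assumes "square_integrable M g"
  shows "(\<integral>x. g x * cnj (lin_comb \<phi> c x) \<partial>M)
    = (\<Sum>j\<in>UNIV. cnj (c $ j) * (\<integral>x. g x * cnj (\<phi> x $ j) \<partial>M))"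
proof -
  have "(\<integral>x. g x * cnj (lin_comb \<phi> c x) \<partial>M)
      = (\<integral>x. (\<Sum>j\<in>UNIV. cnj (c $ j) * (g x * cnj (\<phi> x $ j))) \<partial>M)"
    by (simp add: lin_comb_def sum_distrib_left mult_ac)
  also have "\<dots> = (\<Sum>j\<in>UNIV. (\<integral>x. cnj (c $ j) * (g x * cnj (\<phi> x $ j)) \<partial>M))"
    by (intro Bochner_Integration.integral_sum integrable_mult_right square_integrable_mult assms
        basis_square_integrable)
  finally show ?thesis by simp
qed

lemma integral_lin_comb_basis: "(\<integral>x. lin_comb \<phi> c x * cnj (\<phi> x $ j) \<partial>M) = c $ j"
proof -
  have "(\<integral>x. lin_comb \<phi> c x * cnj (\<phi> x $ j) \<partial>M)
      = (\<integral>x. (\<Sum>k\<in>UNIV. c $ k * (\<phi> x $ k * cnj (\<phi> x $ j))) \<partial>M)"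
    by (simp add: lin_comb_def sum_distrib_right mult.assoc)
  also have "\<dots> = (\<Sum>k\<in>UNIV. (\<integral>x. c $ k * (\<phi> x $ k * cnj (\<phi> x $ j)) \<partial>M))"
    by (intro Bochner_Integration.integral_sum integrable_mult_right square_integrable_mult
        basis_square_integrable)
  also have "\<dots> = c $ j"
    by (simp add: orthonormal if_distrib[of "\<lambda>x. y * x" for y] cong: if_cong)
  finally show ?thesis .
qed

lemma integral_lin_comb_power2: "(\<integral>x. (cmod (lin_comb \<phi> c x))\<^sup>2 \<partial>M) = (norm c)\<^sup>2"
proof -
  have "complex_of_real (\<integral>x. (cmod (lin_comb \<phi> c x))\<^sup>2 \<partial>M)
      = (\<integral>x. complex_of_real ((cmod (lin_comb \<phi> c x))\<^sup>2) \<partial>M)"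
    by (simp only: integral_complex_of_real)
  also have "\<dots> = (\<integral>x. lin_comb \<phi> c x * cnj (lin_comb \<phi> c x) \<partial>M)"
    by (simp only: complex_norm_square)
  also have "\<dots> = (\<Sum>j\<in>UNIV. cnj (c $ j) * c $ j)"
    by (simp add: integral_mult_lin_comb lin_comb_square_integrable integral_lin_comb_basis)
  also have "\<dots> = complex_of_real ((norm c)\<^sup>2)"
    unfolding norm_vec_power2 of_real_sum complex_norm_square by (simp add: mult.commute)
  finally show ?thesis using of_real_eq_iff by blast
qed

lemma nn_integral_lin_comb_power2:
  "(\<integral>\<^sup>+x. ennreal ((cmod (lin_comb \<phi> c x))\<^sup>2) \<partial>M) = ennreal ((norm c)\<^sup>2)"
  using lin_comb_square_integrable[of c]
  by (subst nn_integral_eq_integral) (auto simp: square_integrable_def integral_lin_comb_power2)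

lemma orthogonal_pythagoras:
  assumes g: "square_integrable M g" and orth: "\<And>j. (\<integral>x. g x * cnj (\<phi> x $ j) \<partial>M) = 0"
  shows "(\<integral>\<^sup>+x. ennreal ((cmod (g x + lin_comb \<phi> c x))\<^sup>2) \<partial>M)
    = (\<integral>\<^sup>+x. ennreal ((cmod (g x))\<^sup>2) \<partial>M) + ennreal ((norm c)\<^sup>2)"
proof -
  note l = lin_comb_square_integrable[of c]
  have i: "integrable M (\<lambda>x. (cmod (g x))\<^sup>2)" "integrable M (\<lambda>x. (cmod (lin_comb \<phi> c x))\<^sup>2)"
    using g l by (auto simp: square_integrable_def)
  have j: "integrable M (\<lambda>x. g x * cnj (lin_comb \<phi> c x))"
    by (rule square_integrable_mult[OF g l])
  have linear: "(\<integral>x. a x + b x + 2 * p x \<partial>M)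
      = (\<integral>x. a x \<partial>M) + (\<integral>x. b x \<partial>M) + 2 * (\<integral>x. p x \<partial>M)"
    if "integrable M a" "integrable M b" "integrable M p" for a b p :: "'a \<Rightarrow> real"
    using that by simp
  have "(\<integral>x. (cmod (g x + lin_comb \<phi> c x))\<^sup>2 \<partial>M) = (\<integral>x. (cmod (g x))\<^sup>2 \<partial>M)
      + (\<integral>x. (cmod (lin_comb \<phi> c x))\<^sup>2 \<partial>M) + 2 * Re (\<integral>x. g x * cnj (lin_comb \<phi> c x) \<partial>M)"
    unfolding cmod_add_power2 integral_Re[OF j, symmetric]
    using i integrable_Re[OF j] by (rule linear)
  also have "\<dots> = (\<integral>x. (cmod (g x))\<^sup>2 \<partial>M) + (norm c)\<^sup>2"
    by (simp add: integral_mult_lin_comb[OF g] orth integral_lin_comb_power2)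
  finally have "(\<integral>x. (cmod (g x + lin_comb \<phi> c x))\<^sup>2 \<partial>M) = (\<integral>x. (cmod (g x))\<^sup>2 \<partial>M) + (norm c)\<^sup>2" .
  moreover have "integrable M (\<lambda>x. (cmod (g x + lin_comb \<phi> c x))\<^sup>2)"
    using square_integrable_add[OF g l] by (simp add: square_integrable_def)
  ultimately show ?thesis
    using i by (simp add: nn_integral_eq_integral)
qed

text \<open>The coefficients are the inner products of f with the basis. The identity holds at every
  point and not only almost everywhere, because the estimator evaluates f and the fixed
  representatives \<phi> at the sample points.\<close>

lemma orthogonal_decomposition:
  assumes f: "square_integrable M f"
  obtains c g where "\<And>x. f x = g x + lin_comb \<phi> c x" "square_integrable M g"
    "\<And>j. (\<integral>x. g x * cnj (\<phi> x $ j) \<partial>M) = 0"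
proof
  define c where "c = (\<chi> j. (\<integral>x. f x * cnj (\<phi> x $ j) \<partial>M))"
  define g where "g x = f x - lin_comb \<phi> c x" for x
  show "f x = g x + lin_comb \<phi> c x" for x by (simp add: g_def)
  show "square_integrable M g"
    unfolding g_def by (intro square_integrable_diff f lin_comb_square_integrable)
  fix j
  have "(\<integral>x. g x * cnj (\<phi> x $ j) \<partial>M)
      = (\<integral>x. f x * cnj (\<phi> x $ j) - lin_comb \<phi> c x * cnj (\<phi> x $ j) \<partial>M)"
    by (simp add: g_def algebra_simps)
  also have "\<dots> = (\<integral>x. f x * cnj (\<phi> x $ j) \<partial>M) - (\<integral>x. lin_comb \<phi> c x * cnj (\<phi> x $ j) \<partial>M)"
    by (intro Bochner_Integration.integral_diff square_integrable_mult f lin_comb_square_integrable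
        basis_square_integrable)
  also have "\<dots> = 0"
    by (simp add: integral_lin_comb_basis c_def)
  finally show "(\<integral>x. g x * cnj (\<phi> x $ j) \<partial>M) = 0" .
qed

text \<open>By orthonormality the mean of \<open>outer (\<phi> x)\<close> is the identity matrix.
  This computes the normalising constant of algorithm A, the mean of \<open>w_B\<close> and the
  expected change of the potential.\<close>

lemma integrable_qform: "integrable M (\<lambda>x. Re (qform B (\<phi> x)))"
  and integral_qform: "(\<integral>x. Re (qform B (\<phi> x)) \<partial>M) = rtrace B"
proof -
  have i: "integrable M (\<lambda>x. cnj (\<phi> x $ i) * B $ i $ j * \<phi> x $ j)" for i j
    using integrable_mult_right[OF square_integrable_mult[OF basis_square_integrable
      basis_square_integrable], of "B $ i $ j" j i]
    by (simp add: mult_ac)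
  then show "integrable M (\<lambda>x. Re (qform B (\<phi> x)))"
    unfolding qform_def by (intro integrable_Re Bochner_Integration.integrable_sum i)
  have "(\<integral>x. Re (qform B (\<phi> x)) \<partial>M) = Re (\<integral>x. qform B (\<phi> x) \<partial>M)"
    using i unfolding qform_def by (intro integral_Re Bochner_Integration.integrable_sum)
  also have "(\<integral>x. qform B (\<phi> x) \<partial>M)
      = (\<Sum>i\<in>UNIV. \<Sum>j\<in>UNIV. (\<integral>x. cnj (\<phi> x $ i) * B $ i $ j * \<phi> x $ j \<partial>M))"
    using i unfolding qform_def by (simp add: Bochner_Integration.integral_sum)
  also have "\<dots> = (\<Sum>i\<in>UNIV. \<Sum>j\<in>UNIV. B $ i $ j * (\<integral>x. \<phi> x $ j * cnj (\<phi> x $ i) \<partial>M))"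
    by (simp add: mult_ac flip: integral_mult_right_zero)
  also have "\<dots> = trace B"
    by (simp add: orthonormal trace_def if_distrib[of "\<lambda>x. y * x" for y] cong: if_cong)
  finally show "(\<integral>x. Re (qform B (\<phi> x)) \<partial>M) = rtrace B" by (simp add: rtrace_def)
qed

end


text \<open>\<open>lin_comb\<close> pairs coefficients with \<phi> without conjugation, while the
  matrices are sums of \<open>outer (\<phi> x)\<close>. In the normal equations the unknown is
  therefore the conjugate of the coefficient vector.\<close>

definition vec_cnj :: "complex^'n \<Rightarrow> complex^'n" where
  "vec_cnj c = (\<chi> j. cnj (c $ j))"

lemma norm_vec_cnj: "norm (vec_cnj c) = norm c"
  by (simp add: vec_cnj_def norm_vec_def)

lemma vec_cnj_vec_cnj: "vec_cnj (vec_cnj c) = c"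
  by (simp add: vec_cnj_def vec_eq_iff)

lemma sum_cnj_lin_comb: "(\<Sum>j\<in>UNIV. cnj (\<phi> x $ j) * vec_cnj c $ j) = cnj (lin_comb \<phi> c x)"
  by (simp add: lin_comb_def vec_cnj_def mult.commute)

lemma inner_vec_cnj: "vec_cnj c \<bullet> (a *s \<phi> x) = Re (a * lin_comb \<phi> c x)"
proof -
  have "vec_cnj c \<bullet> (a *s \<phi> x) = Re (\<Sum>j\<in>UNIV. c $ j * (a * \<phi> x $ j))"
    by (simp add: vec_cnj_def inner_vec_def inner_complex_Re)
  also have "(\<Sum>j\<in>UNIV. c $ j * (a * \<phi> x $ j)) = a * lin_comb \<phi> c x"
    by (simp add: lin_comb_def sum_distrib_left mult.left_commute)
  finally show ?thesis .
qed

lemma sum_matrix_vec_mult: "(\<Sum>i\<in>I. B i) *v x = (\<Sum>i\<in>I. B i *v (x :: complex^'n))"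
  by (induction I rule: infinite_finite_induct) (auto simp: matrix_vector_mult_add_rdistrib)

text \<open>The deviation d depends only on the values of g = f - \<open>lin_comb \<phi> c\<close>
  at the sample points: its conjugate y solves the normal equations A' y = S with right-hand side
  built from g. The form of A' at y is at least \<alpha> |d|^2. It equals y . S, which gives the
  estimate by the norm of S, used for algorithm A; it is also at most the weighted sum of the
  |g(x_i)|^2, which gives the estimate used for algorithm B.\<close>

lemma wls_perturbation:
  fixes \<phi> :: "'a \<Rightarrow> complex^'n" and s :: "nat \<Rightarrow> real"
  assumes s: "\<And>i. i \<in> {1..m} \<Longrightarrow> 0 \<le> s i" and \<alpha>: "0 < \<alpha>"
    and A: "\<And>v. \<alpha> * (norm v)\<^sup>2 \<le> v \<bullet> ((\<Sum>i=1..m. s i *\<^sub>R outer (\<phi> (x i))) *v v)"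
  obtains d where "wls \<phi> m x s f = lin_comb \<phi> (c + d)"
    "\<alpha> * norm d \<le> norm (\<Sum>i=1..m. s i *\<^sub>R (cnj (f (x i) - lin_comb \<phi> c (x i)) *s \<phi> (x i)))"
    "\<alpha> * (norm d)\<^sup>2 \<le> (\<Sum>i=1..m. s i * (cmod (f (x i) - lin_comb \<phi> c (x i)))\<^sup>2)"
proof -
  define A' where "A' = (\<Sum>i=1..m. s i *\<^sub>R outer (\<phi> (x i)))"
  define g where "g i = f (x i) - lin_comb \<phi> c (x i)" for i
  define S where "S = (\<Sum>i=1..m. s i *\<^sub>R (cnj (g i) *s \<phi> (x i)))"
  have "selfadj (\<Sum>i\<in>I. s i *\<^sub>R outer (\<phi> (x i)))" for I
    by (induction I rule: infinite_finite_induct) (simp_all add: selfadj_simps selfadj_outer)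
  then have "selfadj A'" by (simp add: A'_def)
  moreover have "0 < v \<bullet> (A' *v v)" if "v \<noteq> 0" for v
  proof -
    have "0 < \<alpha> * (norm v)\<^sup>2" using that \<alpha> by simp
    with A[of v] show ?thesis unfolding A'_def by linarith
  qed
  ultimately have pd: "posdef A'" by (simp add: posdef_def)
  define y where "y = matrix_inv A' *v S"
  have Ay: "A' *v y = S"
    unfolding y_def by (simp add: matrix_vector_mul_assoc posdef_inv[OF pd])
  define d where "d = vec_cnj y"
  have yd: "y = vec_cnj d" by (simp add: d_def vec_cnj_vec_cnj)
  define J where "J e = (\<Sum>i=1..m. s i * (cmod (f (x i) - lin_comb \<phi> (c + e) (x i)))\<^sup>2)" for e
  have A'_vec: "A' *v vec_cnj e = (\<Sum>i=1..m. s i *\<^sub>R (cnj (lin_comb \<phi> e (x i)) *s \<phi> (x i)))" for e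
    by (simp add: A'_def sum_matrix_vec_mult scaleR_matrix_mult_vec outer_mult_vec sum_cnj_lin_comb)
  have quad: "vec_cnj e \<bullet> (A' *v vec_cnj e) = (\<Sum>i=1..m. s i * (cmod (lin_comb \<phi> e (x i)))\<^sup>2)" for e
    unfolding A'_vec inner_sum_right inner_scaleR_right inner_vec_cnj inner_complex_Re[symmetric]
      dot_square_norm ..
  \<comment> \<open>Expansion of the objective around the candidate d. The linear term is a multiple
    of the pairing of e with S - A' y and vanishes by the normal equations.\<close>
  have J: "J (d + e) = J d + vec_cnj e \<bullet> (A' *v vec_cnj e)" for e
  proof -
    have 1: "(cmod (f (x i) - lin_comb \<phi> (c + (d + e)) (x i)))\<^sup>2
       = (cmod (f (x i) - lin_comb \<phi> (c + d) (x i)))\<^sup>2 + (cmod (lin_comb \<phi> e (x i)))\<^sup>2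
         - 2 * (vec_cnj e \<bullet> ((cnj (g i - lin_comb \<phi> d (x i))) *s \<phi> (x i)))" for i
      unfolding inner_vec_cnj g_def cmod_power2 lin_comb_add
      by (simp add: power2_eq_square algebra_simps)
    have "J (d + e) = J d + vec_cnj e \<bullet> (A' *v vec_cnj e) - 2 *
        (vec_cnj e \<bullet> (\<Sum>i=1..m. s i *\<^sub>R (cnj (g i - lin_comb \<phi> d (x i)) *s \<phi> (x i))))"
      unfolding J_def 1 quad inner_sum_right
      by (simp add: algebra_simps sum.distrib sum_subtractf sum_distrib_left)
    also have "(\<Sum>i=1..m. s i *\<^sub>R (cnj (g i - lin_comb \<phi> d (x i)) *s \<phi> (x i))) = S - A' *v y"
      unfolding yd A'_vec S_def
      by (simp add: vector_ssub_ldistrib vector_sub_rdistrib scaleR_diff_right sum_subtractf)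
    finally show ?thesis by (simp add: Ay)
  qed
  show ?thesis
  proof (rule that)
    show "wls \<phi> m x s f = lin_comb \<phi> (c + d)"
    proof -
      let ?F = "\<lambda>v. \<Sum>i=1..m. s i * (cmod (f (x i) - v (x i)))\<^sup>2"
      have "is_arg_min ?F (\<lambda>v. v \<in> range (lin_comb \<phi>)) (lin_comb \<phi> (c + d))"
        unfolding is_arg_min_def
      proof (intro conjI notI)
        assume "\<exists>v. v \<in> range (lin_comb \<phi>) \<and> ?F v < ?F (lin_comb \<phi> (c + d))"
        then obtain b where b: "?F (lin_comb \<phi> b) < ?F (lin_comb \<phi> (c + d))" by auto
        then have "J (d + (b - c - d)) < J d" by (simp add: J_def)
        then show False
          unfolding J using posdef_nonneg[OF pd, of "vec_cnj (b - c - d)"] by simp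
      qed simp
      \<comment> \<open>\<open>wls\<close> is a choice among the minimisers. Since one exists, the
        chosen function is a minimiser, and the exact expansion \<open>J\<close> then forces its
        coefficients to be c + d.\<close>
      then have "is_arg_min ?F (\<lambda>v. v \<in> range (lin_comb \<phi>)) (wls \<phi> m x s f)"
        unfolding wls_def arg_min_def by (rule someI[of "is_arg_min ?F (\<lambda>v. v \<in> range (lin_comb \<phi>))"])
      then obtain b where b: "wls \<phi> m x s f = lin_comb \<phi> b"
        and le: "?F (lin_comb \<phi> b) \<le> ?F (lin_comb \<phi> (c + d))"
        unfolding is_arg_min_def by (auto simp: not_less)
      from le have "J (d + (b - c - d)) \<le> J d" by (simp add: J_def)
      then have "vec_cnj (b - c - d) = 0"
        unfolding J using posdef_pos[OF pd, of "vec_cnj (b - c - d)"] by force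
      then have "norm (b - c - d) = 0"
        by (metis norm_vec_cnj norm_zero)
      then have "b = c + d" by (simp add: algebra_simps)
      with b show ?thesis by simp
    qed
    have lower: "\<alpha> * (norm d)\<^sup>2 \<le> y \<bullet> (A' *v y)"
      using A[of y] by (simp add: A'_def yd norm_vec_cnj)
    have "y \<bullet> S \<le> norm d * norm S"
      using norm_cauchy_schwarz[of y S] by (simp add: yd norm_vec_cnj)
    with lower have "norm d * (\<alpha> * norm d) \<le> norm d * norm S"
      by (simp add: Ay power2_eq_square mult_ac)
    then have "\<alpha> * norm d \<le> norm S"
      by (cases "d = 0") auto
    then show "\<alpha> * norm d \<le> norm (\<Sum>i=1..m. s i *\<^sub>R (cnj (f (x i) - lin_comb \<phi> c (x i)) *s \<phi> (x i)))"
      by (simp add: S_def g_def)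
    \<comment> \<open>Expanding from d to 0 gives J 0 as J d plus the form of A' at y; the
      nonnegative J d is dropped.\<close>
    have "0 \<le> J d" unfolding J_def by (intro sum_nonneg mult_nonneg_nonneg s) auto
    moreover have "vec_cnj (- d) = - y" by (simp add: yd vec_cnj_def vec_eq_iff)
    moreover have "A' *v (- y) = - (A' *v y)"
      using matrix_mult_scaleR_vec[of A' "-1" y] by simp
    ultimately have "y \<bullet> (A' *v y) \<le> J 0"
      using J[of "- d"] by simp
    with lower show "\<alpha> * (norm d)\<^sup>2 \<le> (\<Sum>i=1..m. s i * (cmod (f (x i) - lin_comb \<phi> c (x i)))\<^sup>2)"
      by (simp add: J_def)
  qed
qed


section \<open>Algorithm A\<close>

lemma resolvent_eq: "resolvent A l = matrix_inv (A - l *\<^sub>R mat 1)"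
  by (simp add: resolvent_def)

lemma posdef_scaleR_mat1: "0 < k \<Longrightarrow> posdef (k *\<^sub>R mat 1)"
  by (simp add: posdef_def selfadj_simps scaleR_matrix_mult_vec)

text \<open>Origin of the starting barrier -n: it normalises the initial potential.\<close>

lemma rtrace_resolvent_0:
  "rtrace (resolvent (0 :: complex^'n^'n) (- real CARD('n))) = 1"
proof -
  have "matrix_inv (real CARD('n) *\<^sub>R mat 1 :: complex^'n^'n) = (1 / real CARD('n)) *\<^sub>R mat 1"
    by (rule matrix_inv_eqI) (simp add: matrix_simps)
  then show ?thesis by (simp add: resolvent_eq rtrace_simps)
qed

lemma norm_vector_smult: "norm (a *s (v :: complex^'n)) = cmod a * norm v"
proof -
  have "(norm (a *s v))\<^sup>2 = (cmod a * norm v)\<^sup>2"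
    unfolding norm_vec_power2 power_mult_distrib
    by (simp add: norm_mult power_mult_distrib sum_distrib_left)
  then show ?thesis by (simp add: power2_eq_iff_nonneg)
qed

lemma inner_square_selfadj: "selfadj Z \<Longrightarrow> v \<bullet> ((Z ** Z) *v v) = (norm (Z *v v))\<^sup>2"
  by (simp add: power2_norm_eq_inner selfadjD flip: matrix_vector_mul_assoc)

lemma rho_A_eq: "rho_A \<phi> \<gamma> A l y = \<phi> y \<bullet> (resolvent A l *v \<phi> y) + \<gamma> / real CARD('n) * (norm (\<phi> y))\<^sup>2"
  for \<phi> :: "'a \<Rightarrow> complex^'n"
  by (simp add: rho_A_def Re_qform matrix_vector_mult_add_rdistrib scaleR_matrix_mult_vec inner_simps
      power2_norm_eq_inner)

section \<open>One step of algorithm A\<close>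

locale step_A =
  fixes A :: "complex^'n^'n" and l \<epsilon> \<gamma> :: real
  assumes posdef_A: "posdef (A - l *\<^sub>R mat 1)" and \<epsilon>: "0 < \<epsilon>" "\<epsilon> < 1" and \<gamma>: "0 \<le> \<gamma>"
begin

abbreviation "l' \<equiv> barrier_A \<epsilon> \<gamma> A l"
abbreviation "Y \<equiv> resolvent A l"
abbreviation "Z \<equiv> resolvent A l'"
abbreviation "\<Psi> \<equiv> rtrace Y + \<gamma>"
abbreviation "\<Xi> \<equiv> Xi_A \<gamma> A l'"

lemma Y_posdef: "posdef Y"
  unfolding resolvent_eq by (rule posdef_inv[OF posdef_A])

lemma rtrace_Y_pos: "0 < rtrace Y" and \<Psi>_pos: "0 < \<Psi>"
  using posdef_rtrace_pos[OF Y_posdef] \<gamma> by auto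

lemma barrier_shift: "A - l' *\<^sub>R mat 1 = (A - l *\<^sub>R mat 1) - (\<epsilon> / \<Psi>) *\<^sub>R mat 1"
  by (simp add: barrier_A_def algebra_simps)

text \<open>The step \<epsilon> / \<Psi> of the barrier is below 1 / Tr Y, since \<epsilon> < 1 and
  \<Psi> \<ge> Tr Y.\<close>

lemma posdef_A': "posdef (A - l' *\<^sub>R mat 1)"
  unfolding barrier_shift
proof (rule posdef_diff_scaleR_mat1[OF posdef_A], fold resolvent_eq)
  have "\<epsilon> * rtrace Y < 1 * rtrace Y"
    using \<epsilon> rtrace_Y_pos by (intro mult_strict_right_mono) auto
  then have "\<epsilon> * rtrace Y < \<Psi>" using \<gamma> by simp
  then show "\<epsilon> / \<Psi> * rtrace Y < 1" using \<Psi>_pos by simp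
qed

lemma Z_posdef: "posdef Z"
  unfolding resolvent_eq by (rule posdef_inv[OF posdef_A'])

lemma \<Xi>_ge: "\<gamma> \<le> \<Xi>" and \<Xi>_pos: "0 < \<Xi>"
  using posdef_rtrace_pos[OF Z_posdef] \<gamma> by (auto simp: Xi_A_def)

lemma rho_nonneg: "0 \<le> rho_A \<phi> \<gamma> A l' y"
  unfolding rho_A_eq by (intro add_nonneg_nonneg posdef_nonneg Z_posdef) (simp add: \<gamma>)

lemma rho_ge: "\<phi> y \<bullet> (Z *v \<phi> y) \<le> rho_A \<phi> \<gamma> A l' y"
  unfolding rho_A_eq using \<gamma> by simp

text \<open>Contribution of the summand \<gamma> I / n: it bounds |\<phi>(y)|^2 / \<rho> by n /
  \<gamma>, which controls the second moment of the residual, whereas \<open>rho_ge\<close> serves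
  the potential.\<close>

lemma rho_ge': "\<gamma> / real CARD('n) * (norm (\<phi> y))\<^sup>2 \<le> rho_A \<phi> \<gamma> A l' y"
  unfolding rho_A_eq using posdef_nonneg[OF Z_posdef] by simp

text \<open>Z is positive definite and bounds the density from below. Where the density vanishes,
  the weight is a quotient by zero, but it multiplies a zero matrix or vector.\<close>

lemma rho_eq_0: "rho_A \<phi> \<gamma> A l' y = 0 \<Longrightarrow> \<phi> y = 0"
  using rho_ge[of \<phi> y] posdef_pos[OF Z_posdef, of "\<phi> y"] by fastforce

lemma eta_pos: "0 < eta \<epsilon>"
  using \<epsilon> by (simp add: eta_def)

lemma posdef_update: "posdef (A + (eta \<epsilon> / rho_A \<phi> \<gamma> A l' y) *\<^sub>R outer (\<phi> y) - l' *\<^sub>R mat 1)"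
proof -
  have "0 \<le> eta \<epsilon> / rho_A \<phi> \<gamma> A l' y"
    by (rule divide_nonneg_nonneg[OF less_imp_le[OF eta_pos] rho_nonneg])
  from posdef_add_outer[OF posdef_A' this, of "\<phi> y"] show ?thesis
    by (simp add: algebra_simps)
qed

text \<open>Sherman-Morrison with weight s = \<eta> / \<rho>. Since q \<le> \<rho>, the denominator
  1 + s q is at most 1 + \<eta> = 1 / (1 - \<epsilon>), and s (1 - \<epsilon>) = \<epsilon> /
  \<rho>; this explains the choice of \<eta>.\<close>

lemma rtrace_update:
  assumes \<rho>: "0 < rho_A \<phi> \<gamma> A l' y"
  shows "rtrace (resolvent (A + (eta \<epsilon> / rho_A \<phi> \<gamma> A l' y) *\<^sub>R outer (\<phi> y)) l')
    \<le> rtrace Z - \<epsilon> / rho_A \<phi> \<gamma> A l' y * (\<phi> y \<bullet> ((Z ** Z) *v \<phi> y))"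
proof -
  define s where "s = eta \<epsilon> / rho_A \<phi> \<gamma> A l' y"
  define q where "q = \<phi> y \<bullet> (Z *v \<phi> y)"
  define t where "t = \<phi> y \<bullet> ((Z ** Z) *v \<phi> y)"
  have s: "0 \<le> s" unfolding s_def using eta_pos \<rho> by simp
  have q: "0 \<le> q" unfolding q_def by (rule posdef_nonneg[OF Z_posdef])
  have t: "0 \<le> t" unfolding t_def by (simp add: inner_square_selfadj posdef_selfadj Z_posdef)
  have "A + s *\<^sub>R outer (\<phi> y) - l' *\<^sub>R mat 1 = A - l' *\<^sub>R mat 1 + s *\<^sub>R outer (\<phi> y)" by simp
  then have eq: "rtrace (resolvent (A + s *\<^sub>R outer (\<phi> y)) l') = rtrace Z - s * t / (1 + s * q)"
    unfolding resolvent_eq t_def q_def by (simp only: rtrace_inv_add_outer[OF posdef_A' s])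
  have "s * q \<le> s * rho_A \<phi> \<gamma> A l' y"
    unfolding q_def by (intro mult_left_mono rho_ge s)
  then have "1 + s * q \<le> 1 / (1 - \<epsilon>)"
    using \<rho> \<epsilon> by (simp add: s_def eta_def) (simp add: field_simps)
  then have "s * t / (1 / (1 - \<epsilon>)) \<le> s * t / (1 + s * q)"
  proof (rule divide_left_mono)
    have "0 < 1 + s * q" using s q by (simp add: add_pos_nonneg)
    then show "0 < 1 / (1 - \<epsilon>) * (1 + s * q)" using \<epsilon> by simp
    show "0 \<le> s * t" using s t by simp
  qed
  moreover have "s * t / (1 / (1 - \<epsilon>)) = \<epsilon> / rho_A \<phi> \<gamma> A l' y * t"
    using \<epsilon> by (simp add: s_def eta_def)
  ultimately show ?thesis
    unfolding s_def[symmetric] t_def[symmetric] eq by simp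
qed

text \<open>The left-hand side is the bound for the expected potential after the step. With a =
  Tr(ZY), c = Tr(ZYZ) and d = \<epsilon> / \<Psi> one has Tr Z - Tr Y = d a, \<Xi> = \<Psi> + d a
  and Tr(ZZ) = a + d c. The claim thus reduces to a^2 \<le> c \<Psi>, which follows from the trace
  inequality because \<Psi> \<ge> Tr Y.\<close>

lemma rtrace_Z_le: "rtrace Z - \<epsilon> * rtrace (Z ** Z) / \<Xi> \<le> rtrace Y"
proof -
  define a where "a = rtrace (Z ** Y)"
  define c where "c = rtrace (Z ** Y ** Z)"
  define d where "d = \<epsilon> / \<Psi>"
  have d: "0 < d" unfolding d_def using \<epsilon> \<Psi>_pos by simp
  have B': "posdef ((A - l *\<^sub>R mat 1) - d *\<^sub>R mat 1)"
    using posdef_A' unfolding barrier_shift d_def .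
  have Z: "Z = matrix_inv ((A - l *\<^sub>R mat 1) - d *\<^sub>R mat 1)"
    unfolding resolvent_eq barrier_shift d_def ..
  note tr = shifted_inverse_traces[OF posdef_A d B', folded Z resolvent_eq, folded a_def c_def]
  have "a\<^sup>2 \<le> c * \<Psi>"
    using tr(4,5) \<gamma> by (smt (verit) distrib_left mult_nonneg_nonneg)
  then have "d * a * a \<le> d * (c * \<Psi>)"
    using d by (simp add: power2_eq_square mult.assoc)
  then have "a * \<Xi> \<le> \<Psi> * rtrace (Z ** Z)"
    unfolding tr(2) Xi_A_def using tr(1) by (simp add: algebra_simps)
  then have "\<epsilon> * (a * \<Xi>) \<le> \<epsilon> * (\<Psi> * rtrace (Z ** Z))"
    using \<epsilon> by simp
  then have "d * a \<le> \<epsilon> * rtrace (Z ** Z) / \<Xi>"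
    unfolding d_def using \<Psi>_pos \<Xi>_pos by (simp add: field_simps)
  then show ?thesis using tr(1) by simp
qed

end

section \<open>The run of algorithm A and its expected potential\<close>

locale algorithm_A = L2_basis M V \<phi> for M :: "'a measure" and V and \<phi> :: "'a \<Rightarrow> complex^'n" +
  fixes \<epsilon> \<gamma> :: real
  assumes \<epsilon>: "0 < \<epsilon>" "\<epsilon> < 1" and \<gamma>: "0 \<le> \<gamma>"
begin

abbreviation "mat_at x i \<equiv> fst (state_A \<phi> \<epsilon> \<gamma> x i)"
abbreviation "low_at x i \<equiv> snd (state_A \<phi> \<epsilon> \<gamma> x i)"
abbreviation "next_low x i \<equiv> barrier_A \<epsilon> \<gamma> (mat_at x i) (low_at x i)"
abbreviation "potential x i \<equiv> rtrace (resolvent (mat_at x i) (low_at x i))"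

definition dens :: "nat \<Rightarrow> (nat \<Rightarrow> 'a) \<Rightarrow> 'a \<Rightarrow> real" where
  "dens i x y = rho_A \<phi> \<gamma> (mat_at x i) (next_low x i) y / Xi_A \<gamma> (mat_at x i) (next_low x i)"

text \<open>Holds for every sequence of points and not only almost surely: the weights are
  nonnegative, also where the density vanishes, and a nonnegative rank-one term preserves positivity
  above the raised barrier.\<close>

lemma posdef_state: "posdef (mat_at x i - low_at x i *\<^sub>R mat 1)"
proof (induction i)
  case 0
  then show ?case by (simp add: posdef_scaleR_mat1)
next
  case (Suc i)
  interpret step_A "mat_at x i" "low_at x i" \<epsilon> \<gamma>
    by unfold_locales (use Suc \<epsilon> \<gamma> in auto)
  show ?case by (simp add: Let_def posdef_update)
qed

lemma step_A_state: "step_A (mat_at x i) (low_at x i) \<epsilon> \<gamma>"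
  by unfold_locales (use posdef_state \<epsilon> \<gamma> in auto)

lemma state_A_upd: "j \<le> i \<Longrightarrow> state_A \<phi> \<epsilon> \<gamma> (x(Suc i := y)) j = state_A \<phi> \<epsilon> \<gamma> x j"
  by (induction j) (auto simp: Let_def)

lemma dens_integral: "(\<integral>\<^sup>+ y. ennreal (dens i x y) \<partial>M) = 1"
proof -
  interpret step_A "mat_at x i" "low_at x i" \<epsilon> \<gamma> by (rule step_A_state)
  have "integrable M (rho_A \<phi> \<gamma> (mat_at x i) l')"
    unfolding rho_A_def by (rule integrable_qform)
  moreover have "(\<integral>y. rho_A \<phi> \<gamma> (mat_at x i) l' y \<partial>M) = \<Xi>"
    unfolding rho_A_def integral_qform by (simp add: rtrace_simps Xi_A_def)
  ultimately show ?thesis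
    unfolding dens_def using rho_nonneg \<Xi>_pos
    by (subst nn_integral_eq_integral) (auto intro!: AE_I2 divide_nonneg_pos)
qed

sublocale chain: density_chain M "kernel_A M \<phi> \<epsilon> \<gamma>" dens
proof
  fix i x
  show "kernel_A M \<phi> \<epsilon> \<gamma> (Suc i) x = density M (\<lambda>y. ennreal (dens i x y))"
    by (simp add: kernel_A_def dens_def case_prod_beta Let_def)
  note [measurable] = state_A_measurable[OF basis_measurable order_refl, where \<epsilon> = \<epsilon> and \<gamma> = \<gamma>]
  show "(\<lambda>(x, y). dens i x y) \<in> borel_measurable (Pi\<^sub>M {1..i} (\<lambda>_. M) \<Otimes>\<^sub>M M)"
    unfolding dens_def by measurable
qed (simp add: dens_integral)

lemma law_A_eq: "law_A M \<phi> \<epsilon> \<gamma> m = chain.law m"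
  by (simp add: law_A_def)

lemma prob_space_law: "prob_space (chain.law i)"
proof (induction i)
  case (Suc i)
  then show ?case by (rule chain.prob_space_law_Suc) (simp add: dens_integral)
qed (rule chain.prob_space_law_0)

lemma potential_measurable: "j \<le> i \<Longrightarrow> (\<lambda>x. potential x j) \<in> borel_measurable (chain.prodM i)"
  using state_A_measurable[OF basis_measurable, where i = j and j = i and \<epsilon> = \<epsilon> and \<gamma> = \<gamma>] by simp

lemma potential_pos: "0 < potential x i"
  using step_A.rtrace_Y_pos[OF step_A_state] .

text \<open>The density \<rho> / \<Xi> cancels the factor 1 / \<rho> in
  \<open>rtrace_update\<close>. What remains is a quadratic form in \<phi>(y) with mean Tr Z -
  \<epsilon> Tr(ZZ) / \<Xi>, to which \<open>rtrace_Z_le\<close> applies.\<close>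

lemma potential_step:
  "(\<integral>\<^sup>+ y. ennreal (dens i x y) * ennreal (potential (x(Suc i := y)) (Suc i)) \<partial>M) \<le> ennreal (potential x i)"
proof -
  interpret step_A "mat_at x i" "low_at x i" \<epsilon> \<gamma> by (rule step_A_state)
  let ?\<rho> = "rho_A \<phi> \<gamma> (mat_at x i) l'"
  define u where "u y = (?\<rho> y * rtrace Z - \<epsilon> * (\<phi> y \<bullet> ((Z ** Z) *v \<phi> y))) / \<Xi>" for y
  have le: "dens i x y * potential (x(Suc i := y)) (Suc i) \<le> u y" for y
  proof (cases "?\<rho> y = 0")
    case True
    with rho_eq_0[OF True] show ?thesis by (simp add: dens_def u_def)
  next
    case False
    then have \<rho>: "0 < ?\<rho> y" using rho_nonneg[of \<phi> y] by simp
    have "potential (x(Suc i := y)) (Suc i) \<le> rtrace Z - \<epsilon> / ?\<rho> y * (\<phi> y \<bullet> ((Z ** Z) *v \<phi> y))"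
      using rtrace_update[OF \<rho>] by (simp add: Let_def state_A_upd)
    then have "?\<rho> y / \<Xi> * potential (x(Suc i := y)) (Suc i)
        \<le> ?\<rho> y / \<Xi> * (rtrace Z - \<epsilon> / ?\<rho> y * (\<phi> y \<bullet> ((Z ** Z) *v \<phi> y)))"
      using \<rho> \<Xi>_pos by (intro mult_left_mono) auto
    also have "\<dots> = u y"
      using \<rho> \<Xi>_pos by (simp add: u_def field_simps)
    finally show ?thesis by (simp add: dens_def)
  qed
  have dens_nonneg: "0 \<le> dens i x y" for y
    unfolding dens_def by (rule divide_nonneg_pos[OF rho_nonneg \<Xi>_pos])
  have int: "integrable M ?\<rho>" "integrable M (\<lambda>y. \<phi> y \<bullet> ((Z ** Z) *v \<phi> y))"
    unfolding rho_A_def Re_qform[symmetric] by (rule integrable_qform)+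
  have int_\<rho>: "(\<integral>y. ?\<rho> y \<partial>M) = \<Xi>"
    unfolding rho_A_def integral_qform by (simp add: rtrace_simps Xi_A_def)
  have int_ZZ: "(\<integral>y. \<phi> y \<bullet> ((Z ** Z) *v \<phi> y) \<partial>M) = rtrace (Z ** Z)"
    unfolding Re_qform[symmetric] by (rule integral_qform)
  have "(\<integral>\<^sup>+ y. ennreal (dens i x y) * ennreal (potential (x(Suc i := y)) (Suc i)) \<partial>M)
      \<le> (\<integral>\<^sup>+ y. ennreal (u y) \<partial>M)"
    using le by (intro nn_integral_mono)
      (simp add: ennreal_mult'[OF dens_nonneg, symmetric] ennreal_leI)
  also have "\<dots> = ennreal (\<integral>y. u y \<partial>M)"
  proof (rule nn_integral_eq_integral)
    show "integrable M u" unfolding u_def using int by simp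
    have "0 \<le> u y" for y
      using order_trans[OF mult_nonneg_nonneg[OF dens_nonneg less_imp_le[OF potential_pos]] le] .
    then show "AE y in M. 0 \<le> u y" by simp
  qed
  also have "(\<integral>y. u y \<partial>M) = (\<Xi> * rtrace Z - \<epsilon> * rtrace (Z ** Z)) / \<Xi>"
    unfolding u_def using int by (simp add: int_\<rho> int_ZZ)
  also have "\<dots> = rtrace Z - \<epsilon> * rtrace (Z ** Z) / \<Xi>"
    using \<Xi>_pos by (simp add: field_simps)
  also have "ennreal \<dots> \<le> ennreal (potential x i)" by (intro ennreal_leI rtrace_Z_le)
  finally show ?thesis .
qed

text \<open>Stated for all j \<le> i under the law of the longer run, because the average of the
  potentials at all times is needed under a single law. The potentials at earlier times do not see
  the new draw, which integrates out.\<close>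

lemma potential_expectation:
  "j \<le> i \<Longrightarrow> (\<integral>\<^sup>+ x. ennreal (potential x j) \<partial>chain.law i) \<le> 1"
proof (induction i arbitrary: j)
  case 0
  then show ?case
    by (subst chain.nn_integral_law_0)
       (use potential_measurable[of 0 0] in \<open>simp_all add: rtrace_resolvent_0\<close>)
next
  case (Suc i)
  note [measurable] = potential_measurable[OF Suc.prems]
  have eq: "(\<integral>\<^sup>+ x. ennreal (potential x j) \<partial>chain.law (Suc i)) =
      (\<integral>\<^sup>+ x. \<integral>\<^sup>+ y. ennreal (dens i x y) * ennreal (potential (x(Suc i := y)) j) \<partial>M \<partial>chain.law i)"
    by (rule chain.nn_integral_law_Suc) measurable
  show ?case
  proof (cases "j = Suc i")
    case True
    have "(\<integral>\<^sup>+ x. ennreal (potential x j) \<partial>chain.law (Suc i))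
        \<le> (\<integral>\<^sup>+ x. ennreal (potential x i) \<partial>chain.law i)"
      unfolding eq unfolding True by (intro nn_integral_mono potential_step)
    also have "\<dots> \<le> 1" by (rule Suc.IH) simp
    finally show ?thesis .
  next
    case False
    then have j: "j \<le> i" using Suc.prems by simp
    have "(\<integral>\<^sup>+ x. ennreal (potential x j) \<partial>chain.law (Suc i)) =
        (\<integral>\<^sup>+ x. \<integral>\<^sup>+ y. ennreal (dens i x y) * ennreal (potential x j) \<partial>M \<partial>chain.law i)"
      unfolding eq by (simp add: state_A_upd[OF j])
    also have "\<dots> = (\<integral>\<^sup>+ x. ennreal (potential x j) \<partial>chain.law i)"
    proof (intro nn_integral_cong)
      fix x assume "x \<in> space (chain.law i)"
      then have [measurable]: "dens i x \<in> borel_measurable M"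
        unfolding chain.space_law by (rule chain.density_measurable1)
      show "(\<integral>\<^sup>+ y. ennreal (dens i x y) * ennreal (potential x j) \<partial>M) = ennreal (potential x j)"
        by (simp add: nn_integral_multc dens_integral)
    qed
    finally show ?thesis using Suc.IH[OF j] by simp
  qed
qed

text \<open>\<open>next_low x i\<close> is the barrier with index i + 1, which is already determined
  by the first i points. The sum therefore has i + 1 terms; this is the origin of m + 1 in
  r.\<close>

lemma next_low_eq: "next_low x i = - real CARD('n) + (\<Sum>j\<le>i. \<epsilon> / (potential x j + \<gamma>))"
  by (induction i) (simp_all add: barrier_A_def Let_def)

lemma event_A_iff:
  assumes "x \<in> space (law_A M \<phi> \<epsilon> \<gamma> m)"
    and "\<alpha> = real CARD('n) * (\<epsilon> * ((real m + 1) / real CARD('n)) / (1 / p + \<gamma>) - 1)"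
  shows "x \<in> event_A M \<phi> \<epsilon> \<gamma> p m \<longleftrightarrow> (\<forall>v. \<alpha> * (norm v)\<^sup>2 \<le> v \<bullet> (mat_at x m *v v))"
proof -
  \<comment> \<open>Selfadjointness is known for the state minus its barrier; adding back a multiple
    of the identity transfers it to \<alpha>.\<close>
  have "selfadj (mat_at x m - low_at x m *\<^sub>R mat 1 + (low_at x m - \<alpha>) *\<^sub>R mat 1)"
    by (intro selfadj_simps posdef_selfadj posdef_state)
  then have "selfadj (mat_at x m - \<alpha> *\<^sub>R mat 1)"
    by (simp add: algebra_simps)
  then show ?thesis
    using assms(1) unfolding assms(2)
    by (simp add: event_A_def Let_def matrix_A_def psd_def selfadj_qform_Reals Re_qform
        matrix_vector_mult_diff_rdistrib scaleR_matrix_mult_vec inner_simps power2_norm_eq_inner)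
qed

text \<open>
  Tangent line of \<open>t \<mapsto> 1 / t\<close> at \<open>c = 1 / p + \<gamma>\<close>: if the average of the potentials is at most
  \<open>1 / p\<close>, then the average of \<open>1 / \<Psi>\<^sub>i\<close> is at least \<open>1 / c\<close>.
\<close>

lemma event_A_superset:
  assumes p: "0 < p"
    and x: "x \<in> space (law_A M \<phi> \<epsilon> \<gamma> m)"
    and avg: "(\<Sum>j\<le>m. potential x j) \<le> (real m + 1) / p"
  shows "x \<in> event_A M \<phi> \<epsilon> \<gamma> p m"
proof (subst event_A_iff[OF x refl], intro allI)
  fix v :: "complex^'n"
  interpret step_A "mat_at x m" "low_at x m" \<epsilon> \<gamma> by (rule step_A_state)
  define c where "c = 1 / p + \<gamma>"
  have c: "0 < c" unfolding c_def using p \<gamma> by (simp add: add_pos_nonneg)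
  have tangent: "2 / c - t / c\<^sup>2 \<le> 1 / t" if "0 < t" for t :: real
  proof -
    have "0 \<le> (t - c)\<^sup>2 / (t * c\<^sup>2)" using that by simp
    also have "\<dots> = 1 / t - (2 / c - t / c\<^sup>2)"
      using that c by (simp add: power2_eq_square field_simps)
    finally show ?thesis by simp
  qed
  have "(\<Sum>j\<le>m. potential x j + \<gamma>) \<le> (real m + 1) * c"
    using avg by (simp add: sum.distrib c_def add_divide_distrib algebra_simps)
  then have "(\<Sum>j\<le>m. potential x j + \<gamma>) / c\<^sup>2 \<le> (real m + 1) * c / c\<^sup>2"
    by (intro divide_right_mono) auto
  moreover have "(real m + 1) * c / c\<^sup>2 = (real m + 1) / c"
    using c by (simp add: power2_eq_square)
  moreover have "2 * (real m + 1) / c = (real m + 1) / c + (real m + 1) / c"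
    by simp
  ultimately have "(real m + 1) / c \<le> 2 * (real m + 1) / c - (\<Sum>j\<le>m. potential x j + \<gamma>) / c\<^sup>2"
    by linarith
  also have "\<dots> = (\<Sum>j\<le>m. 2 / c - (potential x j + \<gamma>) / c\<^sup>2)"
    unfolding sum_subtractf sum_divide_distrib by simp
  also have "\<dots> \<le> (\<Sum>j\<le>m. 1 / (potential x j + \<gamma>))"
    by (intro sum_mono tangent) (use potential_pos \<gamma> in \<open>simp add: add_pos_nonneg\<close>)
  finally have "\<epsilon> * ((real m + 1) / c) \<le> \<epsilon> * (\<Sum>j\<le>m. 1 / (potential x j + \<gamma>))"
    by (rule mult_left_mono) (use \<epsilon> in simp)
  then have "\<epsilon> * ((real m + 1) / c) - real CARD('n) \<le> l'"
    unfolding next_low_eq by (simp add: sum_distrib_left)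
  then have "(\<epsilon> * ((real m + 1) / c) - real CARD('n)) * (norm v)\<^sup>2 \<le> l' * (norm v)\<^sup>2"
    by (intro mult_right_mono) auto
  \<comment> \<open>A_m lies above the next barrier, with index m + 1, and not only above its
    own.\<close>
  also have "\<dots> \<le> v \<bullet> (mat_at x m *v v)"
    using posdef_nonneg[OF posdef_A', of v]
    by (simp add: matrix_vector_mult_diff_rdistrib scaleR_matrix_mult_vec inner_simps power2_norm_eq_inner)
  finally show "real CARD('n) * (\<epsilon> * ((real m + 1) / real CARD('n)) / (1 / p + \<gamma>) - 1) * (norm v)\<^sup>2
      \<le> v \<bullet> (mat_at x m *v v)"
    unfolding c_def[symmetric] by (simp add: right_diff_distrib)
qed

lemma event_A_sets: "event_A M \<phi> \<epsilon> \<gamma> p m \<in> sets (law_A M \<phi> \<epsilon> \<gamma> m)"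
proof -
  note [measurable] = state_A_measurable[OF basis_measurable order_refl[of m], where \<epsilon> = \<epsilon> and \<gamma> = \<gamma>]
  have "Measurable.pred (law_A M \<phi> \<epsilon> \<gamma> m) (\<lambda>x. psd (mat_at x m - \<alpha> *\<^sub>R mat 1))" for \<alpha>
    unfolding law_A_eq measurable_cong_sets[OF chain.sets_law refl]
    by (rule pred_psd) measurable
  then show ?thesis
    unfolding event_A_def Let_def matrix_A_def by measurable
qed

lemma event_A_prob:
  assumes p: "0 < p"
  shows "1 - p \<le> measure (law_A M \<phi> \<epsilon> \<gamma> m) (event_A M \<phi> \<epsilon> \<gamma> p m)"
proof -
  interpret L: prob_space "chain.law m" by (rule prob_space_law)
  have [measurable]: "(\<lambda>x. potential x j) \<in> borel_measurable (chain.law m)" if "j \<le> m" for j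
    using potential_measurable[OF that] by (simp add: measurable_cong_sets[OF chain.sets_law refl])
  have [measurable]: "(\<lambda>x. \<Sum>j\<le>m. potential x j) \<in> borel_measurable (chain.law m)"
    by (rule borel_measurable_sum) simp
  define B where "B = {x \<in> space (chain.law m). (real m + 1) / p \<le> (\<Sum>j\<le>m. potential x j)}"
  have B: "B \<in> sets (chain.law m)" unfolding B_def by measurable
  have c: "0 < (real m + 1) / p" using p by simp
  have sum: "(\<integral>\<^sup>+ x. ennreal (\<Sum>j\<le>m. potential x j) \<partial>chain.law m) \<le> ennreal (real m + 1)"
  proof -
    have "(\<integral>\<^sup>+ x. ennreal (\<Sum>j\<le>m. potential x j) \<partial>chain.law m)
        = (\<Sum>j\<le>m. \<integral>\<^sup>+ x. ennreal (potential x j) \<partial>chain.law m)"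
      unfolding sum_ennreal[OF less_imp_le[OF potential_pos], symmetric]
      by (rule nn_integral_sum) simp
    also have "\<dots> \<le> (\<Sum>j\<le>m. 1)"
      by (intro sum_mono potential_expectation) simp
    also have "(\<Sum>j\<le>m. 1 :: ennreal) = ennreal (real (Suc m))"
      by (simp only: sum_constant card_atMost ennreal_of_nat_eq_real_of_nat mult_1_right)
    also have "real (Suc m) = real m + 1" by simp
    finally show ?thesis .
  qed
  have "ennreal ((real m + 1) / p) * emeasure (chain.law m) B
      = (\<integral>\<^sup>+ x. ennreal ((real m + 1) / p) * indicator B x \<partial>chain.law m)"
    using B by (simp add: nn_integral_cmult_indicator)
  also have "\<dots> \<le> (\<integral>\<^sup>+ x. ennreal (\<Sum>j\<le>m. potential x j) \<partial>chain.law m)"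
    by (intro nn_integral_mono) (auto simp: B_def indicator_def intro!: ennreal_leI)
  also note sum
  finally have "ennreal ((real m + 1) / p * L.prob B) \<le> ennreal (real m + 1)"
    by (simp only: L.emeasure_eq_measure ennreal_mult'[OF less_imp_le[OF c]])
  then have "(real m + 1) / p * L.prob B \<le> real m + 1"
    by (subst (asm) ennreal_le_iff) auto
  then have "L.prob B \<le> p"
    using p by (simp add: divide_le_eq mult_le_cancel_left_pos)
  moreover have "L.prob (space (chain.law m) - B) = 1 - L.prob B"
    using B by (rule L.prob_compl)
  moreover have "L.prob (space (chain.law m) - B) \<le> L.prob (event_A M \<phi> \<epsilon> \<gamma> p m)"
  proof (rule L.finite_measure_mono)
    show "event_A M \<phi> \<epsilon> \<gamma> p m \<in> sets (chain.law m)"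
      using event_A_sets by (simp add: law_A_eq)
    show "space (chain.law m) - B \<subseteq> event_A M \<phi> \<epsilon> \<gamma> p m"
    proof
      fix x assume "x \<in> space (chain.law m) - B"
      then have "x \<in> space (law_A M \<phi> \<epsilon> \<gamma> m)" "(\<Sum>j\<le>m. potential x j) \<le> (real m + 1) / p"
        by (auto simp: law_A_eq B_def)
      then show "x \<in> event_A M \<phi> \<epsilon> \<gamma> p m" by (rule event_A_superset[OF p])
    qed
  qed
  ultimately show ?thesis by (simp add: law_A_eq)
qed

section \<open>Second moment of the right-hand side of the normal equations\<close>

definition residual :: "('a \<Rightarrow> complex) \<Rightarrow> (nat \<Rightarrow> 'a) \<Rightarrow> nat \<Rightarrow> complex^'n" where
  "residual g x i = (\<Sum>j=1..i. weight_A \<phi> \<epsilon> \<gamma> x j *\<^sub>R (cnj (g (x j)) *s \<phi> (x j)))"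

lemma weight_A_Suc: "weight_A \<phi> \<epsilon> \<gamma> x (Suc i)
    = eta \<epsilon> / rho_A \<phi> \<gamma> (mat_at x i) (next_low x i) (x (Suc i))"
  by (simp add: weight_A_def case_prod_beta)

lemma weight_A_nonneg: "0 \<le> weight_A \<phi> \<epsilon> \<gamma> x j"
proof -
  interpret step_A "mat_at x (j - 1)" "low_at x (j - 1)" \<epsilon> \<gamma> by (rule step_A_state)
  show ?thesis
    unfolding weight_A_def case_prod_beta Let_def
    by (rule divide_nonneg_nonneg[OF less_imp_le[OF eta_pos] rho_nonneg])
qed

lemma matrix_A_eq_sum: "mat_at x i = (\<Sum>j=1..i. weight_A \<phi> \<epsilon> \<gamma> x j *\<^sub>R outer (\<phi> (x j)))"
  by (induction i) (simp_all add: Let_def weight_A_Suc)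

lemma weight_A_upd: "j \<le> i \<Longrightarrow> weight_A \<phi> \<epsilon> \<gamma> (x(Suc i := y)) j = weight_A \<phi> \<epsilon> \<gamma> x j"
  by (simp add: weight_A_def state_A_upd)

lemma residual_upd:
  "residual g (x(Suc i := y)) (Suc i) = residual g x i
    + (eta \<epsilon> / rho_A \<phi> \<gamma> (mat_at x i) (next_low x i) y) *\<^sub>R (cnj (g y) *s \<phi> y)"
  by (simp add: residual_def weight_A_Suc state_A_upd weight_A_upd)

lemma residual_measurable:
  assumes [measurable]: "g \<in> borel_measurable M"
  shows "(\<lambda>x. residual g x i) \<in> borel_measurable (chain.prodM i)"
  unfolding residual_def
proof (rule borel_measurable_sum)
  fix j assume j: "j \<in> {1..i}"
  then obtain k where k: "j = Suc k" "k \<le> i" by (cases j) auto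
  have [measurable]: "(\<lambda>x. x j) \<in> measurable (chain.prodM i) M"
    using j by (rule measurable_component_singleton)
  note [measurable] = state_A_measurable[OF basis_measurable k(2), where \<epsilon> = \<epsilon> and \<gamma> = \<gamma>]
  have "(\<lambda>x. weight_A \<phi> \<epsilon> \<gamma> x j) \<in> borel_measurable (chain.prodM i)"
    unfolding k weight_A_Suc unfolding k(1)[symmetric] by measurable
  moreover have "(\<lambda>x. cnj (g (x j)) *s \<phi> (x j)) \<in> borel_measurable (chain.prodM i)"
    by (intro borel_measurable_vecI) (simp only: vector_smult_component, measurable)
  ultimately show "(\<lambda>x. weight_A \<phi> \<epsilon> \<gamma> x j *\<^sub>R (cnj (g (x j)) *s \<phi> (x j))) \<in> borel_measurable (chain.prodM i)"
    by measurable
qed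

text \<open>
  The increments of the residual are centred given the past, since \<open>g\<close> is orthogonal to the
  basis, so their second moments add up.
\<close>

lemma residual_step:
  assumes g: "square_integrable M g" and orth: "\<And>j. (\<integral>y. g y * cnj (\<phi> y $ j) \<partial>M) = 0"
    and \<gamma>_pos: "0 < \<gamma>"
  shows "(\<integral>\<^sup>+ y. ennreal (dens i x y) * ennreal ((norm (residual g (x(Suc i := y)) (Suc i)))\<^sup>2) \<partial>M)
    \<le> ennreal ((norm (residual g x i))\<^sup>2)
      + ennreal (real CARD('n) * (eta \<epsilon>)\<^sup>2 / \<gamma>\<^sup>2 * (\<integral>y. (cmod (g y))\<^sup>2 \<partial>M))"
proof -
  interpret step_A "mat_at x i" "low_at x i" \<epsilon> \<gamma> by (rule step_A_state)
  let ?\<rho> = "rho_A \<phi> \<gamma> (mat_at x i) l'"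
  define C where "C = real CARD('n) * (eta \<epsilon>)\<^sup>2 / \<gamma>\<^sup>2"
  define S where "S = residual g x i"
  define c where "c = vec_cnj S"
  have S: "S = vec_cnj c" by (simp add: c_def vec_cnj_vec_cnj)
  \<comment> \<open>The expanded square times the density, with the quadratic term replaced by its
    bound \<open>C\<close> |g|^2; the integral of this majorant can be computed.\<close>
  define u where "u y = ?\<rho> y * ((norm S)\<^sup>2 / \<Xi>)
    + 2 * eta \<epsilon> / \<Xi> * Re (g y * cnj (lin_comb \<phi> c y)) + C * (cmod (g y))\<^sup>2" for y
  have le: "dens i x y * (norm (residual g (x(Suc i := y)) (Suc i)))\<^sup>2 \<le> u y" for y
  proof -
    define b where "b = cnj (g y) *s \<phi> y"
    define s where "s = eta \<epsilon> / ?\<rho> y"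
    have exp: "(norm (S + s *\<^sub>R b))\<^sup>2 = (norm S)\<^sup>2 + 2 * s * (S \<bullet> b) + s\<^sup>2 * (norm b)\<^sup>2"
      unfolding power2_norm_eq_inner inner_add_left inner_add_right inner_scaleR_left
        inner_scaleR_right inner_commute[of b S] unfolding power2_eq_square
      by (simp add: algebra_simps)
    have Sb: "S \<bullet> b = Re (g y * cnj (lin_comb \<phi> c y))"
      unfolding S b_def inner_vec_cnj by simp
    \<comment> \<open>In the cross term the density cancels the weight, so that its mean becomes an
      inner product of g with an element of V. Where \<rho> vanishes, so does \<phi>.\<close>
    have 1: "?\<rho> y * s * (S \<bullet> b) = eta \<epsilon> * (S \<bullet> b)"
      using rho_eq_0[of \<phi> y] by (cases "?\<rho> y = 0") (simp_all add: s_def b_def)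
    \<comment> \<open>Origin of \<open>C\<close>: |\<phi>|^2 / \<rho> \<le> n / \<gamma> and 1 /
      \<Xi> \<le> 1 / \<gamma>, times \<eta>^2 from the squared weight.\<close>
    have 2: "?\<rho> y * s\<^sup>2 * (norm b)\<^sup>2 / \<Xi> \<le> C * (cmod (g y))\<^sup>2"
    proof (cases "?\<rho> y = 0")
      case True
      then show ?thesis by (simp add: C_def)
    next
      case False
      then have \<rho>: "0 < ?\<rho> y" using rho_nonneg[of \<phi> y] by simp
      have "(norm (\<phi> y))\<^sup>2 \<le> real CARD('n) / \<gamma> * ?\<rho> y"
        using rho_ge'[of \<phi> y] \<gamma>_pos by (simp add: field_simps)
      then have "(norm (\<phi> y))\<^sup>2 / ?\<rho> y \<le> real CARD('n) / \<gamma>"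
        using \<rho> by (simp add: field_simps)
      moreover have "1 / \<Xi> \<le> 1 / \<gamma>"
        using \<Xi>_ge \<gamma>_pos by (intro divide_left_mono) (auto intro: mult_pos_pos)
      ultimately have "(norm (\<phi> y))\<^sup>2 / ?\<rho> y * (1 / \<Xi>) \<le> real CARD('n) / \<gamma> * (1 / \<gamma>)"
        using \<gamma>_pos \<Xi>_pos \<rho> by (intro mult_mono) auto
      then have "(eta \<epsilon>)\<^sup>2 * (cmod (g y))\<^sup>2 * ((norm (\<phi> y))\<^sup>2 / ?\<rho> y * (1 / \<Xi>))
          \<le> (eta \<epsilon>)\<^sup>2 * (cmod (g y))\<^sup>2 * (real CARD('n) / \<gamma> * (1 / \<gamma>))"
        by (intro mult_left_mono) auto
      then show ?thesis
        using \<rho> by (simp add: s_def b_def C_def norm_vector_smult power_mult_distrib power2_eq_square field_simps)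
    qed
    have "dens i x y * (norm (residual g (x(Suc i := y)) (Suc i)))\<^sup>2 = ?\<rho> y / \<Xi> * (norm (S + s *\<^sub>R b))\<^sup>2"
      by (simp add: residual_upd dens_def S_def s_def b_def)
    also have "\<dots> = ?\<rho> y * ((norm S)\<^sup>2 / \<Xi>) + 2 * (?\<rho> y * s * (S \<bullet> b)) / \<Xi> + ?\<rho> y * s\<^sup>2 * (norm b)\<^sup>2 / \<Xi>"
      unfolding exp by (simp add: add_divide_distrib algebra_simps)
    also have "\<dots> \<le> u y"
      unfolding 1 u_def using 2 by (simp add: Sb)
    finally show ?thesis .
  qed
  have dens_nonneg: "0 \<le> dens i x y" for y
    unfolding dens_def by (rule divide_nonneg_pos[OF rho_nonneg \<Xi>_pos])
  have int_\<rho>: "integrable M ?\<rho>" "(\<integral>y. ?\<rho> y \<partial>M) = \<Xi>"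
    unfolding rho_A_def integral_qform by (rule integrable_qform) (simp add: rtrace_simps Xi_A_def)
  have int_c: "integrable M (\<lambda>y. g y * cnj (lin_comb \<phi> c y))"
    by (rule square_integrable_mult[OF g lin_comb_square_integrable])
  have int_c0: "(\<integral>y. Re (g y * cnj (lin_comb \<phi> c y)) \<partial>M) = 0"
    using integral_Re[OF int_c] by (simp only: integral_mult_lin_comb[OF g] orth) simp
  have int_g: "integrable M (\<lambda>y. (cmod (g y))\<^sup>2)"
    using g by (simp add: square_integrable_def)
  have u_int: "integrable M u" and u_eq: "(\<integral>y. u y \<partial>M) = (norm S)\<^sup>2 + C * (\<integral>y. (cmod (g y))\<^sup>2 \<partial>M)"
  proof -
    have gen: "integrable M (\<lambda>y. a y * k + k' * b y + C * d y)"
      "(\<integral>y. a y * k + k' * b y + C * d y \<partial>M) = (\<integral>y. a y \<partial>M) * k + k' * (\<integral>y. b y \<partial>M) + C * (\<integral>y. d y \<partial>M)"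
      if "integrable M a" "integrable M b" "integrable M d" for a b d :: "'a \<Rightarrow> real" and k k'
      using that by simp_all
    note G = gen[OF int_\<rho>(1) integrable_Re[OF int_c] int_g]
    show "integrable M u" unfolding u_def by (rule G)
    show "(\<integral>y. u y \<partial>M) = (norm S)\<^sup>2 + C * (\<integral>y. (cmod (g y))\<^sup>2 \<partial>M)"
      unfolding u_def G int_\<rho> int_c0 using \<Xi>_pos by simp
  qed
  have "(\<integral>\<^sup>+ y. ennreal (dens i x y) * ennreal ((norm (residual g (x(Suc i := y)) (Suc i)))\<^sup>2) \<partial>M)
      \<le> (\<integral>\<^sup>+ y. ennreal (u y) \<partial>M)"
    using le by (intro nn_integral_mono)
      (simp add: ennreal_mult'[OF dens_nonneg, symmetric] ennreal_leI)
  also have "\<dots> = ennreal (\<integral>y. u y \<partial>M)"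
    using u_int order_trans[OF mult_nonneg_nonneg[OF dens_nonneg zero_le_power2] le]
    by (intro nn_integral_eq_integral AE_I2)
  also have "\<dots> = ennreal ((norm S)\<^sup>2) + ennreal (C * (\<integral>y. (cmod (g y))\<^sup>2 \<partial>M))"
    unfolding u_eq by (intro ennreal_plus) (auto simp: C_def intro!: mult_nonneg_nonneg)
  finally show ?thesis by (simp add: S_def C_def)
qed

lemma residual_expectation:
  assumes g: "square_integrable M g" and orth: "\<And>j. (\<integral>y. g y * cnj (\<phi> y $ j) \<partial>M) = 0"
    and \<gamma>_pos: "0 < \<gamma>"
  shows "(\<integral>\<^sup>+ x. ennreal ((norm (residual g x i))\<^sup>2) \<partial>chain.law i)
    \<le> ennreal (real i * (real CARD('n) * (eta \<epsilon>)\<^sup>2 / \<gamma>\<^sup>2 * (\<integral>y. (cmod (g y))\<^sup>2 \<partial>M)))"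
proof (induction i)
  case 0
  then show ?case
    by (subst chain.nn_integral_law_0) (simp_all add: residual_def)
next
  case (Suc i)
  interpret L: prob_space "chain.law i" by (rule prob_space_law)
  let ?C = "real CARD('n) * (eta \<epsilon>)\<^sup>2 / \<gamma>\<^sup>2 * (\<integral>y. (cmod (g y))\<^sup>2 \<partial>M)"
  have add: "ennreal (real i * k) + ennreal k = ennreal (real (Suc i) * k)" if "0 \<le> k" for k
    using that by (subst ennreal_plus[symmetric]) (simp_all add: algebra_simps)
  note meas = residual_measurable[OF square_integrable_measurable[OF g]]
  note [measurable] = meas
  have [measurable]: "(\<lambda>x. residual g x i) \<in> borel_measurable (chain.law i)"
    using meas[of i] by (simp add: measurable_cong_sets[OF chain.sets_law refl])
  have "(\<integral>\<^sup>+ x. ennreal ((norm (residual g x (Suc i)))\<^sup>2) \<partial>chain.law (Suc i))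
      = (\<integral>\<^sup>+ x. \<integral>\<^sup>+ y. ennreal (dens i x y)
          * ennreal ((norm (residual g (x(Suc i := y)) (Suc i)))\<^sup>2) \<partial>M \<partial>chain.law i)"
    by (rule chain.nn_integral_law_Suc) measurable
  also have "\<dots> \<le> (\<integral>\<^sup>+ x. ennreal ((norm (residual g x i))\<^sup>2) + ennreal ?C \<partial>chain.law i)"
    by (intro nn_integral_mono residual_step g orth \<gamma>_pos)
  also have "\<dots> = (\<integral>\<^sup>+ x. ennreal ((norm (residual g x i))\<^sup>2) \<partial>chain.law i) + ennreal ?C"
    by (subst nn_integral_add) (simp_all add: L.emeasure_space_1)
  also have "\<dots> \<le> ennreal (real i * ?C) + ennreal ?C"
    by (intro add_mono Suc.IH order_refl)
  also have "\<dots> = ennreal (real (Suc i) * ?C)"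
    by (rule add) simp
  finally show ?case .
qed

end


section \<open>Algorithm B\<close>

lemma w_B_eq: "w_B \<phi> \<delta> A l y =
    (\<phi> y \<bullet> ((resolvent A (l + \<delta>) ** resolvent A (l + \<delta>)) *v \<phi> y))
      / (rtrace (resolvent A (l + \<delta>)) - rtrace (resolvent A l))
    - \<phi> y \<bullet> (resolvent A (l + \<delta>) *v \<phi> y)"
  by (simp add: w_B_def W_B_def Let_def Re_qform matrix_vector_mult_diff_rdistrib
      scaleR_matrix_mult_vec inner_simps divide_inverse mult.commute)

section \<open>One step of algorithm B\<close>

locale step_B =
  fixes A :: "complex^'n^'n" and l \<delta> :: real
  assumes posdef_A: "posdef (A - l *\<^sub>R mat 1)" and rtrace_Y: "rtrace (resolvent A l) = 1"
    and \<delta>: "0 < \<delta>" "\<delta> < 1"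
begin

abbreviation "l' \<equiv> l + \<delta>"
abbreviation "Y \<equiv> resolvent A l"
abbreviation "Z \<equiv> resolvent A l'"

lemma barrier_shift: "A - l' *\<^sub>R mat 1 = (A - l *\<^sub>R mat 1) - \<delta> *\<^sub>R mat 1"
  by (simp add: algebra_simps)

lemma posdef_A': "posdef (A - l' *\<^sub>R mat 1)"
  unfolding barrier_shift
  by (rule posdef_diff_scaleR_mat1[OF posdef_A], fold resolvent_eq) (simp add: rtrace_Y \<delta>)

lemma Z_posdef: "posdef Z"
  unfolding resolvent_eq by (rule posdef_inv[OF posdef_A'])

lemma traces:
  shows "rtrace Z - rtrace Y = \<delta> * rtrace (Z ** Y)"
    and "rtrace (Z ** Z) = rtrace (Z ** Y) + \<delta> * rtrace (Z ** Y ** Z)"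
    and "0 < rtrace (Z ** Y)"
    and "(rtrace (Z ** Y))\<^sup>2 \<le> rtrace (Z ** Y ** Z)"
proof -
  have Z: "Z = matrix_inv ((A - l *\<^sub>R mat 1) - \<delta> *\<^sub>R mat 1)"
    unfolding resolvent_eq barrier_shift ..
  have B': "posdef ((A - l *\<^sub>R mat 1) - \<delta> *\<^sub>R mat 1)"
    using posdef_A' unfolding barrier_shift .
  note tr = shifted_inverse_traces[OF posdef_A \<delta>(1) B', folded Z resolvent_eq]
  show "rtrace Z - rtrace Y = \<delta> * rtrace (Z ** Y)"
    "rtrace (Z ** Z) = rtrace (Z ** Y) + \<delta> * rtrace (Z ** Y ** Z)"
    "0 < rtrace (Z ** Y)"
    by (rule tr)+
  show "(rtrace (Z ** Y))\<^sup>2 \<le> rtrace (Z ** Y ** Z)"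
    using tr(5) by (simp add: rtrace_Y)
qed

lemma rtrace_diff_pos: "0 < rtrace Z - rtrace Y"
  unfolding traces(1) using traces(3) \<delta> by simp

text \<open>With a = Tr(ZY) and c = Tr(ZYZ), the trace equals (1 - \<delta>) / \<delta> + (c / a -
  \<delta> a). The bracket is nonnegative because the trace inequality with Tr Y = 1 gives c / a
  \<ge> a, and \<delta> < 1.\<close>

lemma rtrace_W_ge: "(1 - \<delta>) / \<delta> \<le> rtrace (W_B \<delta> A l)"
proof -
  define a where "a = rtrace (Z ** Y)"
  define c where "c = rtrace (Z ** Y ** Z)"
  have a: "0 < a" "a\<^sup>2 \<le> c" unfolding a_def c_def by (rule traces)+
  have Z: "rtrace Z = 1 + \<delta> * a" using traces(1) by (simp add: rtrace_Y a_def)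
  have "rtrace (W_B \<delta> A l) = (a + \<delta> * c) / (\<delta> * a) - (1 + \<delta> * a)"
    unfolding W_B_def Let_def rtrace_simps traces(1,2) a_def[symmetric] c_def[symmetric] Z rtrace_Y
    by (simp add: divide_inverse mult.commute)
  also have "\<dots> = (1 - \<delta>) / \<delta> + (c / a - \<delta> * a)"
    using a \<delta> by (simp add: field_simps)
  finally have eq: "rtrace (W_B \<delta> A l) = (1 - \<delta>) / \<delta> + (c / a - \<delta> * a)" .
  have "\<delta> * a \<le> 1 * a" using a \<delta> by (intro mult_right_mono) auto
  also have "\<dots> \<le> c / a" using a by (simp add: field_simps power2_eq_square)
  finally show ?thesis unfolding eq by simp
qed

text \<open>\<open>W_B\<close> is made for this: with D = Tr Z - Tr Y it satisfies w + q = t / D.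
  For the weight 1 / w, Sherman-Morrison then lowers the trace by t / (w + q) = D, exactly the
  amount by which the barrier had raised it.\<close>

lemma rtrace_update:
  assumes w: "0 < w_B \<phi> \<delta> A l y"
  shows "rtrace (resolvent (A + (1 / w_B \<phi> \<delta> A l y) *\<^sub>R outer (\<phi> y)) l') = 1"
proof -
  define s where "s = 1 / w_B \<phi> \<delta> A l y"
  define q where "q = \<phi> y \<bullet> (Z *v \<phi> y)"
  define t where "t = \<phi> y \<bullet> ((Z ** Z) *v \<phi> y)"
  define D where "D = rtrace Z - rtrace Y"
  have D: "0 < D" unfolding D_def by (rule rtrace_diff_pos)
  have s: "0 \<le> s" unfolding s_def using w by simp
  have q: "0 \<le> q" unfolding q_def by (rule posdef_nonneg[OF Z_posdef])
  have wq: "w_B \<phi> \<delta> A l y + q = t / D"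
    unfolding w_B_eq q_def t_def D_def by simp
  have "A + s *\<^sub>R outer (\<phi> y) - l' *\<^sub>R mat 1 = A - l' *\<^sub>R mat 1 + s *\<^sub>R outer (\<phi> y)" by simp
  then have eq: "rtrace (resolvent (A + s *\<^sub>R outer (\<phi> y)) l') = rtrace Z - s * t / (1 + s * q)"
    unfolding resolvent_eq t_def q_def by (simp only: rtrace_inv_add_outer[OF posdef_A' s])
  have "s * t / (1 + s * q) = t / (w_B \<phi> \<delta> A l y + q)"
    using w q by (simp add: s_def field_simps)
  also have "\<dots> = D"
  proof -
    have "0 < t / D" using wq w q by linarith
    then have "t \<noteq> 0" by force
    then show ?thesis unfolding wq using D by simp
  qed
  finally show ?thesis
    unfolding s_def[symmetric] eq D_def by (simp add: rtrace_Y)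
qed

lemma posdef_update: "0 \<le> s \<Longrightarrow> posdef (A + s *\<^sub>R outer v - l' *\<^sub>R mat 1)"
  using posdef_add_outer[OF posdef_A', of s v] by (simp add: algebra_simps)

end

section \<open>The run of algorithm B: threshold, admissible histories and lower bound\<close>

locale algorithm_B = L2_basis M V \<phi> for M :: "'a measure" and V and \<phi> :: "'a \<Rightarrow> complex^'n" +
  fixes \<delta> \<kappa> :: real
  assumes \<delta>: "0 < \<delta>" "\<delta> < 1" and \<kappa>: "0 \<le> \<kappa>" "\<kappa> \<le> 1"
begin

abbreviation "mat_at x i \<equiv> fst (state_B \<phi> \<delta> \<kappa> x i)"
abbreviation "low_at x i \<equiv> snd (state_B \<phi> \<delta> \<kappa> x i)"
abbreviation "R_at x i \<equiv> R_B \<phi> \<delta> \<kappa> (mat_at x i) (low_at x i)"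
abbreviation "Gamma_at x i \<equiv> Gamma_B M \<phi> \<delta> \<kappa> (mat_at x i) (low_at x i)"

definition threshold :: real where "threshold = \<kappa> * ((1 - \<delta>) / \<delta>)"

lemma threshold_nonneg: "0 \<le> threshold"
  unfolding threshold_def using \<delta> \<kappa> by simp

lemma R_nonneg: "0 \<le> R_B \<phi> \<delta> \<kappa> A l y"
  using threshold_nonneg by (simp add: R_B_def threshold_def)

lemma R_ge: "w_B \<phi> \<delta> A l y - threshold \<le> R_B \<phi> \<delta> \<kappa> A l y"
  using threshold_nonneg by (simp add: R_B_def threshold_def)

lemma R_pos_eq: "0 < R_B \<phi> \<delta> \<kappa> A l y \<Longrightarrow> R_B \<phi> \<delta> \<kappa> A l y = w_B \<phi> \<delta> A l y"
  and R_pos_ge: "0 < R_B \<phi> \<delta> \<kappa> A l y \<Longrightarrow> threshold \<le> R_B \<phi> \<delta> \<kappa> A l y"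
  by (auto simp: R_B_def threshold_def split: if_splits)

lemma w_integrable: "integrable M (w_B \<phi> \<delta> A l)"
  and w_integral: "(\<integral>y. w_B \<phi> \<delta> A l y \<partial>M) = rtrace (W_B \<delta> A l)"
  unfolding w_B_def by (rule integrable_qform integral_qform)+

lemma R_integrable: "integrable M (R_B \<phi> \<delta> \<kappa> A l)"
  by (rule Bochner_Integration.integrable_bound[OF w_integrable[of A l]])
     (measurable, simp add: R_B_def)

lemma Gamma_nonneg: "0 \<le> Gamma_B M \<phi> \<delta> \<kappa> A l"
  unfolding Gamma_B_def by (simp add: R_nonneg)

text \<open>Discarding the values of w below the threshold loses at most the threshold at each
  point, hence at most \<kappa> (1 - \<delta>) / \<delta> in the mean over a probability
  measure.\<close>

lemma Gamma_ge:
  assumes "step_B A l \<delta>"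
  shows "(1 - \<kappa>) * ((1 - \<delta>) / \<delta>) \<le> Gamma_B M \<phi> \<delta> \<kappa> A l"
proof -
  interpret step_B A l \<delta> by (rule assms)
  have "(\<integral>y. w_B \<phi> \<delta> A l y - threshold \<partial>M) \<le> Gamma_B M \<phi> \<delta> \<kappa> A l"
    unfolding Gamma_B_def
    by (intro integral_mono R_integrable R_ge Bochner_Integration.integrable_diff w_integrable) simp
  also have "(\<integral>y. w_B \<phi> \<delta> A l y - threshold \<partial>M) = rtrace (W_B \<delta> A l) - threshold"
    using w_integrable[of A l] by (simp add: w_integral prob_space)
  finally have "rtrace (W_B \<delta> A l) - threshold \<le> Gamma_B M \<phi> \<delta> \<kappa> A l" .
  moreover have "(1 - \<kappa>) * ((1 - \<delta>) / \<delta>) = (1 - \<delta>) / \<delta> - threshold"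
    unfolding threshold_def by (simp only: left_diff_distrib mult_1)
  ultimately show ?thesis using rtrace_W_ge by linarith
qed

text \<open>For \<kappa> < 1 this is contained in \<open>Gamma_ge\<close>. For \<kappa> = 1 that
  bound is zero; but if \<Gamma> vanished, w would be strictly below (1 - \<delta>) / \<delta>
  almost everywhere, while its mean is at least this number.\<close>

lemma Gamma_pos:
  assumes "step_B A l \<delta>"
  shows "0 < Gamma_B M \<phi> \<delta> \<kappa> A l"
proof (rule ccontr)
  interpret step_B A l \<delta> by (rule assms)
  assume "\<not> 0 < Gamma_B M \<phi> \<delta> \<kappa> A l"
  then have \<Gamma>: "Gamma_B M \<phi> \<delta> \<kappa> A l = 0" using Gamma_nonneg[of A l] by simp
  have "0 < (1 - \<delta>) / \<delta>" using \<delta> by simp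
  with Gamma_ge[OF assms] \<Gamma> \<kappa> have "\<kappa> = 1"
    by (metis diff_gt_0_iff_gt less_eq_real_def mult_pos_pos not_le)
  then have thr: "threshold = (1 - \<delta>) / \<delta>" unfolding threshold_def by simp
  have R0: "AE y in M. R_B \<phi> \<delta> \<kappa> A l y = 0"
    using \<Gamma> R_integrable[of A l] unfolding Gamma_B_def
    by (subst (asm) integral_nonneg_eq_0_iff_AE) (auto simp: R_nonneg)
  have lt: "AE y in M. 0 < threshold - w_B \<phi> \<delta> A l y"
    using R0
  proof eventually_elim
    case (elim y)
    show ?case
    proof (rule ccontr)
      assume "\<not> 0 < threshold - w_B \<phi> \<delta> A l y"
      then have "threshold \<le> w_B \<phi> \<delta> A l y" by simp
      moreover have "0 < threshold" unfolding thr using \<delta> by simp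
      ultimately show False using elim by (simp add: R_B_def threshold_def)
    qed
  qed
  have int: "integrable M (\<lambda>y. threshold - w_B \<phi> \<delta> A l y)"
    using w_integrable[of A l] by simp
  have "(\<integral>y. threshold - w_B \<phi> \<delta> A l y \<partial>M) = threshold - rtrace (W_B \<delta> A l)"
    using w_integrable[of A l] by (simp add: w_integral prob_space)
  also have "\<dots> \<le> 0" using rtrace_W_ge by (simp add: thr)
  finally have "(\<integral>y. threshold - w_B \<phi> \<delta> A l y \<partial>M) \<le> 0" .
  moreover have "0 \<le> (\<integral>y. threshold - w_B \<phi> \<delta> A l y \<partial>M)"
    using lt by (intro integral_nonneg_AE) auto
  ultimately have "(\<integral>y. threshold - w_B \<phi> \<delta> A l y \<partial>M) = 0" by simp
  then have "AE y in M. threshold - w_B \<phi> \<delta> A l y = 0"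
    using lt by (subst (asm) integral_nonneg_eq_0_iff_AE[OF int]) auto
  with lt have "AE y in M. False" by eventually_elim simp
  then show False by simp
qed

definition dens :: "nat \<Rightarrow> (nat \<Rightarrow> 'a) \<Rightarrow> 'a \<Rightarrow> real" where
  "dens i x y = R_at x i y / Gamma_at x i"

lemma dens_nonneg: "0 \<le> dens i x y"
  unfolding dens_def by (rule divide_nonneg_nonneg[OF R_nonneg Gamma_nonneg])

text \<open>The quotient is 1 unless \<Gamma> = 0, when it is 0; the latter is excluded later, at
  admissible histories.\<close>

lemma dens_integral: "(\<integral>\<^sup>+ y. ennreal (dens i x y) \<partial>M) = ennreal (Gamma_at x i / Gamma_at x i)"
proof -
  have "(\<integral>\<^sup>+ y. ennreal (dens i x y) \<partial>M) = ennreal (\<integral>y. dens i x y \<partial>M)"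
    using dens_nonneg R_integrable by (intro nn_integral_eq_integral) (auto simp: dens_def)
  also have "(\<integral>y. dens i x y \<partial>M) = Gamma_at x i / Gamma_at x i"
    unfolding dens_def by (subst (2) Gamma_B_def) simp
  finally show ?thesis .
qed

lemma state_B_upd: "j \<le> i \<Longrightarrow> state_B \<phi> \<delta> \<kappa> (x(Suc i := y)) j = state_B \<phi> \<delta> \<kappa> x j"
  by (induction j) (auto simp: Let_def)

sublocale chain: density_chain M "kernel_B M \<phi> \<delta> \<kappa>" dens
proof
  fix i x
  show "kernel_B M \<phi> \<delta> \<kappa> (Suc i) x = density M (\<lambda>y. ennreal (dens i x y))"
    by (simp add: kernel_B_def dens_def case_prod_beta Let_def)
  note [measurable] = state_B_measurable[OF basis_measurable order_refl, where \<delta> = \<delta> and \<kappa> = \<kappa>]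
  note [measurable] = Gamma_B_measurable[OF _ _ basis_measurable sigma_finite_measure_axioms]
  show "(\<lambda>(x, y). dens i x y) \<in> borel_measurable (Pi\<^sub>M {1..i} (\<lambda>_. M) \<Otimes>\<^sub>M M)"
    unfolding dens_def by measurable
  show "(\<integral>\<^sup>+ y. ennreal (dens i x y) \<partial>M) \<le> 1"
    unfolding dens_integral by (cases "Gamma_at x i = 0") auto
qed

lemma law_B_eq: "law_B M \<phi> \<delta> \<kappa> m = chain.law m"
  by (simp add: law_B_def)

text \<open>Every point so far was drawn where R is positive. This makes the weights 1 / R genuine
  quotients and keeps the potential equal to 1.\<close>

definition admissible :: "nat \<Rightarrow> (nat \<Rightarrow> 'a) \<Rightarrow> bool" where
  "admissible i x \<longleftrightarrow> (\<forall>j<i. 0 < R_at x j (x (Suc j)))"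

lemma low_at_eq: "low_at x i = - real CARD('n) + real i * \<delta>"
  by (induction i) (simp_all add: Let_def algebra_simps)

lemma admissible_step_B:
  assumes "admissible i x"
  shows "step_B (mat_at x i) (low_at x i) \<delta>"
  using assms
proof (induction i)
  case 0
  show ?case
    by unfold_locales (auto simp: posdef_scaleR_mat1 rtrace_resolvent_0 \<delta>)
next
  case (Suc i)
  then interpret step_B "mat_at x i" "low_at x i" \<delta> by (simp add: admissible_def)
  from Suc.prems have R: "0 < R_at x i (x (Suc i))" by (simp add: admissible_def)
  then have w: "0 < w_B \<phi> \<delta> (mat_at x i) (low_at x i) (x (Suc i))"
    using R_pos_eq by simp
  show ?case
  proof
    show "posdef (mat_at x (Suc i) - low_at x (Suc i) *\<^sub>R mat 1)"
      using R by (simp add: Let_def posdef_update)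
    show "rtrace (resolvent (mat_at x (Suc i)) (low_at x (Suc i))) = 1"
      using rtrace_update[OF w] by (simp add: Let_def R_pos_eq[OF R])
  qed (rule \<delta>)+
qed

lemma admissible_upd:
  assumes "admissible i x" "0 < dens i x y"
  shows "admissible (Suc i) (x(Suc i := y))"
proof -
  have "R_at x i y \<noteq> 0" using assms(2) by (auto simp: dens_def)
  then have "0 < R_at x i y" using R_nonneg by (simp add: order_less_le)
  then show ?thesis
    using assms(1) by (auto simp: admissible_def less_Suc_eq state_B_upd)
qed

lemma admissible_measurable: "Measurable.pred (chain.prodM i) (admissible i)"
proof -
  have "Measurable.pred (chain.prodM i) (\<lambda>x. 0 < R_at x j (x (Suc j)))" if "j < i" for j
  proof -
    have [measurable]: "(\<lambda>x. x (Suc j)) \<in> measurable (chain.prodM i) M"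
      using that by (intro measurable_component_singleton) auto
    note [measurable] = state_B_measurable[OF basis_measurable less_imp_le[OF that],
        where \<delta> = \<delta> and \<kappa> = \<kappa>]
    show ?thesis by measurable
  qed
  then show ?thesis
    unfolding admissible_def[abs_def] by measurable
qed

lemma AE_admissible: "AE x in chain.law i. admissible i x"
proof (induction i)
  case 0
  then show ?case by (simp add: admissible_def)
next
  case (Suc i)
  show ?case
    by (rule chain.AE_law_Suc[OF admissible_measurable])
       (use Suc in eventually_elim, simp add: admissible_upd)
qed

text \<open>Each point has a conditional density with respect to M, so it avoids the null sets of M.
  This turns an essential bound on f - v into a bound at the sample points.\<close>

lemma AE_points:
  assumes P: "Measurable.pred M P" and ae: "AE y in M. P y"
  shows "AE x in chain.law i. \<forall>j\<in>{1..i}. P (x j)"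
proof (induction i)
  case (Suc i)
  have [measurable]: "(\<lambda>x. x j) \<in> measurable (chain.prodM (Suc i)) M" if "j \<in> {1..Suc i}" for j
    using that by (rule measurable_component_singleton)
  have meas: "Measurable.pred (chain.prodM (Suc i)) (\<lambda>x. \<forall>j\<in>{1..Suc i}. P (x j))"
    by (intro pred_intros_finite(3) measurable_compose[OF _ P]) simp_all
  show ?case
  proof (rule chain.AE_law_Suc[OF meas], use Suc in eventually_elim)
    fix x assume x: "\<forall>j\<in>{1..i}. P (x j)"
    show "AE y in M. 0 < dens i x y \<longrightarrow> (\<forall>j\<in>{1..Suc i}. P ((x(Suc i := y)) j))"
      using ae by eventually_elim (use x in \<open>auto simp: le_Suc_eq\<close>)
  qed
qed simp

lemma dens_integral_admissible: "admissible i x \<Longrightarrow> (\<integral>\<^sup>+ y. ennreal (dens i x y) \<partial>M) = 1"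
  unfolding dens_integral using Gamma_pos[OF admissible_step_B] by fastforce

lemma prob_space_law: "prob_space (chain.law i)"
proof (induction i)
  case (Suc i)
  then show ?case
    by (rule chain.prob_space_law_Suc)
       (rule eventually_mono[OF AE_admissible dens_integral_admissible])
qed (rule chain.prob_space_law_0)

lemma weight_B_Suc: "weight_B \<phi> \<delta> \<kappa> x (Suc i) = 1 / R_at x i (x (Suc i))"
  by (simp add: weight_B_def case_prod_beta)

lemma weight_B_nonneg: "0 \<le> weight_B \<phi> \<delta> \<kappa> x j"
  unfolding weight_B_def case_prod_beta Let_def by (simp add: R_nonneg)

text \<open>A positive R is at least the threshold; where R vanishes, the weight is 1 / 0 =
  0.\<close>

lemma weight_B_le:
  assumes "0 < \<kappa>"
  shows "weight_B \<phi> \<delta> \<kappa> x j \<le> \<delta> / (\<kappa> * (1 - \<delta>))"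
proof -
  have thr: "0 < threshold" unfolding threshold_def using assms \<delta> by simp
  define R where "R = R_at x (j - 1) (x j)"
  have "1 / R \<le> 1 / threshold"
  proof (cases "0 < R")
    case True
    then have "threshold \<le> R" unfolding R_def by (rule R_pos_ge)
    then show ?thesis using thr by (intro divide_left_mono) auto
  next
    case False
    then have "R = 0" unfolding R_def using R_nonneg by (simp add: order_less_le)
    then show ?thesis using thr by simp
  qed
  then show ?thesis
    by (simp add: weight_B_def case_prod_beta R_def threshold_def)
qed

lemma matrix_B_eq_sum: "mat_at x i = (\<Sum>j=1..i. weight_B \<phi> \<delta> \<kappa> x j *\<^sub>R outer (\<phi> (x j)))"
  by (induction i) (simp_all add: Let_def weight_B_Suc)

lemma weight_B_upd: "j \<le> i \<Longrightarrow> weight_B \<phi> \<delta> \<kappa> (x(Suc i := y)) j = weight_B \<phi> \<delta> \<kappa> x j"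
  by (simp add: weight_B_def state_B_upd)

text \<open>The inverse of the state minus its barrier has trace 1, so this difference is at least
  the identity. The barrier -n + i \<delta> thereby gains 1, which is the origin of n - 1 in
  r.\<close>

lemma matrix_B_lower_bound:
  assumes "admissible i x"
  shows "(real i * \<delta> - (real CARD('n) - 1)) * (norm v)\<^sup>2 \<le> v \<bullet> (mat_at x i *v v)"
proof -
  interpret step_B "mat_at x i" "low_at x i" \<delta> by (rule admissible_step_B[OF assms])
  have "(norm v)\<^sup>2 \<le> v \<bullet> ((mat_at x i - low_at x i *\<^sub>R mat 1) *v v)"
    using posdef_lower_bound[OF posdef_A, of v] rtrace_Y by (simp add: resolvent_eq)
  then show ?thesis
    by (simp add: matrix_vector_mult_diff_rdistrib scaleR_matrix_mult_vec inner_simps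
        low_at_eq algebra_simps flip: power2_norm_eq_inner)
qed

section \<open>Expected weighted square sum of the orthogonal part\<close>

definition weighted_square :: "('a \<Rightarrow> complex) \<Rightarrow> (nat \<Rightarrow> 'a) \<Rightarrow> nat \<Rightarrow> real" where
  "weighted_square g x i = (\<Sum>j=1..i. weight_B \<phi> \<delta> \<kappa> x j * (cmod (g (x j)))\<^sup>2)"

lemma weighted_square_nonneg: "0 \<le> weighted_square g x i"
  unfolding weighted_square_def by (intro sum_nonneg mult_nonneg_nonneg weight_B_nonneg) simp

lemma weighted_square_upd:
  "weighted_square g (x(Suc i := y)) (Suc i) = weighted_square g x i + 1 / R_at x i y * (cmod (g y))\<^sup>2"
  by (simp add: weighted_square_def weight_B_Suc state_B_upd weight_B_upd)

lemma weighted_square_measurable: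
  assumes [measurable]: "g \<in> borel_measurable M"
  shows "(\<lambda>x. weighted_square g x i) \<in> borel_measurable (chain.prodM i)"
  unfolding weighted_square_def
proof (rule borel_measurable_sum)
  fix j assume j: "j \<in> {1..i}"
  then obtain k where k: "j = Suc k" "k \<le> i" by (cases j) auto
  have [measurable]: "(\<lambda>x. x j) \<in> measurable (chain.prodM i) M"
    using j by (rule measurable_component_singleton)
  note [measurable] = state_B_measurable[OF basis_measurable k(2), where \<delta> = \<delta> and \<kappa> = \<kappa>]
  have [measurable]: "(\<lambda>x. weight_B \<phi> \<delta> \<kappa> x j) \<in> borel_measurable (chain.prodM i)"
    unfolding k weight_B_Suc unfolding k(1)[symmetric] by measurable
  show "(\<lambda>x. weight_B \<phi> \<delta> \<kappa> x j * (cmod (g (x j)))\<^sup>2) \<in> borel_measurable (chain.prodM i)"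
    by measurable
qed

text \<open>Where R is nonzero, the density R / \<Gamma> cancels the new weight 1 / R; elsewhere the
  density vanishes. The new term contributes at most the squared L2 norm of g divided by \<Gamma>,
  and admissibility gives access to \<open>Gamma_ge\<close>.\<close>

lemma weighted_square_step:
  assumes g: "square_integrable M g" and \<kappa>1: "\<kappa> < 1" and adm: "admissible i x"
  shows "(\<integral>\<^sup>+ y. ennreal (dens i x y) * ennreal (weighted_square g (x(Suc i := y)) (Suc i)) \<partial>M)
    \<le> ennreal (weighted_square g x i)
      + ennreal (\<delta> / ((1 - \<kappa>) * (1 - \<delta>)) * (\<integral>y. (cmod (g y))\<^sup>2 \<partial>M))"
proof -
  let ?G = "Gamma_at x i"
  define C where "C = \<delta> / ((1 - \<kappa>) * (1 - \<delta>))"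
  define Q where "Q = weighted_square g x i"
  define u where "u y = R_at x i y * (Q / ?G) + C * (cmod (g y))\<^sup>2" for y
  have G: "0 < ?G" "(1 - \<kappa>) * ((1 - \<delta>) / \<delta>) \<le> ?G"
    using Gamma_pos Gamma_ge admissible_step_B[OF adm] by blast+
  have "1 / ?G \<le> 1 / ((1 - \<kappa>) * ((1 - \<delta>) / \<delta>))"
    using G \<delta> \<kappa>1 by (intro divide_left_mono) (auto intro!: mult_pos_pos)
  then have GC: "1 / ?G \<le> C" by (simp add: C_def)
  have C: "0 \<le> C" using \<delta> \<kappa>1 by (simp add: C_def)
  have expand: "a / k * (q + 1 / a * z) = a * (q / k) + 1 / k * z" if "a \<noteq> 0" for a k q z :: real
    using that by (simp add: distrib_left)
  have le: "dens i x y * weighted_square g (x(Suc i := y)) (Suc i) \<le> u y" for y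
  proof (cases "R_at x i y = 0")
    case True
    then show ?thesis using C by (simp add: dens_def u_def)
  next
    case False
    have "dens i x y * weighted_square g (x(Suc i := y)) (Suc i)
        = R_at x i y * (Q / ?G) + 1 / ?G * (cmod (g y))\<^sup>2"
      unfolding weighted_square_upd dens_def Q_def[symmetric] using False by (rule expand)
    also have "\<dots> \<le> u y"
      unfolding u_def using GC by (intro add_left_mono mult_right_mono) auto
    finally show ?thesis .
  qed
  have int_g: "integrable M (\<lambda>y. (cmod (g y))\<^sup>2)"
    using g by (simp add: square_integrable_def)
  have u_int: "integrable M u"
    unfolding u_def using R_integrable int_g by simp
  have u_eq: "(\<integral>y. u y \<partial>M) = Q + C * (\<integral>y. (cmod (g y))\<^sup>2 \<partial>M)"
  proof -
    have "(\<integral>y. u y \<partial>M) = ?G * (Q / ?G) + C * (\<integral>y. (cmod (g y))\<^sup>2 \<partial>M)"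
      unfolding u_def using R_integrable int_g by (subst (2) Gamma_B_def) simp
    then show ?thesis using G by simp
  qed
  have "(\<integral>\<^sup>+ y. ennreal (dens i x y) * ennreal (weighted_square g (x(Suc i := y)) (Suc i)) \<partial>M)
      \<le> (\<integral>\<^sup>+ y. ennreal (u y) \<partial>M)"
    using le by (intro nn_integral_mono)
      (simp add: ennreal_mult'[OF dens_nonneg, symmetric] ennreal_leI)
  also have "\<dots> = ennreal (\<integral>y. u y \<partial>M)"
    using u_int order_trans[OF mult_nonneg_nonneg[OF dens_nonneg weighted_square_nonneg] le]
    by (intro nn_integral_eq_integral AE_I2)
  also have "\<dots> = ennreal Q + ennreal (C * (\<integral>y. (cmod (g y))\<^sup>2 \<partial>M))"
    unfolding u_eq using weighted_square_nonneg C
    by (intro ennreal_plus) (auto simp: Q_def intro!: mult_nonneg_nonneg)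
  finally show ?thesis by (simp add: Q_def C_def)
qed

lemma weighted_square_expectation:
  assumes g: "square_integrable M g" and \<kappa>1: "\<kappa> < 1"
  shows "(\<integral>\<^sup>+ x. ennreal (weighted_square g x i) \<partial>chain.law i)
    \<le> ennreal (real i * (\<delta> / ((1 - \<kappa>) * (1 - \<delta>)) * (\<integral>y. (cmod (g y))\<^sup>2 \<partial>M)))"
proof (induction i)
  case 0
  then show ?case
    by (subst chain.nn_integral_law_0) (simp_all add: weighted_square_def)
next
  case (Suc i)
  interpret L: prob_space "chain.law i" by (rule prob_space_law)
  let ?C = "\<delta> / ((1 - \<kappa>) * (1 - \<delta>)) * (\<integral>y. (cmod (g y))\<^sup>2 \<partial>M)"
  have add: "ennreal (real i * k) + ennreal k = ennreal (real (Suc i) * k)" if "0 \<le> k" for k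
    using that by (subst ennreal_plus[symmetric]) (simp_all add: algebra_simps)
  note meas = weighted_square_measurable[OF square_integrable_measurable[OF g]]
  note [measurable] = meas
  have [measurable]: "(\<lambda>x. weighted_square g x i) \<in> borel_measurable (chain.law i)"
    using meas[of i] by (simp add: measurable_cong_sets[OF chain.sets_law refl])
  have "(\<integral>\<^sup>+ x. ennreal (weighted_square g x (Suc i)) \<partial>chain.law (Suc i))
      = (\<integral>\<^sup>+ x. \<integral>\<^sup>+ y. ennreal (dens i x y)
          * ennreal (weighted_square g (x(Suc i := y)) (Suc i)) \<partial>M \<partial>chain.law i)"
    by (rule chain.nn_integral_law_Suc) measurable
  also have "\<dots> \<le> (\<integral>\<^sup>+ x. ennreal (weighted_square g x i) + ennreal ?C \<partial>chain.law i)"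
    by (intro nn_integral_mono_AE eventually_mono[OF AE_admissible] weighted_square_step g \<kappa>1)
  also have "\<dots> = (\<integral>\<^sup>+ x. ennreal (weighted_square g x i) \<partial>chain.law i) + ennreal ?C"
    by (subst nn_integral_add) (simp_all add: L.emeasure_space_1)
  also have "\<dots> \<le> ennreal (real i * ?C) + ennreal ?C"
    by (intro add_mono Suc.IH order_refl)
  also have "\<dots> = ennreal (real (Suc i) * ?C)"
    by (rule add) (use \<delta> \<kappa>1 in simp)
  finally show ?case .
qed

end


section \<open>Error bounds\<close>

context L2_basis
begin

text \<open>Pythagoras with \<open>c - b\<close>, where \<open>lin_comb \<phi> b\<close> represents
  a competitor from V almost everywhere; members of V need not be linear combinations of \<phi> at
  every point.\<close>

lemma L2_norm_best_approximation:
  assumes f: "\<And>x. f x = g x + lin_comb \<phi> c x" and g: "square_integrable M g"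
    and orth: "\<And>j. (\<integral>x. g x * cnj (\<phi> x $ j) \<partial>M) = 0"
  shows "is_arg_min (\<lambda>v. L2_norm M (\<lambda>z. f z - v z)) (\<lambda>v. v \<in> V) (lin_comb \<phi> c)"
proof -
  have "L2_norm M (\<lambda>z. f z - lin_comb \<phi> c z) \<le> L2_norm M (\<lambda>z. f z - v z)" if v: "v \<in> V" for v
  proof (rule L2_norm_mono)
    from V_lin_comb[OF v] obtain b where b: "AE x in M. v x = lin_comb \<phi> b x" by auto
    have "(\<integral>\<^sup>+ x. ennreal ((cmod (f x - lin_comb \<phi> c x))\<^sup>2) \<partial>M)
        \<le> (\<integral>\<^sup>+ x. ennreal ((cmod (g x))\<^sup>2) \<partial>M) + ennreal ((norm (c - b))\<^sup>2)"
      by (simp add: f)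
    also have "\<dots> = (\<integral>\<^sup>+ x. ennreal ((cmod (g x + lin_comb \<phi> (c - b) x))\<^sup>2) \<partial>M)"
      by (rule orthogonal_pythagoras[OF g orth, symmetric])
    also have "\<dots> = (\<integral>\<^sup>+ x. ennreal ((cmod (f x - v x))\<^sup>2) \<partial>M)"
      by (rule nn_integral_cong_AE)
         (use b in eventually_elim, simp add: f lin_comb_diff algebra_simps)
    finally show "(\<integral>\<^sup>+ x. ennreal ((cmod (f x - lin_comb \<phi> c x))\<^sup>2) \<partial>M)
        \<le> (\<integral>\<^sup>+ x. ennreal ((cmod (f x - v x))\<^sup>2) \<partial>M)" .
  qed
  then show ?thesis
    unfolding is_arg_min_def using lin_comb_in_V by (auto simp: not_less)
qed

lemma L2_norm_error_power2:
  assumes f: "\<And>x. f x = g x + lin_comb \<phi> c x" and g: "square_integrable M g"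
    and orth: "\<And>j. (\<integral>x. g x * cnj (\<phi> x $ j) \<partial>M) = 0"
  shows "(L2_norm M (\<lambda>z. f z - lin_comb \<phi> (c + d) z))\<^sup>2
    = ennreal (\<integral>x. (cmod (g x))\<^sup>2 \<partial>M) + ennreal ((norm d)\<^sup>2)"
proof -
  have eq: "f z - lin_comb \<phi> (c + d) z = g z + lin_comb \<phi> (0 - d) z" for z
    unfolding f lin_comb_add lin_comb_diff lin_comb_0 by simp
  show ?thesis
    unfolding L2_norm_power2 eq orthogonal_pythagoras[OF g orth]
    using g by (simp add: nn_integral_eq_integral square_integrable_def)
qed

text \<open>If \<open>f\<close> is not square integrable, then all norms are infinite and the bound is trivial.\<close>

lemma L2_error_bound_cases:
  assumes f [measurable]: "f \<in> borel_measurable M" and K: "0 < K"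
    and bound: "\<And>g c. (\<And>x. f x = g x + lin_comb \<phi> c x) \<Longrightarrow> square_integrable M g
      \<Longrightarrow> (\<And>j. (\<integral>x. g x * cnj (\<phi> x $ j) \<partial>M) = 0)
      \<Longrightarrow> I \<le> ennreal K * ennreal (\<integral>x. (cmod (g x))\<^sup>2 \<partial>M)"
  shows "\<exists>v. is_arg_min (\<lambda>v. L2_norm M (\<lambda>z. f z - v z)) (\<lambda>v. v \<in> V) v
    \<and> I \<le> ennreal K * (L2_norm M (\<lambda>z. f z - v z))\<^sup>2"
proof (cases "square_integrable M f")
  case True
  show ?thesis
  proof (rule orthogonal_decomposition[OF True])
    fix c g
    assume d: "\<And>x. f x = g x + lin_comb \<phi> c x" "square_integrable M g"
      "\<And>j. (\<integral>x. g x * cnj (\<phi> x $ j) \<partial>M) = 0"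
    show ?thesis
      using L2_norm_best_approximation[OF d] bound[OF d] L2_norm_error_power2[OF d, of 0]
      by (intro exI[of _ "lin_comb \<phi> c"]) simp
  qed
next
  case False
  have top: "L2_norm M (\<lambda>z. f z - v z) = \<top>" if "v \<in> V" for v
  proof (rule ccontr)
    note v = V_square_integrable[OF that]
    note [measurable] = square_integrable_measurable[OF v]
    assume "L2_norm M (\<lambda>z. f z - v z) \<noteq> \<top>"
    then have "(\<lambda>z. f z - v z) \<in> L2_space M"
      by (simp add: L2_space_def less_top[symmetric])
    then have "square_integrable M (\<lambda>z. (f z - v z) + v z)"
      unfolding L2_space_iff by (rule square_integrable_add[OF _ v])
    with False show False by simp
  qed
  have "is_arg_min (\<lambda>v. L2_norm M (\<lambda>z. f z - v z)) (\<lambda>v. v \<in> V) (lin_comb \<phi> 0)"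
    unfolding is_arg_min_def using lin_comb_in_V[of 0] top by auto
  moreover have "ennreal K * (L2_norm M (\<lambda>z. f z - lin_comb \<phi> 0 z))\<^sup>2 = \<top>"
    using K by (simp add: top[OF lin_comb_in_V] power2_eq_square ennreal_mult_top)
  ultimately show ?thesis by (metis top_greatest)
qed

lemma Linf_norm_le_iff:
  assumes [measurable]: "u \<in> borel_measurable M" and "0 \<le> t"
  shows "Linf_norm M u \<le> ennreal t \<longleftrightarrow> (AE x in M. cmod (u x) \<le> t)"
proof
  assume le: "Linf_norm M u \<le> ennreal t"
  have "AE x in M. ennreal (cmod (u x)) \<le> Linf_norm M u"
    unfolding Linf_norm_def by (rule esssup_AE)
  then show "AE x in M. cmod (u x) \<le> t"
  proof eventually_elim
    case (elim x)
    then have "ennreal (cmod (u x)) \<le> ennreal t" using le by (rule order_trans)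
    then show ?case using assms(2) by simp
  qed
next
  assume "AE x in M. cmod (u x) \<le> t"
  then have "AE x in M. ennreal (cmod (u x)) \<le> ennreal t"
    by eventually_elim (rule ennreal_leI)
  then show "Linf_norm M u \<le> ennreal t"
    unfolding Linf_norm_def by (intro esssup_I) simp_all
qed

lemma Linf_norm_finite_AE:
  assumes "u \<in> borel_measurable M" "Linf_norm M u < \<top>"
  shows "AE x in M. cmod (u x) \<le> enn2real (Linf_norm M u)"
  using assms by (subst Linf_norm_le_iff[symmetric]) auto

lemma enn2real_Linf_norm_le:
  assumes "u \<in> borel_measurable M" "0 \<le> t" "AE x in M. cmod (u x) \<le> t"
  shows "Linf_norm M u < \<top>" "enn2real (Linf_norm M u) \<le> t"
proof -
  have le: "Linf_norm M u \<le> ennreal t" using assms by (simp add: Linf_norm_le_iff)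
  then show "Linf_norm M u < \<top>" by (rule le_less_trans) simp
  show "enn2real (Linf_norm M u) \<le> t"
    using le assms(2) by (rule enn2real_leI[rotated])
qed

text \<open>On a probability space the L2 norm, here the norm of the coefficients, is at most the
  essential supremum. It supplies the coercivity of the uniform distance.\<close>

lemma norm_le_of_AE_bound:
  assumes t: "0 \<le> t" and ae: "AE x in M. cmod (lin_comb \<phi> c x) \<le> t"
  shows "norm c \<le> t"
proof -
  have "(norm c)\<^sup>2 = (\<integral>x. (cmod (lin_comb \<phi> c x))\<^sup>2 \<partial>M)"
    by (rule integral_lin_comb_power2[symmetric])
  also have "\<dots> \<le> (\<integral>x. t\<^sup>2 \<partial>M)"
  proof (rule integral_mono_AE)
    show "AE x in M. (cmod (lin_comb \<phi> c x))\<^sup>2 \<le> t\<^sup>2"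
      using ae by eventually_elim (simp add: power_mono)
  qed (use lin_comb_square_integrable[of c] in \<open>simp_all add: square_integrable_def\<close>)
  also have "\<dots> = t\<^sup>2" by (simp add: prob_space)
  finally show ?thesis using t by (rule power2_le_imp_le)
qed

text \<open>
  The distance to \<open>f\<close> is a Lipschitz function of the coefficients, and it is coercive because
  the uniform norm dominates the \<open>L\<^sup>2\<close> norm; hence it attains its minimum.
\<close>

lemma Linf_norm_best_approximation:
  assumes f [measurable]: "f \<in> borel_measurable M" and V: "V \<subseteq> Linf_space M"
  shows "\<exists>c. is_arg_min (\<lambda>v. Linf_norm M (\<lambda>z. f z - v z)) (\<lambda>v. v \<in> V) (lin_comb \<phi> c)"
proof -
  define N where "N c = Linf_norm M (\<lambda>z. f z - lin_comb \<phi> c z)" for c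
  have "\<exists>c. \<forall>b. N c \<le> N b"
  proof (cases "\<exists>b. N b < \<top>")
    case True
    then obtain b where b: "N b < \<top>" by blast
    define k where "k j = enn2real (Linf_norm M (\<lambda>x. \<phi> x $ j))" for j
    have phi: "AE x in M. cmod (\<phi> x $ j) \<le> k j" for j
      unfolding k_def using V basis_in_V[of j]
      by (intro Linf_norm_finite_AE) (auto simp: Linf_space_def)
    define K where "K = (\<Sum>j\<in>UNIV. k j)"
    have K: "0 \<le> K" unfolding K_def k_def by (intro sum_nonneg) simp
    have lin: "AE x in M. cmod (lin_comb \<phi> c x) \<le> K * norm c" for c
    proof -
      have "AE x in M. \<forall>j\<in>UNIV. cmod (\<phi> x $ j) \<le> k j"
        using phi by (intro AE_finite_allI) auto
      then show ?thesis
      proof eventually_elim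
        case (elim x)
        have "cmod (lin_comb \<phi> c x) \<le> (\<Sum>j\<in>UNIV. cmod (c $ j) * cmod (\<phi> x $ j))"
          unfolding lin_comb_def by (rule sum_norm_le) (simp add: norm_mult)
        also have "\<dots> \<le> (\<Sum>j\<in>UNIV. norm c * k j)"
          using elim by (intro sum_mono mult_mono) (auto simp: Finite_Cartesian_Product.norm_nth_le)
        finally show ?case by (simp add: K_def sum_distrib_left mult.commute)
      qed
    qed
    define F where "F c = enn2real (N c)" for c
    have F_nonneg: "0 \<le> F c" for c by (simp add: F_def)
    \<comment> \<open>Linear combinations of \<phi> are essentially bounded here, so finiteness of
      the distance at one coefficient vector spreads to all, together with the Lipschitz
      estimate.\<close>
    have step: "N c' < \<top> \<and> F c' \<le> F c + K * norm (c - c')" if c: "N c < \<top>" for c c'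
    proof -
      have "AE x in M. cmod (f x - lin_comb \<phi> c x) \<le> F c"
        unfolding F_def N_def using c by (intro Linf_norm_finite_AE) (auto simp: N_def)
      then have "AE x in M. cmod (f x - lin_comb \<phi> c' x) \<le> F c + K * norm (c - c')"
        using lin[of "c - c'"]
      proof eventually_elim
        case (elim x)
        have eq: "f x - lin_comb \<phi> c' x = (f x - lin_comb \<phi> c x) + lin_comb \<phi> (c - c') x"
          by (simp add: lin_comb_diff)
        show ?case
          unfolding eq
          using elim norm_triangle_ineq[of "f x - lin_comb \<phi> c x" "lin_comb \<phi> (c - c') x"] by linarith
      qed
      from enn2real_Linf_norm_le[OF _ _ this] show ?thesis
        using F_nonneg[of c] K unfolding F_def N_def by auto
    qed
    have fin: "N c < \<top>" for c using step[OF b] by blast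
    have lip: "F c' \<le> F c + K * norm (c - c')" for c c' using step[OF fin] by blast
    have "K-lipschitz_on UNIV F"
    proof (rule lipschitz_onI)
      fix c c'
      show "dist (F c) (F c') \<le> K * dist c c'"
        using lip[of c c'] lip[of c' c] by (simp add: dist_norm norm_minus_commute abs_le_iff)
    qed (rule K)
    then have cont: "continuous_on S F" for S
      using lipschitz_on_continuous_on continuous_on_subset by blast
    have coercive: "norm (b - c) \<le> F c + F b" for c
    proof (rule norm_le_of_AE_bound)
      show "0 \<le> F c + F b" by (intro add_nonneg_nonneg F_nonneg)
      have "AE x in M. cmod (f x - lin_comb \<phi> c x) \<le> F c" "AE x in M. cmod (f x - lin_comb \<phi> b x) \<le> F b"
        unfolding F_def N_def using fin by (auto intro!: Linf_norm_finite_AE simp: N_def)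
      then show "AE x in M. cmod (lin_comb \<phi> (b - c) x) \<le> F c + F b"
      proof eventually_elim
        case (elim x)
        have eq: "lin_comb \<phi> (b - c) x = (f x - lin_comb \<phi> c x) - (f x - lin_comb \<phi> b x)"
          by (simp add: lin_comb_diff)
        show ?case
          unfolding eq
          using elim norm_triangle_ineq4[of "f x - lin_comb \<phi> c x" "f x - lin_comb \<phi> b x"] by linarith
      qed
    qed
    \<comment> \<open>The radius 2 F b suffices: outside this ball, coercivity gives F a \<ge> norm
      (b - a) - F b > F b, so no such a beats the centre b.\<close>
    have "\<exists>c\<in>cball b (2 * F b). \<forall>a\<in>cball b (2 * F b). F c \<le> F a"
      using F_nonneg[of b] by (intro continuous_attains_inf cont) auto
    then obtain c where c: "\<And>a. a \<in> cball b (2 * F b) \<Longrightarrow> F c \<le> F a" by blast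
    have "F c \<le> F a" for a
    proof (cases "a \<in> cball b (2 * F b)")
      case False
      have "F c \<le> F b" using c[of b] F_nonneg by simp
      moreover have "2 * F b < norm (b - a)" using False by (simp add: dist_norm)
      ultimately show ?thesis using coercive[of a] by linarith
    qed (rule c)
    then have "N c \<le> N a" for a
      using fin[of a] fin[of c] unfolding F_def
      by (metis enn2real_nonneg ennreal_enn2real ennreal_leI)
    then show ?thesis by blast
  next
    case False
    then show ?thesis by (metis less_top top_greatest)
  qed
  then obtain c where c: "\<And>b. N c \<le> N b" by blast
  have "Linf_norm M (\<lambda>z. f z - lin_comb \<phi> c z) \<le> Linf_norm M (\<lambda>z. f z - v z)" if v: "v \<in> V" for v
  proof -
    note [measurable] = square_integrable_measurable[OF V_square_integrable[OF v]]
    from V_lin_comb[OF v] obtain b where b: "AE x in M. v x = lin_comb \<phi> b x" by auto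
    have "Linf_norm M (\<lambda>z. f z - v z) = N b"
      unfolding N_def Linf_norm_def
      by (rule esssup_AE_cong) (measurable, use b in eventually_elim, simp)
    then show ?thesis using c[of b] by (simp add: N_def)
  qed
  then have "is_arg_min (\<lambda>v. Linf_norm M (\<lambda>z. f z - v z)) (\<lambda>v. v \<in> V) (lin_comb \<phi> c)"
    unfolding is_arg_min_def using lin_comb_in_V by (auto simp: not_less)
  then show ?thesis by blast
qed

text \<open>Minkowski's inequality in squared form: (a + b)^2 \<le> (1 + B) a^2 + (1 + 1 / B) b^2 is
  sharp for b = B a, so the bounds t for u and B t for the coefficients give exactly ((1 + B)
  t)^2.\<close>

lemma L2_norm_diff_le:
  assumes [measurable]: "u \<in> borel_measurable M" and u: "AE x in M. cmod (u x) \<le> t"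
    and t: "0 \<le> t" and B: "0 < B" and d: "(norm d)\<^sup>2 \<le> (B * t)\<^sup>2"
  shows "L2_norm M (\<lambda>z. u z - lin_comb \<phi> d z) \<le> ennreal ((1 + B) * t)"
proof -
  have young: "(a + b)\<^sup>2 \<le> (1 + B) * a\<^sup>2 + (1 + 1 / B) * b\<^sup>2" for a b :: real
  proof -
    have "0 \<le> (B * a - b)\<^sup>2 / B" using B by simp
    also have "\<dots> = (1 + B) * a\<^sup>2 + (1 + 1 / B) * b\<^sup>2 - (a + b)\<^sup>2"
      using B by (simp add: power2_eq_square field_simps)
    finally show ?thesis by simp
  qed
  have "(\<integral>\<^sup>+ x. ennreal ((cmod (u x - lin_comb \<phi> d x))\<^sup>2) \<partial>M)
      \<le> (\<integral>\<^sup>+ x. ennreal ((1 + B) * t\<^sup>2) + ennreal (1 + 1 / B) * ennreal ((cmod (lin_comb \<phi> d x))\<^sup>2) \<partial>M)"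
  proof (rule nn_integral_mono_AE, use u in eventually_elim)
    case (elim x)
    have "(cmod (u x - lin_comb \<phi> d x))\<^sup>2 \<le> (cmod (u x) + cmod (lin_comb \<phi> d x))\<^sup>2"
      by (intro power_mono norm_triangle_ineq4) simp
    also have "\<dots> \<le> (1 + B) * (cmod (u x))\<^sup>2 + (1 + 1 / B) * (cmod (lin_comb \<phi> d x))\<^sup>2"
      by (rule young)
    also have "\<dots> \<le> (1 + B) * t\<^sup>2 + (1 + 1 / B) * (cmod (lin_comb \<phi> d x))\<^sup>2"
      using elim B by (intro add_right_mono mult_left_mono power_mono) auto
    finally have "ennreal ((cmod (u x - lin_comb \<phi> d x))\<^sup>2)
        \<le> ennreal ((1 + B) * t\<^sup>2 + (1 + 1 / B) * (cmod (lin_comb \<phi> d x))\<^sup>2)"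
      by (rule ennreal_leI)
    also have "\<dots> = ennreal ((1 + B) * t\<^sup>2) + ennreal (1 + 1 / B) * ennreal ((cmod (lin_comb \<phi> d x))\<^sup>2)"
      using B by (subst ennreal_mult[symmetric]) (auto intro!: ennreal_plus)
    finally show ?case .
  qed
  also have "\<dots> = ennreal ((1 + B) * t\<^sup>2) + ennreal (1 + 1 / B) * ennreal ((norm d)\<^sup>2)"
    by (subst nn_integral_add)
       (simp_all add: nn_integral_cmult nn_integral_lin_comb_power2 emeasure_space_1)
  also have "\<dots> = ennreal ((1 + B) * t\<^sup>2 + (1 + 1 / B) * (norm d)\<^sup>2)"
    using B by (subst ennreal_mult[symmetric]) (auto intro!: ennreal_plus[symmetric])
  also have "\<dots> \<le> ennreal (((1 + B) * t)\<^sup>2)"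
  proof (rule ennreal_leI)
    have "(1 + B) * t\<^sup>2 + (1 + 1 / B) * (norm d)\<^sup>2 \<le> (1 + B) * t\<^sup>2 + (1 + 1 / B) * (B * t)\<^sup>2"
      using B d by (intro add_left_mono mult_left_mono) auto
    also have "\<dots> = ((1 + B) * t)\<^sup>2"
      using B by (simp add: power2_eq_square field_simps)
    finally show "(1 + B) * t\<^sup>2 + (1 + 1 / B) * (norm d)\<^sup>2 \<le> ((1 + B) * t)\<^sup>2" .
  qed
  finally have le: "(\<integral>\<^sup>+ x. ennreal ((cmod (u x - lin_comb \<phi> d x))\<^sup>2) \<partial>M) \<le> ennreal (((1 + B) * t)\<^sup>2)" .
  then have "(\<integral>\<^sup>+ x. ennreal ((cmod (u x - lin_comb \<phi> d x))\<^sup>2) \<partial>M) \<noteq> \<top>"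
    using neq_top_trans ennreal_neq_top by blast
  moreover have "sqrt (enn2real (\<integral>\<^sup>+ x. ennreal ((cmod (u x - lin_comb \<phi> d x))\<^sup>2) \<partial>M)) \<le> (1 + B) * t"
    using B t le by (intro real_le_lsqrt enn2real_leI) auto
  ultimately show ?thesis
    by (simp add: L2_norm_def Let_def ennreal_leI)
qed

end

section \<open>Error of algorithm A under the conditioned law\<close>

context algorithm_A
begin

text \<open>On the event, the coefficients deviate by at most |residual| / \<alpha>. The increments
  of the residual are centred under the original law, so its second moment is taken there; passing
  to the conditioned law costs the factor 1 / (1 - p), because the integrand is nonnegative and the
  event has probability at least 1 - p.\<close>

lemma conditional_error_bound:
  assumes f: "\<And>x. f x = g x + lin_comb \<phi> c x" and g: "square_integrable M g"
    and orth: "\<And>j. (\<integral>x. g x * cnj (\<phi> x $ j) \<partial>M) = 0"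
    and \<gamma>_pos: "0 < \<gamma>" and p: "0 < p" "p < 1" and \<alpha>: "0 < \<alpha>"
    and \<alpha>_eq: "\<alpha> = real CARD('n) * (\<epsilon> * ((real m + 1) / real CARD('n)) / (1 / p + \<gamma>) - 1)"
  shows "(\<integral>\<^sup>+ x. (L2_norm M (\<lambda>z. f z - wls \<phi> m x (weight_A \<phi> \<epsilon> \<gamma> x) f z))\<^sup>2
      \<partial>cond_law_A M \<phi> \<epsilon> \<gamma> p m)
    \<le> ennreal (1 + real m * (real CARD('n) * (eta \<epsilon>)\<^sup>2 / \<gamma>\<^sup>2) / (\<alpha>\<^sup>2 * (1 - p)))
      * ennreal (\<integral>x. (cmod (g x))\<^sup>2 \<partial>M)"
proof -
  define G where "G = (\<integral>x. (cmod (g x))\<^sup>2 \<partial>M)"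
  have G: "0 \<le> G" by (simp add: G_def)
  define C where "C = real CARD('n) * (eta \<epsilon>)\<^sup>2 / \<gamma>\<^sup>2"
  have C: "0 \<le> C" by (simp add: C_def)
  interpret L: prob_space "chain.law m" by (rule prob_space_law)
  define E where "E = event_A M \<phi> \<epsilon> \<gamma> p m"
  have E: "E \<in> sets (chain.law m)" unfolding E_def law_A_eq[symmetric] by (rule event_A_sets)
  have PE: "1 - p \<le> L.prob E" unfolding E_def law_A_eq[symmetric] by (rule event_A_prob[OF p(1)])
  then have E0: "emeasure (chain.law m) E \<noteq> 0" using p by (simp add: L.emeasure_eq_measure)
  have cond: "cond_law_A M \<phi> \<epsilon> \<gamma> p m = uniform_measure (chain.law m) E"
    by (simp add: cond_law_A_def law_A_eq E_def)
  interpret U: prob_space "uniform_measure (chain.law m) E"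
    by (rule prob_space_uniform_measure[OF E0]) simp
  have [measurable]: "(\<lambda>x. residual g x m) \<in> borel_measurable (chain.law m)"
    using residual_measurable[OF square_integrable_measurable[OF g], of m]
    by (simp add: measurable_cong_sets[OF chain.sets_law refl])
  have err: "(L2_norm M (\<lambda>z. f z - wls \<phi> m x (weight_A \<phi> \<epsilon> \<gamma> x) f z))\<^sup>2
      \<le> ennreal G + ennreal (1 / \<alpha>\<^sup>2) * ennreal ((norm (residual g x m))\<^sup>2)" if x: "x \<in> E" for x
  proof -
    have "x \<in> space (law_A M \<phi> \<epsilon> \<gamma> m)" using x by (simp add: E_def event_A_def Let_def)
    from event_A_iff[OF this \<alpha>_eq] x
    have lower: "\<alpha> * (norm v)\<^sup>2 \<le> v \<bullet> ((\<Sum>i=1..m. weight_A \<phi> \<epsilon> \<gamma> x i *\<^sub>R outer (\<phi> (x i))) *v v)" for v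
      unfolding E_def matrix_A_eq_sum by blast
    obtain d where w: "wls \<phi> m x (weight_A \<phi> \<epsilon> \<gamma> x) f = lin_comb \<phi> (c + d)"
      and "\<alpha> * norm d \<le> norm (\<Sum>i=1..m. weight_A \<phi> \<epsilon> \<gamma> x i *\<^sub>R (cnj (f (x i) - lin_comb \<phi> c (x i)) *s \<phi> (x i)))"
      by (rule wls_perturbation[where s = "weight_A \<phi> \<epsilon> \<gamma> x" and f = f and c = c,
            OF weight_A_nonneg \<alpha> lower])
    then have d: "\<alpha> * norm d \<le> norm (residual g x m)"
      by (simp add: residual_def f)
    have "(\<alpha> * norm d)\<^sup>2 \<le> (norm (residual g x m))\<^sup>2"
      using d \<alpha> by (intro power_mono) auto
    then have "(norm d)\<^sup>2 \<le> 1 / \<alpha>\<^sup>2 * (norm (residual g x m))\<^sup>2"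
      using \<alpha> by (simp add: power_mult_distrib field_simps)
    then have "ennreal ((norm d)\<^sup>2) \<le> ennreal (1 / \<alpha>\<^sup>2) * ennreal ((norm (residual g x m))\<^sup>2)"
      by (simp add: ennreal_mult[symmetric] ennreal_leI)
    then show ?thesis
      unfolding w L2_norm_error_power2[OF f g orth] G_def by (rule add_left_mono)
  qed
  have "(\<integral>\<^sup>+ x. (L2_norm M (\<lambda>z. f z - wls \<phi> m x (weight_A \<phi> \<epsilon> \<gamma> x) f z))\<^sup>2
      \<partial>uniform_measure (chain.law m) E)
      \<le> (\<integral>\<^sup>+ x. ennreal G + ennreal (1 / \<alpha>\<^sup>2) * ennreal ((norm (residual g x m))\<^sup>2)
          \<partial>uniform_measure (chain.law m) E)"
    using err by (intro nn_integral_mono_AE AE_uniform_measureI E) auto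
  also have "\<dots> = ennreal G + ennreal (1 / \<alpha>\<^sup>2) *
      (\<integral>\<^sup>+ x. ennreal ((norm (residual g x m))\<^sup>2) \<partial>uniform_measure (chain.law m) E)"
    by (subst nn_integral_add) (simp_all add: nn_integral_cmult U.emeasure_space_1[simplified])
  also have "(\<integral>\<^sup>+ x. ennreal ((norm (residual g x m))\<^sup>2) \<partial>uniform_measure (chain.law m) E)
      \<le> ennreal (real m * (C * G)) / ennreal (1 - p)"
  proof -
    have "(\<integral>\<^sup>+ x. ennreal ((norm (residual g x m))\<^sup>2) \<partial>uniform_measure (chain.law m) E)
        = (\<integral>\<^sup>+ x. ennreal ((norm (residual g x m))\<^sup>2) * indicator E x \<partial>chain.law m)
          / emeasure (chain.law m) E"
      using E by (intro nn_integral_uniform_measure) measurable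
    also have "\<dots> \<le> (\<integral>\<^sup>+ x. ennreal ((norm (residual g x m))\<^sup>2) \<partial>chain.law m)
          / emeasure (chain.law m) E"
      by (intro divide_right_mono_ennreal nn_integral_mono) (simp add: indicator_def)
    also have "\<dots> \<le> ennreal (real m * (C * G)) / emeasure (chain.law m) E"
      unfolding C_def G_def
      by (intro divide_right_mono_ennreal residual_expectation g orth \<gamma>_pos)
    also have "\<dots> \<le> ennreal (real m * (C * G)) / ennreal (1 - p)"
    proof -
      have P: "0 < L.prob E" using PE p by simp
      have "real m * (C * G) / L.prob E \<le> real m * (C * G) / (1 - p)"
        using C G p P by (intro divide_left_mono PE mult_pos_pos) auto
      then show ?thesis
        unfolding L.emeasure_eq_measure using C G p P by (simp add: divide_ennreal ennreal_leI)
    qed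
    finally show ?thesis .
  qed
  also have "ennreal (real m * (C * G)) / ennreal (1 - p) = ennreal (real m * (C * G) / (1 - p))"
    using C G p by (intro divide_ennreal) auto
  also have "ennreal G + ennreal (1 / \<alpha>\<^sup>2) * ennreal (real m * (C * G) / (1 - p))
      = ennreal (G + 1 / \<alpha>\<^sup>2 * (real m * (C * G) / (1 - p)))"
    using C G p by (simp add: ennreal_mult'[symmetric])
  also have "G + 1 / \<alpha>\<^sup>2 * (real m * (C * G) / (1 - p)) = (1 + real m * C / (\<alpha>\<^sup>2 * (1 - p))) * G"
    by (simp add: distrib_right)
  also have "ennreal \<dots> = ennreal (1 + real m * C / (\<alpha>\<^sup>2 * (1 - p))) * ennreal G"
    using C G p by (intro ennreal_mult) auto
  finally show ?thesis
    unfolding cond C_def G_def by (simp add: add_left_mono mult_left_mono)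
qed

end

section \<open>Error of algorithm B, in expectation and almost surely\<close>

context algorithm_B
begin

text \<open>Here the second estimate of \<open>wls_perturbation\<close> is used. It bounds \<alpha>
  |d|^2 by the weighted square sum of g, so that only the first power of \<alpha> is gained.\<close>

lemma error_bound_expectation:
  assumes f: "\<And>x. f x = g x + lin_comb \<phi> c x" and g: "square_integrable M g"
    and orth: "\<And>j. (\<integral>x. g x * cnj (\<phi> x $ j) \<partial>M) = 0"
    and \<kappa>1: "\<kappa> < 1" and \<alpha>: "0 < \<alpha>" and \<alpha>_eq: "\<alpha> = real m * \<delta> - (real CARD('n) - 1)"
  shows "(\<integral>\<^sup>+ x. (L2_norm M (\<lambda>z. f z - wls \<phi> m x (weight_B \<phi> \<delta> \<kappa> x) f z))\<^sup>2 \<partial>law_B M \<phi> \<delta> \<kappa> m)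
    \<le> ennreal (1 + real m * (\<delta> / ((1 - \<kappa>) * (1 - \<delta>))) / \<alpha>)
      * ennreal (\<integral>x. (cmod (g x))\<^sup>2 \<partial>M)"
proof -
  define G where "G = (\<integral>x. (cmod (g x))\<^sup>2 \<partial>M)"
  have G: "0 \<le> G" by (simp add: G_def)
  define C where "C = \<delta> / ((1 - \<kappa>) * (1 - \<delta>))"
  have C: "0 \<le> C" using \<delta> \<kappa>1 by (simp add: C_def)
  interpret L: prob_space "chain.law m" by (rule prob_space_law)
  have [measurable]: "(\<lambda>x. weighted_square g x m) \<in> borel_measurable (chain.law m)"
    using weighted_square_measurable[OF square_integrable_measurable[OF g], of m]
    by (simp add: measurable_cong_sets[OF chain.sets_law refl])
  have err: "(L2_norm M (\<lambda>z. f z - wls \<phi> m x (weight_B \<phi> \<delta> \<kappa> x) f z))\<^sup>2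
      \<le> ennreal G + ennreal (1 / \<alpha>) * ennreal (weighted_square g x m)" if x: "admissible m x" for x
  proof -
    have lower: "\<alpha> * (norm v)\<^sup>2 \<le> v \<bullet> ((\<Sum>i=1..m. weight_B \<phi> \<delta> \<kappa> x i *\<^sub>R outer (\<phi> (x i))) *v v)" for v
      using matrix_B_lower_bound[OF x, of v] unfolding \<alpha>_eq matrix_B_eq_sum .
    obtain d where w: "wls \<phi> m x (weight_B \<phi> \<delta> \<kappa> x) f = lin_comb \<phi> (c + d)"
      and "\<alpha> * (norm d)\<^sup>2 \<le> (\<Sum>i=1..m. weight_B \<phi> \<delta> \<kappa> x i * (cmod (f (x i) - lin_comb \<phi> c (x i)))\<^sup>2)"
      by (rule wls_perturbation[where s = "weight_B \<phi> \<delta> \<kappa> x" and f = f and c = c,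
            OF weight_B_nonneg \<alpha> lower])
    then have "\<alpha> * (norm d)\<^sup>2 \<le> weighted_square g x m"
      by (simp add: weighted_square_def f)
    then have "(norm d)\<^sup>2 \<le> 1 / \<alpha> * weighted_square g x m"
      using \<alpha> by (simp add: field_simps)
    then have "ennreal ((norm d)\<^sup>2) \<le> ennreal (1 / \<alpha>) * ennreal (weighted_square g x m)"
      using \<alpha> by (simp add: ennreal_mult'[symmetric] ennreal_leI)
    then show ?thesis
      unfolding w L2_norm_error_power2[OF f g orth] G_def by (rule add_left_mono)
  qed
  have "(\<integral>\<^sup>+ x. (L2_norm M (\<lambda>z. f z - wls \<phi> m x (weight_B \<phi> \<delta> \<kappa> x) f z))\<^sup>2 \<partial>chain.law m)
      \<le> (\<integral>\<^sup>+ x. ennreal G + ennreal (1 / \<alpha>) * ennreal (weighted_square g x m) \<partial>chain.law m)"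
    by (intro nn_integral_mono_AE eventually_mono[OF AE_admissible] err)
  also have "\<dots> = ennreal G + ennreal (1 / \<alpha>) * (\<integral>\<^sup>+ x. ennreal (weighted_square g x m) \<partial>chain.law m)"
    by (subst nn_integral_add) (simp_all add: nn_integral_cmult L.emeasure_space_1)
  also have "\<dots> \<le> ennreal G + ennreal (1 / \<alpha>) * ennreal (real m * (C * G))"
    unfolding C_def G_def
    by (intro add_left_mono mult_left_mono weighted_square_expectation g \<kappa>1) simp
  also have "\<dots> = ennreal (G + 1 / \<alpha> * (real m * (C * G)))"
    using C G \<alpha> by (simp add: ennreal_mult'[symmetric])
  also have "G + 1 / \<alpha> * (real m * (C * G)) = (1 + real m * C / \<alpha>) * G"
    by (simp add: distrib_right)
  also have "ennreal \<dots> = ennreal (1 + real m * C / \<alpha>) * ennreal G"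
    using C G \<alpha> by (intro ennreal_mult) auto
  finally show ?thesis
    unfolding law_B_eq C_def G_def .
qed

text \<open>\<open>lin_comb \<phi> c\<close> is arbitrary here, not the L2 projection, so that it
  can become a best approximation in the uniform norm. With all values |f -
  \<open>lin_comb \<phi> c\<close>| at the sample points at most t and all weights at most \<delta>
  / (\<kappa> (1 - \<delta>)), one gets |d| \<le> B t.\<close>

lemma error_bound_almost_sure:
  assumes f [measurable]: "f \<in> borel_measurable M"
    and \<kappa>0: "0 < \<kappa>" and \<alpha>: "0 < \<alpha>" and \<alpha>_eq: "\<alpha> = real m * \<delta> - (real CARD('n) - 1)"
    and B: "0 < B" and B_eq: "B\<^sup>2 = real m * (\<delta> / (\<kappa> * (1 - \<delta>))) / \<alpha>"
  shows "AE x in law_B M \<phi> \<delta> \<kappa> m.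
    L2_norm M (\<lambda>z. f z - wls \<phi> m x (weight_B \<phi> \<delta> \<kappa> x) f z)
      \<le> ennreal (1 + B) * Linf_norm M (\<lambda>z. f z - lin_comb \<phi> c z)"
proof (cases "Linf_norm M (\<lambda>z. f z - lin_comb \<phi> c z)")
  case top
  have "ennreal (1 + B) \<noteq> 0" using B by simp
  then show ?thesis unfolding top by (simp add: ennreal_mult_top)
next
  case (real t)
  define u where "u z = f z - lin_comb \<phi> c z" for z
  have [measurable]: "u \<in> borel_measurable M" unfolding u_def by measurable
  have u: "AE y in M. cmod (u y) \<le> t"
    using Linf_norm_le_iff[of u t] real by (simp add: u_def[abs_def])
  have "AE x in chain.law m. \<forall>j\<in>{1..m}. cmod (u (x j)) \<le> t"
    by (rule AE_points[OF _ u]) measurable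
  then show ?thesis
    using AE_admissible[of m] unfolding law_B_eq
  proof eventually_elim
    case (elim x)
    have lower: "\<alpha> * (norm v)\<^sup>2 \<le> v \<bullet> ((\<Sum>i=1..m. weight_B \<phi> \<delta> \<kappa> x i *\<^sub>R outer (\<phi> (x i))) *v v)" for v
      using matrix_B_lower_bound[OF elim(2), of v] unfolding \<alpha>_eq matrix_B_eq_sum .
    obtain d where w: "wls \<phi> m x (weight_B \<phi> \<delta> \<kappa> x) f = lin_comb \<phi> (c + d)"
      and "\<alpha> * (norm d)\<^sup>2 \<le> (\<Sum>i=1..m. weight_B \<phi> \<delta> \<kappa> x i * (cmod (f (x i) - lin_comb \<phi> c (x i)))\<^sup>2)"
      by (rule wls_perturbation[where s = "weight_B \<phi> \<delta> \<kappa> x" and f = f and c = c,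
            OF weight_B_nonneg \<alpha> lower])
    note this(2)
    also have "\<dots> \<le> (\<Sum>i=1..m. \<delta> / (\<kappa> * (1 - \<delta>)) * t\<^sup>2)"
      using elim(1) \<delta> \<kappa>0 unfolding u_def
      by (intro sum_mono mult_mono weight_B_le power_mono) auto
    finally have "\<alpha> * (norm d)\<^sup>2 \<le> \<alpha> * (B * t)\<^sup>2"
      using \<alpha> by (simp add: power_mult_distrib B_eq mult.assoc)
    then have d: "(norm d)\<^sup>2 \<le> (B * t)\<^sup>2" using \<alpha> by simp
    have "f z - lin_comb \<phi> (c + d) z = u z - lin_comb \<phi> d z" for z
      by (simp add: u_def lin_comb_add)
    then have "L2_norm M (\<lambda>z. f z - wls \<phi> m x (weight_B \<phi> \<delta> \<kappa> x) f z) \<le> ennreal ((1 + B) * t)"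
      unfolding w using L2_norm_diff_le[OF _ u real(1) B d] by simp
    also have "\<dots> = ennreal (1 + B) * ennreal t"
      using B real(1) by (intro ennreal_mult) auto
    finally show ?case unfolding real(2) .
  qed
qed

end

text \<open>Here q = r^(-1/4) is both \<epsilon> and p, and \<gamma> makes 1 / p + \<gamma> = 1 /
  q^2, whence \<alpha> = n (1 - q) / q. In the error factor, \<eta>^2, \<gamma>^-2 and \<alpha>^-2
  each contribute (1 - q)^-2 and the conditioning contributes (1 - q)^-1, which makes the seventh
  power.\<close>

lemma constant_A:
  fixes q :: real
  assumes q: "0 < q" "q < 1" and n: "0 < n" and m: "0 \<le> m"
    and r: "(m + 1) / n = 1 / q ^ 4"
  shows "n * (q * ((m + 1) / n) / (1 / q + (1 / q\<^sup>2 - 1 / q)) - 1) = n * ((1 - q) / q)"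
    and "m * (n * (eta q)\<^sup>2 / (1 / q\<^sup>2 - 1 / q)\<^sup>2) / ((n * ((1 - q) / q))\<^sup>2 * (1 - q))
      \<le> 1 / ((m + 1) / n * (1 - q) ^ 7)"
proof -
  show "n * (q * ((m + 1) / n) / (1 / q + (1 / q\<^sup>2 - 1 / q)) - 1) = n * ((1 - q) / q)"
    unfolding r using q by (simp add: field_simps eval_nat_numeral)
  have g: "1 / q\<^sup>2 - 1 / q = (1 - q) / q\<^sup>2"
    using q by (simp add: field_simps power2_eq_square)
  define v where "v = 1 - q"
  have v: "0 < v" using q by (simp add: v_def)
  have "m * (n * (eta q)\<^sup>2 / (1 / q\<^sup>2 - 1 / q)\<^sup>2) / ((n * ((1 - q) / q))\<^sup>2 * (1 - q))
      = m / n * (q ^ 8 / (1 - q) ^ 7)"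
    unfolding g eta_def v_def[symmetric] using q v n by (simp add: field_simps eval_nat_numeral)
  \<comment> \<open>Passing from m to m + 1 makes the prefactor equal to r, and r q^8 = 1 /
    r.\<close>
  also have "\<dots> \<le> (m + 1) / n * (q ^ 8 / (1 - q) ^ 7)"
    using q n by (intro mult_right_mono divide_right_mono) auto
  also have "\<dots> = 1 / ((m + 1) / n * (1 - q) ^ 7)"
    unfolding r using q by (simp add: field_simps eval_nat_numeral)
  finally show "m * (n * (eta q)\<^sup>2 / (1 / q\<^sup>2 - 1 / q)\<^sup>2) / ((n * ((1 - q) / q))\<^sup>2 * (1 - q))
      \<le> 1 / ((m + 1) / n * (1 - q) ^ 7)" .
qed

text \<open>Here s is the square root of r, \<delta> = 1 / s, and n stands for the dimension minus
  1. The parameter k is 1 - \<kappa> for the bound in expectation and \<kappa> for the almost sure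
  one.\<close>

lemma constant_B:
  fixes s :: real
  assumes s: "1 < s" and k: "0 < k" and r: "m = s\<^sup>2 * n" and n: "0 < n"
  shows "m * (1 / s) - n = n * (s - 1)"
    and "m * (1 / s / (k * (1 - 1 / s))) / (n * (s - 1)) = 1 / k * (1 / (1 - 1 / s)\<^sup>2)"
proof -
  show "m * (1 / s) - n = n * (s - 1)"
    unfolding r using s by (simp add: power2_eq_square algebra_simps)
  have "1 - 1 / s = (s - 1) / s" using s by (simp add: field_simps)
  then show "m * (1 / s / (k * (1 - 1 / s))) / (n * (s - 1)) = 1 / k * (1 / (1 - 1 / s)\<^sup>2)"
    unfolding r using s k n by (simp add: power2_eq_square)
qed

theorem theorem1p1:
  fixes M :: "'a measure"
    and V :: "('a \<Rightarrow> complex) set"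
    and \<phi> :: "'a \<Rightarrow> complex^'n"
    and f :: "'a \<Rightarrow> complex"
    and m :: nat
  assumes "prob_space M"
    and "L2_subspace M V"
    and "L2_orthonormal_basis M V \<phi>"
    and "m \<ge> CARD('n)"
    and "f \<in> borel_measurable M"
  shows
    "(let r = (real m + 1) / real CARD('n);
          \<epsilon> = r powr (- 1 / 4);
          \<gamma> = r powr (1 / 2) - r powr (1 / 4);
          p = r powr (- 1 / 4);
          err = (\<lambda>x. L2_norm M (\<lambda>z. f z - wls \<phi> m x (weight_A \<phi> \<epsilon> \<gamma> x) f z))
      in prob_space (law_A M \<phi> \<epsilon> \<gamma> m) \<and>
         measure (law_A M \<phi> \<epsilon> \<gamma> m) (event_A M \<phi> \<epsilon> \<gamma> p m) \<ge> 1 - p \<and>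
         (\<exists>v. is_arg_min (\<lambda>v. L2_norm M (\<lambda>z. f z - v z)) (\<lambda>v. v \<in> V) v \<and>
              (\<integral>\<^sup>+ x. (err x)\<^sup>2 \<partial>(cond_law_A M \<phi> \<epsilon> \<gamma> p m))
                \<le> ennreal (1 + 1 / (r * (1 - r powr (- 1 / 4)) ^ 7))
                    * (L2_norm M (\<lambda>z. f z - v z))\<^sup>2)) \<and>
     (CARD('n) \<ge> 2 \<longrightarrow>
      (\<forall>\<kappa>\<in>{0..1}.
        let r = real m / (real CARD('n) - 1);
            \<delta> = r powr (- 1 / 2);
            err = (\<lambda>x. L2_norm M (\<lambda>z. f z - wls \<phi> m x (weight_B \<phi> \<delta> \<kappa> x) f z))
        in prob_space (law_B M \<phi> \<delta> \<kappa> m) \<and>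
           (\<kappa> < 1 \<longrightarrow>
             (\<exists>v. is_arg_min (\<lambda>v. L2_norm M (\<lambda>z. f z - v z)) (\<lambda>v. v \<in> V) v \<and>
                  (\<integral>\<^sup>+ x. (err x)\<^sup>2 \<partial>(law_B M \<phi> \<delta> \<kappa> m))
                    \<le> ennreal (1 + 1 / (1 - \<kappa>) * (1 / (1 - 1 / sqrt r)\<^sup>2))
                        * (L2_norm M (\<lambda>z. f z - v z))\<^sup>2)) \<and>
           (\<kappa> > 0 \<and> V \<subseteq> Linf_space M \<longrightarrow>
             (\<exists>v. is_arg_min (\<lambda>v. Linf_norm M (\<lambda>z. f z - v z)) (\<lambda>v. v \<in> V) v \<and>
                  (AE x in law_B M \<phi> \<delta> \<kappa> m.
                    err x \<le> ennreal (1 + 1 / sqrt \<kappa> * (1 / (1 - 1 / sqrt r)))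
                              * Linf_norm M (\<lambda>z. f z - v z))))))"
proof -
  interpret L2_basis M V \<phi>
    using assms(1-3) by (simp add: L2_basis_def L2_basis_axioms_def)
  note f = assms(5)
  define r where "r = (real m + 1) / real CARD('n)"
  define q where "q = r powr (- 1 / 4)"
  define \<gamma> where "\<gamma> = r powr (1 / 2) - r powr (1 / 4)"
  have "1 < r" using assms(4) by (simp add: r_def)
  have q: "0 < q" "q < 1"
    using \<open>1 < r\<close> powr_less_mono[of "- 1 / 4" 0 r] by (auto simp: q_def)
  \<comment> \<open>All parameters of algorithm A become rational functions of q.\<close>
  have r4: "r powr (1 / 4) = 1 / q" "r powr (1 / 2) = 1 / q\<^sup>2" "r = 1 / q ^ 4"
  proof -
    have "q = 1 / r powr (1 / 4)"
      unfolding q_def using powr_minus_divide[of r "1 / 4"] by simp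
    then show 1: "r powr (1 / 4) = 1 / q" by simp
    have "r powr (1 / 2) = r powr (1 / 4) * r powr (1 / 4)"
      unfolding powr_add[symmetric] by simp
    then show 2: "r powr (1 / 2) = 1 / q\<^sup>2"
      unfolding 1 by (simp add: power2_eq_square)
    have "r = r powr (1 / 2) * r powr (1 / 2)"
      unfolding powr_add[symmetric] using \<open>1 < r\<close> by simp
    then show "r = 1 / q ^ 4"
      unfolding 2 by (simp add: power_add[symmetric])
  qed
  have \<gamma>_eq: "\<gamma> = 1 / q\<^sup>2 - 1 / q" unfolding \<gamma>_def r4(1,2) ..
  have \<gamma>: "0 < \<gamma>" unfolding \<gamma>_eq using q by (simp add: field_simps power2_eq_square)
  interpret A: algorithm_A M V \<phi> q \<gamma>
    by unfold_locales (use q \<gamma> in auto)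
  note const_A = constant_A[OF q, of "real CARD('n)" "real m", folded \<gamma>_eq r_def, OF _ _ r4(3)]
  have \<alpha>: "0 < real CARD('n) * ((1 - q) / q)" using q by simp
  have A3: "\<exists>v. is_arg_min (\<lambda>v. L2_norm M (\<lambda>z. f z - v z)) (\<lambda>v. v \<in> V) v \<and>
      (\<integral>\<^sup>+ x. (L2_norm M (\<lambda>z. f z - wls \<phi> m x (weight_A \<phi> q \<gamma> x) f z))\<^sup>2 \<partial>cond_law_A M \<phi> q \<gamma> q m)
        \<le> ennreal (1 + 1 / (r * (1 - q) ^ 7)) * (L2_norm M (\<lambda>z. f z - v z))\<^sup>2"
  proof (rule L2_error_bound_cases[OF f])
    show "0 < 1 + 1 / (r * (1 - q) ^ 7)"
      using \<open>1 < r\<close> q by (intro add_pos_nonneg) auto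
    fix g c
    assume d: "\<And>x. f x = g x + lin_comb \<phi> c x" "square_integrable M g"
      "\<And>j. (\<integral>x. g x * cnj (\<phi> x $ j) \<partial>M) = 0"
    have "(\<integral>\<^sup>+ x. (L2_norm M (\<lambda>z. f z - wls \<phi> m x (weight_A \<phi> q \<gamma> x) f z))\<^sup>2 \<partial>cond_law_A M \<phi> q \<gamma> q m)
        \<le> ennreal (1 + real m * (real CARD('n) * (eta q)\<^sup>2 / \<gamma>\<^sup>2)
            / ((real CARD('n) * ((1 - q) / q))\<^sup>2 * (1 - q))) * ennreal (\<integral>x. (cmod (g x))\<^sup>2 \<partial>M)"
      by (rule A.conditional_error_bound[OF d \<gamma> q \<alpha>]) (simp add: const_A(1) flip: r_def)
    also have "\<dots> \<le> ennreal (1 + 1 / (r * (1 - q) ^ 7)) * ennreal (\<integral>x. (cmod (g x))\<^sup>2 \<partial>M)"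
      using const_A(2) by (intro mult_right_mono ennreal_leI add_left_mono) auto
    finally show "(\<integral>\<^sup>+ x. (L2_norm M (\<lambda>z. f z - wls \<phi> m x (weight_A \<phi> q \<gamma> x) f z))\<^sup>2
        \<partial>cond_law_A M \<phi> q \<gamma> q m)
        \<le> ennreal (1 + 1 / (r * (1 - q) ^ 7)) * ennreal (\<integral>x. (cmod (g x))\<^sup>2 \<partial>M)" .
  qed
  have partA: "prob_space (law_A M \<phi> q \<gamma> m)" "1 - q \<le> measure (law_A M \<phi> q \<gamma> m) (event_A M \<phi> q \<gamma> q m)"
    using A.prob_space_law A.event_A_prob[OF q(1)] by (simp_all add: A.law_A_eq)
  have partB: "prob_space (law_B M \<phi> \<delta> \<kappa> m) \<and>
      (\<kappa> < 1 \<longrightarrow> (\<exists>v. is_arg_min (\<lambda>v. L2_norm M (\<lambda>z. f z - v z)) (\<lambda>v. v \<in> V) v \<and>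
        (\<integral>\<^sup>+ x. (L2_norm M (\<lambda>z. f z - wls \<phi> m x (weight_B \<phi> \<delta> \<kappa> x) f z))\<^sup>2 \<partial>law_B M \<phi> \<delta> \<kappa> m)
          \<le> ennreal (1 + 1 / (1 - \<kappa>) * (1 / (1 - 1 / s)\<^sup>2)) * (L2_norm M (\<lambda>z. f z - v z))\<^sup>2)) \<and>
      (\<kappa> > 0 \<and> V \<subseteq> Linf_space M \<longrightarrow>
        (\<exists>v. is_arg_min (\<lambda>v. Linf_norm M (\<lambda>z. f z - v z)) (\<lambda>v. v \<in> V) v \<and>
          (AE x in law_B M \<phi> \<delta> \<kappa> m.
            L2_norm M (\<lambda>z. f z - wls \<phi> m x (weight_B \<phi> \<delta> \<kappa> x) f z)
              \<le> ennreal (1 + 1 / sqrt \<kappa> * (1 / (1 - 1 / s))) * Linf_norm M (\<lambda>z. f z - v z))))"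
    if n: "2 \<le> CARD('n)" and \<kappa>: "\<kappa> \<in> {0..1}"
      and s_eq: "s = sqrt (real m / (real CARD('n) - 1))"
      and \<delta>_eq: "\<delta> = (real m / (real CARD('n) - 1)) powr (- 1 / 2)" for \<kappa> s \<delta>
  proof -
    have n1: "0 < real CARD('n) - 1" using n by simp
    have s: "1 < s" using assms(4) n1 by (simp add: s_eq)
    have m: "real m = s\<^sup>2 * (real CARD('n) - 1)"
      using n1 by (simp add: s_eq)
    have \<delta>: "\<delta> = 1 / s"
      unfolding \<delta>_eq s_eq using n1 by (simp add: powr_minus_divide powr_half_sqrt)
    interpret B: algorithm_B M V \<phi> \<delta> \<kappa>
      by unfold_locales (use s \<kappa> in \<open>auto simp: \<delta>\<close>)
    define \<alpha> where "\<alpha> = (real CARD('n) - 1) * (s - 1)"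
    have \<alpha>: "0 < \<alpha>" "\<alpha> = real m * \<delta> - (real CARD('n) - 1)"
      unfolding \<alpha>_def \<delta> using n1 s constant_B(1)[OF s zero_less_one m n1] by auto
    have const_B: "real m * (\<delta> / (k * (1 - \<delta>))) / \<alpha> = 1 / k * (1 / (1 - 1 / s)\<^sup>2)" if "0 < k" for k
      unfolding \<delta> \<alpha>_def by (rule constant_B(2)[OF s that m n1])
    have "prob_space (law_B M \<phi> \<delta> \<kappa> m)"
      using B.prob_space_law by (simp add: B.law_B_eq)
    moreover have "\<exists>v. is_arg_min (\<lambda>v. L2_norm M (\<lambda>z. f z - v z)) (\<lambda>v. v \<in> V) v \<and>
        (\<integral>\<^sup>+ x. (L2_norm M (\<lambda>z. f z - wls \<phi> m x (weight_B \<phi> \<delta> \<kappa> x) f z))\<^sup>2 \<partial>law_B M \<phi> \<delta> \<kappa> m)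
          \<le> ennreal (1 + 1 / (1 - \<kappa>) * (1 / (1 - 1 / s)\<^sup>2)) * (L2_norm M (\<lambda>z. f z - v z))\<^sup>2"
      if \<kappa>1: "\<kappa> < 1"
    proof (rule L2_error_bound_cases[OF f])
      show "0 < 1 + 1 / (1 - \<kappa>) * (1 / (1 - 1 / s)\<^sup>2)"
        using \<kappa>1 by (intro add_pos_nonneg) auto
      show "(\<integral>\<^sup>+ x. (L2_norm M (\<lambda>z. f z - wls \<phi> m x (weight_B \<phi> \<delta> \<kappa> x) f z))\<^sup>2 \<partial>law_B M \<phi> \<delta> \<kappa> m)
          \<le> ennreal (1 + 1 / (1 - \<kappa>) * (1 / (1 - 1 / s)\<^sup>2)) * ennreal (\<integral>x. (cmod (g x))\<^sup>2 \<partial>M)"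
        if "\<And>x. f x = g x + lin_comb \<phi> c x" "square_integrable M g"
          "\<And>j. (\<integral>x. g x * cnj (\<phi> x $ j) \<partial>M) = 0" for g c
        using B.error_bound_expectation[OF that \<kappa>1 \<alpha>]
        unfolding const_B[OF diff_gt_0_iff_gt[THEN iffD2, OF \<kappa>1]] .
    qed
    moreover have "\<exists>v. is_arg_min (\<lambda>v. Linf_norm M (\<lambda>z. f z - v z)) (\<lambda>v. v \<in> V) v \<and>
        (AE x in law_B M \<phi> \<delta> \<kappa> m.
          L2_norm M (\<lambda>z. f z - wls \<phi> m x (weight_B \<phi> \<delta> \<kappa> x) f z)
            \<le> ennreal (1 + 1 / sqrt \<kappa> * (1 / (1 - 1 / s))) * Linf_norm M (\<lambda>z. f z - v z))"
      if \<kappa>0: "0 < \<kappa>" and V: "V \<subseteq> Linf_space M"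
    proof -
      obtain c where c: "is_arg_min (\<lambda>v. Linf_norm M (\<lambda>z. f z - v z)) (\<lambda>v. v \<in> V) (lin_comb \<phi> c)"
        using Linf_norm_best_approximation[OF f V] by blast
      have "0 < 1 / sqrt \<kappa> * (1 / (1 - 1 / s))"
        using \<kappa>0 s by simp
      \<comment> \<open>The constant of the uniform bound is the square root of the error factor in
        expectation, with \<kappa> in place of 1 - \<kappa>.\<close>
      moreover have "(1 / sqrt \<kappa> * (1 / (1 - 1 / s)))\<^sup>2 = real m * (\<delta> / (\<kappa> * (1 - \<delta>))) / \<alpha>"
        unfolding const_B[OF \<kappa>0] using \<kappa>0 by (simp add: power_mult_distrib power_divide)
      ultimately show ?thesis
        using c B.error_bound_almost_sure[OF f \<kappa>0 \<alpha>] by blast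
    qed
    ultimately show ?thesis by blast
  qed
  show ?thesis
    unfolding Let_def r_def[symmetric] q_def[symmetric] \<gamma>_def[symmetric]
    using partA A3 by (intro conjI impI ballI partB refl)
qed

end
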